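(* Let $V\subset\mathbb{R}^n$ be a semi-algebraic set and let $\mathcal{G}$ be a (possibly infinite) proper family of continuous semi-algebraic functions $V\to\mathbb{R}_{>0}$. Let $\hat V=V\cup\{\infty\}$ be the Alexandrov compactification of $V$, let $M=\varprojlim_{\mathcal{F}\in P_{\mathcal{G}}}\overline{E_{\mathcal{F}}(V)}$, let $L_{\mathcal{G}}:V\to M$ be the map induced by the maps $L_{\mathcal{F}}$, and let $\overline{V}_{\mathcal{G}}$ be the closure in $\hat V\times M$ of the image of $i:V\to\hat V\times M$, $i(x)=(x,L_{\mathcal{G}}(x))$. Then $i:V\to\overline V_{\mathcal{G}}$ is a compactification of $V$, and the boundary $\partial_{\mathcal{G}}V=\overline V_{\mathcal{G}}\setminus i(V)$ is the set $\varprojlim_{\mathcal{F}\in P_{\mathcal{G}}}\partial_{\mathcal{F}}V$.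
   Context: A compactification of $V$ is a topological embedding of $V$ onto an open dense subset of a compact space. For $0<t<1$ let $\mathrm{Log}_{1/t}:(\mathbb{R}_{>0})^m\to\mathbb{R}^m$ be the componentwise logarithm in base $1/t$. For $W\subset(\mathbb{R}_{>0})^m$ let $\mathcal{A}_t(W)=\mathrm{Log}_{1/t}(W)$ and let $\mathcal{A}_0(W)$ (logarithmic limit set) be the set of $x\in\mathbb{R}^m$ for which there are $t_k\to0^+$ and $w_k\in W$ with $\mathrm{Log}_{1/t_k}(w_k)\to x$; it is a closed cone. For $W$ closed semi-algebraic put $\partial W=(\mathcal{A}_0(W)\setminus\{0\})/\!\sim$, where $x\sim y$ iff $x=\lambda y$ for some $\lambda>0$, viewed as a subset of $S^{m-1}$. Compactify $\mathbb{R}^m$ to the closed ball $D^m=\mathbb{R}^m\cup S^{m-1}$ via $x\mapsto x/\sqrt{1+\|x\|^2}$. Fix $t_0\in(0,1)$; $\overline W=\mathcal{A}_{t_0}(W)\cup\partial W$ is the closure of $\mathcal{A}_{t_0}(W)$ in $D^m$. A finite family $\mathcal{F}=\{f_1,\dots,f_m\}$ of continuous semi-algebraic functions $V\to\mathbb{R}_{>0}$ is proper if $E_{\mathcal{F}}=(f_1,\dots,f_m):V\to(\mathbb{R}_{>0})^m$ is a proper map; then $E_{\mathcal{F}}(V)$ is closed semi-algebraic; put $L_{\mathcal{F}}=\mathrm{Log}_{1/t_0}\circ E_{\mathcal{F}}$ and $\partial_{\mathcal{F}}V=\partial E_{\mathcal{F}}(V)$. An arbitrary family $\mathcal{G}$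 is proper if it contains a finite proper subfamily; $P_{\mathcal{G}}$ is the set of finite proper subfamilies of $\mathcal{G}$, ordered by inclusion. For $\mathcal{F}\subset\mathcal{F}'$ in $P_{\mathcal{G}}$ the coordinate projection $\mathbb{R}^{\mathcal{F}'}\to\mathbb{R}^{\mathcal{F}}$ maps $\mathcal{A}_{t_0}(E_{\mathcal{F}'}(V))$ onto $\mathcal{A}_{t_0}(E_{\mathcal{F}}(V))$ and induces a map $\partial_{\mathcal{F}'}V\to\partial_{\mathcal{F}}V$; these maps are the bonding maps of the inverse systems $\{\overline{E_{\mathcal{F}}(V)}\}$ and $\{\partial_{\mathcal{F}}V\}$. *)

theory Defs
  imports "HOL-Analysis.Analysis"
begin

section \<open>Semi-algebraic sets and functions\<close>

inductive semialgebraic :: "'a::euclidean_space set \<Rightarrow> bool" where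
  pos: "real_polynomial_function p \<Longrightarrow> semialgebraic {x. p x > 0}"
| compl: "semialgebraic A \<Longrightarrow> semialgebraic (- A)"
| inter: "semialgebraic A \<Longrightarrow> semialgebraic B \<Longrightarrow> semialgebraic (A \<inter> B)"
| union: "semialgebraic A \<Longrightarrow> semialgebraic B \<Longrightarrow> semialgebraic (A \<union> B)"

definition semialgebraic_fun :: "'a::euclidean_space set \<Rightarrow> ('a \<Rightarrow> real) \<Rightarrow> bool" where
  "semialgebraic_fun V f \<longleftrightarrow> semialgebraic ((\<lambda>x. (x, f x)) ` V)"

section \<open>Compactifications and inverse limits\<close>

definition compactification_map :: "'a topology \<Rightarrow> 'b topology \<Rightarrow> ('a \<Rightarrow> 'b) \<Rightarrow> bool" where
  "compactification_map X Y f \<longleftrightarrow>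
     compact_space Y \<and> embedding_map X Y f \<and> openin Y (f ` topspace X) \<and>
     Y closure_of (f ` topspace X) = topspace Y"

text \<open>The bonding map for \<open>le a c\<close> is \<open>b c a\<close>, from the space at \<open>c\<close> to the space at \<open>a\<close>.\<close>

definition inverse_limit_set ::
  "'i set \<Rightarrow> ('i \<Rightarrow> 'i \<Rightarrow> bool) \<Rightarrow> ('i \<Rightarrow> 'a set) \<Rightarrow> ('i \<Rightarrow> 'i \<Rightarrow> 'a \<Rightarrow> 'a) \<Rightarrow> ('i \<Rightarrow> 'a) set" where
  "inverse_limit_set P le S b =
     {z \<in> PiE P S. \<forall>a\<in>P. \<forall>c\<in>P. le a c \<longrightarrow> b c a (z c) = z a}"

definition inverse_limit ::
  "'i set \<Rightarrow> ('i \<Rightarrow> 'i \<Rightarrow> bool) \<Rightarrow> ('i \<Rightarrow> 'a topology) \<Rightarrow> ('i \<Rightarrow> 'i \<Rightarrow> 'a \<Rightarrow> 'a) \<Rightarrow> ('i \<Rightarrow> 'a) topology" where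
  "inverse_limit P le X b =
     subtopology (product_topology X P) (inverse_limit_set P le (\<lambda>a. topspace (X a)) b)"

section \<open>Logarithmic limit sets and the ball compactification\<close>

text \<open>For a finite index set \<open>I\<close>, the space \<open>\<real>\<^sup>I\<close> consists of the functions in
  \<open>I \<rightarrow>\<^sub>E UNIV\<close>, with the product topology; the Euclidean norm of \<open>x\<close> is \<open>L2_set x I\<close>.\<close>

abbreviation Rspace :: "'i set \<Rightarrow> ('i \<Rightarrow> real) topology" where
  "Rspace I \<equiv> product_topology (\<lambda>_. euclideanreal) I"

definition Log_map :: "'i set \<Rightarrow> real \<Rightarrow> ('i \<Rightarrow> real) \<Rightarrow> ('i \<Rightarrow> real)" where
  "Log_map I t w = (\<lambda>i\<in>I. log (1 / t) (w i))"

definition amoeba :: "'i set \<Rightarrow> real \<Rightarrow> ('i \<Rightarrow> real) set \<Rightarrow> ('i \<Rightarrow> real) set" where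
  "amoeba I t W = Log_map I t ` W"

definition log_limit_set :: "'i set \<Rightarrow> ('i \<Rightarrow> real) set \<Rightarrow> ('i \<Rightarrow> real) set" where
  "log_limit_set I W =
     {x \<in> I \<rightarrow>\<^sub>E UNIV. \<exists>t w. (\<forall>k::nat. 0 < t k \<and> t k < 1 \<and> w k \<in> W) \<and> t \<longlonglongrightarrow> 0 \<and>
        limitin (Rspace I) (\<lambda>k. Log_map I (t k) (w k)) x sequentially}"

text \<open>A ray of \<open>\<real>\<^sup>I\<close> is represented by its unit vector, a point of the unit sphere.\<close>

definition direction :: "'i set \<Rightarrow> ('i \<Rightarrow> real) \<Rightarrow> ('i \<Rightarrow> real)" where
  "direction I x = (\<lambda>i\<in>I. x i / L2_set x I)"

definition boundary :: "'i set \<Rightarrow> ('i \<Rightarrow> real) set \<Rightarrow> ('i \<Rightarrow> real) set" where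
  "boundary I W = direction I ` (log_limit_set I W - {\<lambda>i\<in>I. 0})"

text \<open>The compactification of \<open>\<real>\<^sup>I\<close> is the closed unit ball of \<open>\<real>\<^sup>I\<close>, in which \<open>\<real>\<^sup>I\<close> sits as
  the open unit ball.\<close>

definition ball_map :: "'i set \<Rightarrow> ('i \<Rightarrow> real) \<Rightarrow> ('i \<Rightarrow> real)" where
  "ball_map I x = (\<lambda>i\<in>I. x i / sqrt (1 + (L2_set x I)\<^sup>2))"

definition amoeba_closure :: "'i set \<Rightarrow> real \<Rightarrow> ('i \<Rightarrow> real) set \<Rightarrow> ('i \<Rightarrow> real) set" where
  "amoeba_closure I t W = ball_map I ` amoeba I t W \<union> boundary I W"

text \<open>The map of closed balls determined by the coordinate projection \<open>\<real>\<^sup>J \<rightarrow> \<real>\<^sup>I\<close>, for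
  \<open>I \<subseteq> J\<close>: the projection itself on the open ball, the induced map of rays on the sphere.
  It is not meaningful at the points of the sphere whose projection is zero.\<close>

definition bond :: "'i set \<Rightarrow> 'i set \<Rightarrow> ('i \<Rightarrow> real) \<Rightarrow> ('i \<Rightarrow> real)" where
  "bond J I z =
     (if L2_set z J = 1 then direction I (restrict z I)
      else ball_map I (restrict (inv_into (J \<rightarrow>\<^sub>E UNIV) (ball_map J) z) I))"

section \<open>Proper families\<close>

text \<open>The functions \<open>V \<rightarrow> \<real>\<^sub>>\<^sub>0\<close> are the elements of \<open>V \<rightarrow>\<^sub>E {0<..}\<close>, and a finite family \<open>F\<close>
  of functions is its own index set.\<close>

definition cont_sa_funs :: "(real^'n) set \<Rightarrow> (real^'n \<Rightarrow> real) set" where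
  "cont_sa_funs V = {f \<in> V \<rightarrow>\<^sub>E {0<..}. continuous_on V f \<and> semialgebraic_fun V f}"

definition E_map :: "('a \<Rightarrow> real) set \<Rightarrow> 'a \<Rightarrow> ('a \<Rightarrow> real) \<Rightarrow> real" where
  "E_map F x = (\<lambda>f\<in>F. f x)"

definition finite_proper :: "(real^'n) set \<Rightarrow> (real^'n \<Rightarrow> real) set \<Rightarrow> bool" where
  "finite_proper V F \<longleftrightarrow> finite F \<and>
     proper_map (top_of_set V) (product_topology (\<lambda>_. top_of_set {0<..}) F) (E_map F)"

definition proper_subfamilies ::
  "(real^'n) set \<Rightarrow> (real^'n \<Rightarrow> real) set \<Rightarrow> (real^'n \<Rightarrow> real) set set" where
  "proper_subfamilies V G = {F. F \<subseteq> G \<and> finite_proper V F}"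

definition proper_family :: "(real^'n) set \<Rightarrow> (real^'n \<Rightarrow> real) set \<Rightarrow> bool" where
  "proper_family V G \<longleftrightarrow> (\<exists>F\<subseteq>G. finite_proper V F)"

section \<open>The compactification defined by a proper family\<close>

definition L_map :: "real \<Rightarrow> ('a \<Rightarrow> real) set \<Rightarrow> 'a \<Rightarrow> ('a \<Rightarrow> real) \<Rightarrow> real" where
  "L_map t F x = Log_map F t (E_map F x)"

definition M_space :: "real \<Rightarrow> (real^'n) set \<Rightarrow> (real^'n \<Rightarrow> real) set \<Rightarrow>
    ((real^'n \<Rightarrow> real) set \<Rightarrow> (real^'n \<Rightarrow> real) \<Rightarrow> real) topology" where
  "M_space t V G = inverse_limit (proper_subfamilies V G) (\<subseteq>)
     (\<lambda>F. subtopology (Rspace F) (amoeba_closure F t (E_map F ` V))) bond"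

definition L_lim :: "real \<Rightarrow> (real^'n) set \<Rightarrow> (real^'n \<Rightarrow> real) set \<Rightarrow>
    real^'n \<Rightarrow> (real^'n \<Rightarrow> real) set \<Rightarrow> (real^'n \<Rightarrow> real) \<Rightarrow> real" where
  "L_lim t V G x = (\<lambda>F\<in>proper_subfamilies V G. ball_map F (L_map t F x))"

definition iota :: "real \<Rightarrow> (real^'n) set \<Rightarrow> (real^'n \<Rightarrow> real) set \<Rightarrow> real^'n \<Rightarrow>
    (real^'n) option \<times> ((real^'n \<Rightarrow> real) set \<Rightarrow> (real^'n \<Rightarrow> real) \<Rightarrow> real)" where
  "iota t V G x = (Some x, L_lim t V G x)"

definition V_bar :: "real \<Rightarrow> (real^'n) set \<Rightarrow> (real^'n \<Rightarrow> real) set \<Rightarrow>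
    ((real^'n) option \<times> ((real^'n \<Rightarrow> real) set \<Rightarrow> (real^'n \<Rightarrow> real) \<Rightarrow> real)) topology" where
  "V_bar t V G =
     (let X = prod_topology (Alexandroff_compactification (top_of_set V)) (M_space t V G)
      in subtopology X (X closure_of (iota t V G ` V)))"

text \<open>This is a subset of the inverse limit underlying \<open>M_space\<close>.\<close>

definition boundary_lim :: "(real^'n) set \<Rightarrow> (real^'n \<Rightarrow> real) set \<Rightarrow>
    ((real^'n \<Rightarrow> real) set \<Rightarrow> (real^'n \<Rightarrow> real) \<Rightarrow> real) set" where
  "boundary_lim V G = inverse_limit_set (proper_subfamilies V G) (\<subseteq>)
     (\<lambda>F. boundary F (E_map F ` V)) bond"

end

theory Submission
  imports Defs "HOL-Computational_Algebra.Polynomial" "HOL-Library.Multiset"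
begin

text \<open>
  Topologically, the statement is a compactness argument. Let \<open>K\<^sub>F\<close> be the closure of the image of
  \<open>V\<close> in the closed ball of \<open>\<real>\<^sup>F\<close>, and let \<open>C\<close> be the closure of \<open>i(V)\<close> in the compact space
  \<open>V\<^sup>^ \<times> (\<Prod>F. K\<^sub>F)\<close>, where the factors are not yet tied together by bonding maps. Over \<open>V\<close> the set
  \<open>C\<close> is the graph of a continuous map, hence equal to \<open>i(V)\<close>. What has to be shown is that the
  points \<open>(\<infinity>, z)\<close> of \<open>C\<close> are exactly those with \<open>z\<close> in the inverse limit of the boundaries
  (\<open>closure_V_eq\<close>). Then \<open>C\<close> lies over the inverse limit \<open>M\<close>, so it is also the closure of \<open>i(V)\<close>
  taken over \<open>M\<close>; it is compact, and \<open>i\<close> is an open embedding into it because \<open>i(U)\<close> is,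
  for \<open>U \<subseteq> V\<close>, the preimage of \<open>U\<close> under the first projection.

  If \<open>(\<infinity>, z) \<in> C\<close>, then every \<open>z\<^sub>F\<close> lies on the sphere, since \<open>F\<close> is proper, and a limit point of
  the image on the sphere is a point of \<open>\<partial>\<^sub>F V\<close>: rescaling by the base of the logarithm turns points
  of \<open>K\<^sub>F\<close> near the sphere into points of amoebas (\<open>boundary_iff\<close>). Conversely, a compatible family
  \<open>z\<close> of boundary points is hit because each single \<open>z\<^sub>F\<close> is hit, the index set is directed, and
  \<open>C\<close> is compact.

  The compatibility of \<open>z\<close> with the bonding maps is where the functions have to be semi-algebraic.
  For \<open>F \<subseteq> F'\<close> the projection \<open>\<real>\<^sup>F\<^sup>' \<rightarrow> \<real>\<^sup>F\<close> must not kill the direction \<open>z\<^sub>F\<^sub>'\<close>, that is,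
  \<open>log E\<^sub>F\<close> has to grow at least linearly in \<open>log E\<^sub>F\<^sub>'\<close>. (A function of exponential growth
  in \<open>F'\<close> would violate this.) This is the inequality of Lojasiewicz type \<open>ln_growth_comparison\<close>: if \<open>F\<close> is proper
  and \<open>g\<close> is continuous and semi-algebraic, then \<open>|ln g| \<le> C (1 + \<Sum>f\<in>F. |ln f|)\<close>. Let \<open>K\<^sub>\<sigma>\<close> be
  the set where all \<open>f \<in> F\<close> lie in \<open>[1/\<sigma>, \<sigma>]\<close>. It is compact, so \<open>g\<close> and \<open>1/g\<close> are bounded on it,
  and the set of pairs \<open>(\<sigma>, \<zeta>)\<close> such that \<open>\<zeta>\<close> is a value of \<open>g\<close> or \<open>1/g\<close> on \<open>K\<^sub>\<sigma>\<close> is a projection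
  of a semi-algebraic set. By the theorem of Tarski and Seidenberg it is determined by the signs of
  finitely many polynomials in \<open>\<sigma>\<close> and \<open>\<zeta>\<close>. These signs are constant for \<open>\<zeta> > \<sigma>\<^sup>M\<close>, so a fibre
  that is bounded lies below \<open>\<sigma>\<^sup>M\<close>.

  The theorem of Tarski and Seidenberg is proved by the method of Cohen and Hoermander. Instead of
  sign tables, two parameters \<open>e\<close> and \<open>e'\<close> are compared: if finitely many polynomials in the
  parameters have the same signs at \<open>e\<close> and \<open>e'\<close>, then a finite partial order isomorphism of the
  line matches the sign conditions of the polynomials with coefficients specialised at \<open>e\<close> with
  those specialised at \<open>e'\<close> (\<open>uniform_sign_matching\<close>). The induction replaces a polynomial
  \<open>p\<close> of maximal degree by its derivative and by its remainders modulo the others: the remainders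
  give the signs of \<open>p\<close> at the roots of the others, and between these roots \<open>p\<close> is monotone.
\<close>

section \<open>Matching the signs of two families of functions on the line\<close>

text \<open>Partial isomorphisms of the real line, as sets of pairs. That \<open>insert (y, y') T\<close> is again a
  partial isomorphism says that \<open>y\<close> and \<open>y'\<close> lie in corresponding cells (points or open intervals)
  of the two subdivisions of the line by the first and by the second components of \<open>T\<close>.\<close>

definition partial_iso :: "(real \<times> real) set \<Rightarrow> bool" where
  "partial_iso T \<longleftrightarrow> (\<forall>a a' b b'. (a, a') \<in> T \<longrightarrow> (b, b') \<in> T \<longrightarrow> (a < b \<longleftrightarrow> a' < b'))"

lemma partial_iso_insert:
  "partial_iso (insert (y, y') T) \<longleftrightarrow>
     partial_iso T \<and> (\<forall>a a'. (a, a') \<in> T \<longrightarrow> (a < y \<longleftrightarrow> a' < y') \<and> (y < a \<longleftrightarrow> y' < a'))"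
  unfolding partial_iso_def by (intro iffI conjI allI impI) (auto; blast)+

lemma partial_iso_converse: "partial_iso (T\<inverse>) \<longleftrightarrow> partial_iso T"
  unfolding partial_iso_def converse_iff by blast

lemma partial_iso_less: "partial_iso T \<Longrightarrow> (a, a') \<in> T \<Longrightarrow> (b, b') \<in> T \<Longrightarrow> a < b \<longleftrightarrow> a' < b'"
  unfolding partial_iso_def by blast

lemma partial_iso_eq:
  assumes "partial_iso T" "(a, a') \<in> T" "(b, b') \<in> T"
  shows "a = b \<longleftrightarrow> a' = b'"
  using partial_iso_less[OF assms] partial_iso_less[OF assms(1,3,2)] by linarith

lemma between_finite_sets:
  fixes L U :: "real set"
  assumes "finite L" "finite U" "\<And>l u. l \<in> L \<Longrightarrow> u \<in> U \<Longrightarrow> l < u"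
  obtains y where "\<And>l. l \<in> L \<Longrightarrow> l < y" "\<And>u. u \<in> U \<Longrightarrow> y < u"
proof -
  consider "L = {}" "U = {}" | "L = {}" "U \<noteq> {}" | "L \<noteq> {}" "U = {}" | "L \<noteq> {}" "U \<noteq> {}" by blast
  then show ?thesis
  proof cases
    case 1 then show ?thesis using that by blast
  next
    case 2 then show ?thesis using that[of "Min U - 1"] Min_le[OF assms(2)] by force
  next
    case 3 then show ?thesis using that[of "Max L + 1"] Max_ge[OF assms(1)] by force
  next
    case 4
    then have "Max L < Min U" using assms by simp
    then obtain y where "Max L < y" "y < Min U" using dense by blast
    then show ?thesis using that[of y] Max_ge[OF assms(1)] Min_le[OF assms(2)] by force
  qed
qed

text \<open>Back-and-forth: the order of the reals is dense and unbounded, so there is always room for the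
  partner of a new point.\<close>

lemma partial_iso_extend:
  assumes "finite T" "partial_iso T"
  obtains y' where "partial_iso (insert (y, y') T)"
proof (cases "y \<in> fst ` T")
  case True
  then obtain y' where "(y, y') \<in> T" by auto
  then have "partial_iso (insert (y, y') T)" using assms(2) by (simp add: insert_absorb)
  then show ?thesis by (rule that)
next
  case False
  let ?L = "{a'. \<exists>a. (a, a') \<in> T \<and> a < y}" and ?U = "{a'. \<exists>a. (a, a') \<in> T \<and> y < a}"
  have "finite (snd ` T)" using assms(1) by simp
  moreover have "?L \<subseteq> snd ` T" "?U \<subseteq> snd ` T" by force+
  ultimately have "finite ?L" "finite ?U" using finite_subset by blast+
  moreover have "l < u" if lu: "l \<in> ?L" "u \<in> ?U" for l u
  proof -
    obtain a b where "(a, l) \<in> T" "a < y" "(b, u) \<in> T" "y < b" using lu by blast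
    then show ?thesis using partial_iso_less[OF assms(2), of a l b u] by linarith
  qed
  ultimately obtain y' where y': "\<And>l. l \<in> ?L \<Longrightarrow> l < y'" "\<And>u. u \<in> ?U \<Longrightarrow> y' < u"
    using between_finite_sets[of ?L ?U] by blast
  have "(a < y \<longleftrightarrow> a' < y') \<and> (y < a \<longleftrightarrow> y' < a')" if "(a, a') \<in> T" for a a'
  proof -
    have "a \<noteq> y" using that False by force
    then consider "a < y" | "y < a" by linarith
    then show ?thesis
    proof cases
      case 1
      then have "a' < y'" using y'(1) that by blast
      then show ?thesis using 1 by simp
    next
      case 2
      then have "y' < a'" using y'(2) that by blast
      then show ?thesis using 2 by simp
    qed
  qed
  then have "partial_iso (insert (y, y') T)" using assms(2) by (auto simp: partial_iso_insert)
  then show ?thesis by (rule that)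
qed

text \<open>Paired functions have the same sign at any two points in corresponding cells. The signs of
  each function are then in particular constant on every cell.\<close>

definition sign_matching :: "(real \<times> real) set \<Rightarrow> ((real \<Rightarrow> real) \<times> (real \<Rightarrow> real)) set \<Rightarrow> bool" where
  "sign_matching T Q \<longleftrightarrow> finite T \<and> partial_iso T \<and>
     (\<forall>y y' q q'. partial_iso (insert (y, y') T) \<longrightarrow> (q, q') \<in> Q \<longrightarrow> sgn (q y) = sgn (q' y'))"

lemma sign_matching_point:
  assumes "sign_matching T Q" "(q, q') \<in> Q" "(y, y') \<in> T"
  shows "sgn (q y) = sgn (q' y')"
proof -
  have "partial_iso (insert (y, y') T)"
    using assms(1,3) by (simp add: sign_matching_def insert_absorb)
  then show ?thesis using assms(1,2) unfolding sign_matching_def by blast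
qed

lemma sign_matching_converse: "sign_matching (T\<inverse>) (Q\<inverse>) \<longleftrightarrow> sign_matching T Q"
proof -
  have *: "insert (y, y') (T\<inverse>) = (insert (y', y) T)\<inverse>" for y y' by auto
  show ?thesis unfolding sign_matching_def * partial_iso_converse
converse_iff finite_converse
    by metis
qed

lemma sign_matching_mono: "sign_matching T Q \<Longrightarrow> Q' \<subseteq> Q \<Longrightarrow> sign_matching T Q'"
  unfolding sign_matching_def by blast

text \<open>The sign of \<open>q\<close> is constant on cells, so a root inside an open cell would bring a whole interval
  of roots.\<close>

lemma sign_matching_roots:
  assumes "sign_matching T Q" "(q, q') \<in> Q" "finite {y. q y = 0}" "q y = 0"
  shows "y \<in> fst ` T"
proof (rule ccontr)
  assume y: "y \<notin> fst ` T"
  have T: "finite T" "partial_iso T" using assms(1) by (auto simp: sign_matching_def)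
  obtain y' where y': "partial_iso (insert (y, y') T)" using partial_iso_extend[OF T] .
  obtain u where u: "y < u" "\<And>a. a \<in> fst ` T \<Longrightarrow> y < a \<Longrightarrow> u < a"
  proof (rule between_finite_sets[of "{y}" "{a \<in> fst ` T. y < a}"])
    show "finite {a \<in> fst ` T. y < a}" using T(1) by simp
  qed auto
  have "q z = 0" if z: "z \<in> {y<..<u}" for z
  proof -
    have "partial_iso (insert (z, y') T)"
    proof -
      have "(a < z \<longleftrightarrow> a' < y') \<and> (z < a \<longleftrightarrow> y' < a')" if a: "(a, a') \<in> T" for a a'
      proof -
        have "a \<in> fst ` T" using a by force
        then have "a \<noteq> y" "y < a \<longrightarrow> u < a" using u(2) y by auto
        then have "a < z \<longleftrightarrow> a < y" "z < a \<longleftrightarrow> y < a" using z by auto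
        then show ?thesis using y' a unfolding partial_iso_insert by simp
      qed
      then show ?thesis using T(2) by (auto simp: partial_iso_insert)
    qed
    then have "sgn (q z) = sgn (q' y')" "sgn (q y) = sgn (q' y')"
      using assms(1,2) y' unfolding sign_matching_def by blast+
    then show ?thesis using assms(4) by (simp add: sgn_0_0)
  qed
  then have "{y<..<u} \<subseteq> {y. q y = 0}" by blast
  then show False using assms(3) infinite_Ioo[OF u(1)] finite_subset by blast
qed

lemma sgn_constant_without_root:
  fixes q :: "real \<Rightarrow> real"
  assumes "\<And>x. isCont q x" "\<And>w. min a b \<le> w \<Longrightarrow> w \<le> max a b \<Longrightarrow> q w \<noteq> 0"
  shows "sgn (q a) = sgn (q b)"
proof (rule ccontr)
  assume neq: "sgn (q a) \<noteq> sgn (q b)"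
  have *: False
    if le: "a \<le> b" and nz: "\<And>w. a \<le> w \<Longrightarrow> w \<le> b \<Longrightarrow> q w \<noteq> 0" and sg: "sgn (q a) \<noteq> sgn (q b)"
    for a b
  proof -
    have "q a \<noteq> 0" "q b \<noteq> 0" using le nz by auto
    then have "(q a \<le> 0 \<and> 0 \<le> q b) \<or> (q b \<le> 0 \<and> 0 \<le> q a)" using sg
      by (auto simp: sgn_if split: if_splits)
    then show False
    proof
      assume "q a \<le> 0 \<and> 0 \<le> q b"
      then show False using IVT[of q a 0 b] assms(1) le nz by blast
    next
      assume "q b \<le> 0 \<and> 0 \<le> q a"
      then show False using IVT2[of q b 0 a] assms(1) le nz by blast
    qed
  qed
  show False
  proof (cases "a \<le> b")
    case True then show False using *[of a b] assms(2) neq by auto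
  next
    case False then show False using *[of b a] assms(2) neq by auto
  qed
qed

text \<open>A matching may subdivide the line more finely than needed. Only the roots of the given functions
  are kept here: between them the functions have no sign change by the intermediate value
  theorem. This matters because at the other points nothing is known about the sign of a
  further function that is to be added.\<close>

lemma sign_matching_root_part:
  assumes sm: "sign_matching T Q"
    and cont: "\<And>q q' x. (q, q') \<in> Q \<Longrightarrow> isCont q x \<and> isCont q' x"
    and fin: "\<And>q q'. (q, q') \<in> Q \<Longrightarrow> finite {y. q y = 0} \<and> finite {y. q' y = 0}"
  shows "sign_matching {(y, y') \<in> T. \<exists>q q'. (q, q') \<in> Q \<and> q y = 0} Q" (is "sign_matching ?T0 Q")
proof -
  have T: "finite T" "partial_iso T" using sm by (auto simp: sign_matching_def)
  have sub: "?T0 \<subseteq> T" by blast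
  have piso: "partial_iso ?T0" using T(2) unfolding partial_iso_def by blast
  have match: "sgn (q y) = sgn (q' y')"
    if piso0: "partial_iso (insert (y, y') ?T0)" and q: "(q, q') \<in> Q" for y y' q q'
  proof (cases "y \<in> fst ` ?T0")
    case True
    then obtain t where t: "t \<in> ?T0" "y = fst t" by blast
    then have w: "(y, snd t) \<in> ?T0" by simp
    then have "snd t = y'" using partial_iso_eq[OF piso0, of y "snd t" y y'] by blast
    then have "(y, y') \<in> T" using w by blast
    then show ?thesis using sign_matching_point[OF sm q] by blast
  next
    case False
    obtain y1 where y1: "partial_iso (insert (y, y1) T)" using partial_iso_extend[OF T] .
    then have "sgn (q y) = sgn (q' y1)" using sm q unfolding sign_matching_def by blast
    also have "\<dots> = sgn (q' y')"
    proof (rule sgn_constant_without_root[of q'])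
      show "isCont q' x" for x using cont[OF q] by blast
      fix w assume w: "min y1 y' \<le> w" "w \<le> max y1 y'"
      show "q' w \<noteq> 0"
      proof
        assume z: "q' w = 0"
        have "w \<in> fst ` (T\<inverse>)"
        proof (rule sign_matching_roots[where q = q' and y = w])
          show "sign_matching (T\<inverse>) (Q\<inverse>)" using sm sign_matching_converse by blast
          show "(q', q) \<in> Q\<inverse>" using q by blast
          show "finite {y. q' y = 0}" using fin[OF q] by blast
          show "q' w = 0" by (fact z)
        qed
        then obtain u where u: "(u, w) \<in> T" by auto
        then have "sgn (q u) = sgn (q' w)" using sign_matching_point[OF sm q] by blast
        then have "q u = 0" using z by (simp add: sgn_0_0)
        then have u0: "(u, w) \<in> ?T0" using u q by blast
        then have "u \<noteq> y" using False by force
        moreover have "(u < y \<longleftrightarrow> w < y') \<and> (y < u \<longleftrightarrow> y' < w)"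
          using piso0 u0 unfolding partial_iso_insert by blast
        moreover have "(u < y \<longleftrightarrow> w < y1) \<and> (y < u \<longleftrightarrow> y1 < w)"
          using y1 u unfolding partial_iso_insert by blast
        ultimately show False using w by linarith
      qed
    qed
    finally show ?thesis .
  qed
  show ?thesis unfolding sign_matching_def using finite_subset[OF sub T(1)] piso match by blast
qed

text \<open>On an interval without critical points the signs at the two ends determine the signs inside,
  because the function is strictly monotone.\<close>

lemma signs_between_critical_points:
  fixes p :: "real \<Rightarrow> real"
  assumes der: "\<And>x. (p has_real_derivative dp x) (at x)" and cont: "\<And>x. isCont dp x"
    and nz: "\<forall>x. l < x \<longrightarrow> x < u \<longrightarrow> dp x \<noteq> 0" and lu: "l < u"
  shows "0 \<le> p l \<Longrightarrow> 0 \<le> p u \<Longrightarrow> l < y \<Longrightarrow> y < u \<Longrightarrow> 0 < p y"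
    and "p l \<le> 0 \<Longrightarrow> p u \<le> 0 \<Longrightarrow> l < y \<Longrightarrow> y < u \<Longrightarrow> p y < 0"
    and "p l * p u < 0 \<Longrightarrow> \<exists>a>l. a < u \<and> p a = 0 \<and>
      (\<forall>y. l < y \<longrightarrow> y < u \<longrightarrow> (y < a \<longrightarrow> sgn (p y) = sgn (p l)) \<and> (a < y \<longrightarrow> sgn (p y) = sgn (p u)))"
proof -
  have pos: "(0 \<le> p l \<longrightarrow> 0 \<le> p u \<longrightarrow> (\<forall>y. l < y \<longrightarrow> y < u \<longrightarrow> 0 < p y)) \<and>
      (p l \<le> 0 \<longrightarrow> p u \<le> 0 \<longrightarrow> (\<forall>y. l < y \<longrightarrow> y < u \<longrightarrow> p y < 0)) \<and>
      (p l * p u < 0 \<longrightarrow> (\<exists>a>l. a < u \<and> p a = 0 \<and>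
      (\<forall>y. l < y \<longrightarrow> y < u \<longrightarrow> (y < a \<longrightarrow> sgn (p y) = sgn (p l)) \<and> (a < y \<longrightarrow> sgn (p y) = sgn (p u)))))"
    if der: "\<And>x. (p has_real_derivative dp x) (at x)" and pos: "\<And>x. l < x \<Longrightarrow> x < u \<Longrightarrow> dp x > 0"
    for p dp :: "real \<Rightarrow> real"
  proof -
    have inc: "p x < p y" if xy: "l \<le> x" "x < y" "y \<le> u" for x y
    proof (rule DERIV_pos_imp_increasing_open[OF xy(2)])
      show "\<exists>d. (p has_real_derivative d) (at z) \<and> 0 < d" if z: "x < z" "z < y" for z
        using der[of z] pos[of z] xy z by auto
      show "continuous_on {x..y} p"
        by (rule continuous_at_imp_continuous_on) (use der DERIV_isCont in blast)
    qed
    have "\<exists>a>l. a < u \<and> p a = 0 \<and>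
      (\<forall>y. l < y \<longrightarrow> y < u \<longrightarrow> (y < a \<longrightarrow> sgn (p y) = sgn (p l)) \<and> (a < y \<longrightarrow> sgn (p y) = sgn (p u)))"
      if neg: "p l * p u < 0"
    proof -
      have s: "p l < 0" "0 < p u" using inc[of l u] lu neg by (auto simp: mult_less_0_iff)
      have "\<exists>a\<ge>l. a \<le> u \<and> p a = 0"
        by (rule IVT) (use s lu der DERIV_isCont in \<open>auto simp: less_imp_le\<close>)
      then obtain a where a: "l \<le> a" "a \<le> u" "p a = 0" by blast
      then have "l < a" "a < u" using s by (auto simp: less_le)
      moreover have "p y < 0" if "l < y" "y < a" for y using inc[of y a] that a by auto
      moreover have "p y > 0" if "y < u" "a < y" for y using inc[of a y] that a by auto
      ultimately show ?thesis using a s by (auto intro!: exI[of _ a])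
    qed
    moreover have "p l < p y" "p y < p u" if "l < y" "y < u" for y
      using inc[of l y] inc[of y u] that by auto
    ultimately show ?thesis by (meson le_less_trans less_le_trans)
  qed
  define m where "m = (l + u) / 2"
  have m: "l < m" "m < u" using lu by (auto simp: m_def)
  have sg: "sgn (dp x) = sgn (dp m)" if "l < x" "x < u" for x
    using that m nz by (intro sgn_constant_without_root[of dp] cont) auto
  have main: "(0 \<le> p l \<longrightarrow> 0 \<le> p u \<longrightarrow> (\<forall>y. l < y \<longrightarrow> y < u \<longrightarrow> 0 < p y)) \<and>
      (p l \<le> 0 \<longrightarrow> p u \<le> 0 \<longrightarrow> (\<forall>y. l < y \<longrightarrow> y < u \<longrightarrow> p y < 0)) \<and>
      (p l * p u < 0 \<longrightarrow> (\<exists>a>l. a < u \<and> p a = 0 \<and>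
      (\<forall>y. l < y \<longrightarrow> y < u \<longrightarrow> (y < a \<longrightarrow> sgn (p y) = sgn (p l)) \<and> (a < y \<longrightarrow> sgn (p y) = sgn (p u)))))"
  proof (cases "dp m > 0")
    case True
    then have "dp x > 0" if "l < x" "x < u" for x using sg[OF that] by (simp add: sgn_1_pos)
    then show ?thesis by (rule pos[OF der])
  next
    case False
    then have "dp m < 0" using nz m by (meson linorder_neqE_linordered_idom)
    then have "- dp x > 0" if "l < x" "x < u" for x using sg[OF that] by (simp add: sgn_1_neg)
    then show ?thesis
      using pos[of "\<lambda>x. - p x" "\<lambda>x. - dp x"] DERIV_minus[OF der] by (simp add: sgn_minus)
  qed
  show "0 \<le> p l \<Longrightarrow> 0 \<le> p u \<Longrightarrow> l < y \<Longrightarrow> y < u \<Longrightarrow> 0 < p y"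
    and "p l \<le> 0 \<Longrightarrow> p u \<le> 0 \<Longrightarrow> l < y \<Longrightarrow> y < u \<Longrightarrow> p y < 0"
    and "p l * p u < 0 \<Longrightarrow> \<exists>a>l. a < u \<and> p a = 0 \<and>
      (\<forall>y. l < y \<longrightarrow> y < u \<longrightarrow> (y < a \<longrightarrow> sgn (p y) = sgn (p l)) \<and> (a < y \<longrightarrow> sgn (p y) = sgn (p u)))"
    using main by blast+
qed

lemma partial_iso_subset: "partial_iso T \<Longrightarrow> S \<subseteq> T \<Longrightarrow> partial_iso S"
  unfolding partial_iso_def by blast

text \<open>A pair of functions can be added to a matching that covers their derivatives, provided
  that their signs agree at the points of the matching and near \<open>\<plusminus>\<infinity>\<close>. The roots of \<open>p\<close> and \<open>r\<close>
  then lie in corresponding cells, at most one in each, by monotonicity. They are added to the matching.\<close>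

lemma sign_matching_add_antiderivative:
  assumes sm: "sign_matching T Q"
    and finQ: "\<And>q q'. (q, q') \<in> Q \<Longrightarrow> finite {y. q y = 0} \<and> finite {y. q' y = 0}"
    and d: "(dp, dr) \<in> Q"
    and dp: "\<And>x. (p has_real_derivative dp x) (at x)" "\<And>x. isCont dp x"
    and dr: "\<And>x. (r has_real_derivative dr x) (at x)" "\<And>x. isCont dr x"
    and fin: "finite {y. p y = 0}" "finite {y. r y = 0}"
    and pt: "\<And>y y'. (y, y') \<in> T \<Longrightarrow> sgn (p y) = sgn (r y')"
    and top: "\<And>y y'. C \<le> y \<Longrightarrow> C \<le> y' \<Longrightarrow> sgn (p y) = sgn (r y')"
    and bot: "\<And>y y'. y \<le> - C \<Longrightarrow> y' \<le> - C \<Longrightarrow> sgn (p y) = sgn (r y')"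
  shows "\<exists>T'. sign_matching T' (insert (p, r) Q)"
proof -
  have T: "finite T" "partial_iso T" using sm by (auto simp: sign_matching_def)
  \<comment> \<open>Two points beyond everything else serve as ends of the unbounded cells.\<close>
  define M where "M = Max (insert \<bar>C\<bar> ((\<lambda>(a, a'). max \<bar>a\<bar> \<bar>a'\<bar>) ` T)) + 1"
  have finM: "finite (insert \<bar>C\<bar> ((\<lambda>(a, a'). max \<bar>a\<bar> \<bar>a'\<bar>) ` T))" using T by simp
  have "\<bar>C\<bar> \<le> M - 1" unfolding M_def using Max_ge[OF finM, of "\<bar>C\<bar>"] by simp
  then have M: "C \<le> M" "M > 0" by auto
  have MT: "\<bar>a\<bar> < M \<and> \<bar>a'\<bar> < M" if a: "(a, a') \<in> T" for a a'
  proof -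
    have "max \<bar>a\<bar> \<bar>a'\<bar> \<in> (\<lambda>(a, a'). max \<bar>a\<bar> \<bar>a'\<bar>) ` T" using a by force
    from Max_ge[OF finM insertI2[OF this]] have "max \<bar>a\<bar> \<bar>a'\<bar> \<le> M - 1"
      by (simp only: M_def add_diff_cancel_right')
    then show ?thesis by auto
  qed
  define S where "S = insert (M, M) (insert (- M, - M) T)"
  have TS: "T \<subseteq> S" by (auto simp: S_def)
  have S: "finite S" "partial_iso S"
  proof -
    show "finite S" using T by (simp add: S_def)
    have "(a < - M \<longleftrightarrow> a' < - M) \<and> (- M < a \<longleftrightarrow> - M < a') \<and> (a < M \<longleftrightarrow> a' < M) \<and> (M < a \<longleftrightarrow> M < a')"
      if "(a, a') \<in> T" for a a' using MT[OF that] by linarith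
    then show "partial_iso S" using T(2) M(2) unfolding S_def partial_iso_insert by simp
  qed
  have pS: "sgn (p y) = sgn (r y')" if y: "(y, y') \<in> S" for y y'
  proof -
    have "(y, y') \<in> T \<or> (y = M \<and> y' = M) \<or> (y = - M \<and> y' = - M)" using y by (auto simp: S_def)
    then show ?thesis using pt[of y y'] top[of y y'] bot[of y y'] M by auto
  qed
  have root_dp: "\<exists>w'. (w, w') \<in> S" if w: "dp w = 0" for w
  proof -
    have "w \<in> fst ` T"
      by (rule sign_matching_roots[OF sm d _ w]) (use finQ[OF d] in blast)
    then show ?thesis using TS by force
  qed
  have root_dr: "\<exists>w'. (w', w) \<in> S" if w: "dr w = 0" for w
  proof -
    have sm': "sign_matching (T\<inverse>) (Q\<inverse>)" using sm sign_matching_converse by blast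
    have d': "(dr, dp) \<in> Q\<inverse>" using d by blast
    have "w \<in> fst ` (T\<inverse>)"
      by (rule sign_matching_roots[OF sm' d' _ w]) (use finQ[OF d] in blast)
    then show ?thesis using TS by force
  qed
  have contp: "continuous_on A p" for A
    by (rule continuous_at_imp_continuous_on) (use dp(1) DERIV_isCont in blast)
  have contr: "continuous_on A r" for A
    by (rule continuous_at_imp_continuous_on) (use dr(1) DERIV_isCont in blast)
  \<comment> \<open>By Rolle's theorem, two roots of \<open>p\<close> are separated by a root of the derivative, which
    is a point of \<open>S\<close>. This is why the pairs in \<open>R\<close> are in order.\<close>
  define R where "R = {(a, a'). p a = 0 \<and> r a' = 0 \<and> partial_iso (insert (a, a') S)}"
  have R: "p a = 0" "r a' = 0" "partial_iso (insert (a, a') S)" if "(a, a') \<in> R" for a a'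
    using that by (auto simp: R_def)
  have RS: "(c < a \<longleftrightarrow> c' < a') \<and> (a < c \<longleftrightarrow> a' < c')" if "(a, a') \<in> R" "(c, c') \<in> S" for a a' c c'
    using R(3)[OF that(1)] that(2) unfolding partial_iso_insert by blast
  have RR: "a < b \<longleftrightarrow> a' < b'" if aR: "(a, a') \<in> R" and bR: "(b, b') \<in> R" for a a' b b'
  proof
    assume ab: "a < b"
    have "\<exists>w>a. w < b \<and> (p has_real_derivative 0) (at w)"
    proof (rule Rolle[OF ab])
      show "p a = p b" using R(1)[OF aR] R(1)[OF bR] by simp
      show "p differentiable at x" for x using dp(1) real_differentiable_def by blast
    qed (rule contp)
    then obtain w where w: "a < w" "w < b" "(p has_real_derivative 0) (at w)" by blast
    then have "dp w = 0" using DERIV_unique[OF dp(1)] by blast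
    then obtain w' where "(w, w') \<in> S" using root_dp by blast
    then show "a' < b'" using RS[OF aR] RS[OF bR] w by (meson less_trans)
  next
    assume ab: "a' < b'"
    have "\<exists>w>a'. w < b' \<and> (r has_real_derivative 0) (at w)"
    proof (rule Rolle[OF ab])
      show "r a' = r b'" using R(2)[OF aR] R(2)[OF bR] by simp
      show "r differentiable at x" for x using dr(1) real_differentiable_def by blast
    qed (rule contr)
    then obtain w where w: "a' < w" "w < b'" "(r has_real_derivative 0) (at w)" by blast
    then have "dr w = 0" using DERIV_unique[OF dr(1)] by blast
    then obtain w' where "(w', w) \<in> S" using root_dr by blast
    then show "a < b" using RS[OF aR] RS[OF bR] w by (meson less_trans)
  qed
  have "R \<subseteq> {y. p y = 0} \<times> {y. r y = 0}" by (auto simp: R_def)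
  then have "finite R" using fin finite_subset by blast
  moreover have "partial_iso (S \<union> R)"
    unfolding partial_iso_def
  proof (intro allI impI)
    fix a a' b b' assume ab: "(a, a') \<in> S \<union> R" "(b, b') \<in> S \<union> R"
    show "a < b \<longleftrightarrow> a' < b'"
    proof (cases "(a, a') \<in> R")
      case True
      show ?thesis
      proof (cases "(b, b') \<in> R")
        case b: True
        show ?thesis by (rule RR[OF True b])
      next
        case False
        then show ?thesis using RS[OF True] ab(2) by blast
      qed
    next
      case False
      then have a: "(a, a') \<in> S" using ab by blast
      show ?thesis
      proof (cases "(b, b') \<in> R")
        case b: True
        show ?thesis using RS[OF b a] by blast
      next
        case False
        then show ?thesis using partial_iso_less[OF S(2) a] ab(2) by blast
      qed
    qed
  qed
  moreover have "sgn (q y) = sgn (q' y')"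
    if piso: "partial_iso (insert (y, y') (S \<union> R))" and q: "(q, q') \<in> insert (p, r) Q" for y y' q q'
  proof -
    have "partial_iso (insert (y, y') T)"
      by (rule partial_iso_subset[OF piso]) (use TS in blast)
    then have "sgn (q y) = sgn (q' y')" if "(q, q') \<in> Q" using sm that unfolding sign_matching_def by blast
    moreover have "sgn (p y) = sgn (r y')"
    proof -
      have cell: "(a < y \<longleftrightarrow> a' < y') \<and> (y < a \<longleftrightarrow> y' < a')" if "(a, a') \<in> S \<union> R" for a a'
        using piso that unfolding partial_iso_insert by blast
      have MS: "(M, M) \<in> S" "(- M, - M) \<in> S" by (auto simp: S_def)
      consider (hi) "M \<le> y" | (lo) "y \<le> - M" | (pt) "\<exists>w. (y, w) \<in> S"
        | (gap) "- M < y" "y < M" "\<forall>w. (y, w) \<notin> S"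
        by (meson linorder_not_le)
      then show ?thesis
      proof cases
        case hi
        then have "M \<le> y'" using cell[of M M] MS by auto
        then show ?thesis using top[of y y'] hi M by auto
      next
        case lo
        then have "y' \<le> - M" using cell[of "- M" "- M"] MS by auto
        then show ?thesis using bot[of y y'] lo M by auto
      next
        case pt
        then obtain w where w: "(y, w) \<in> S" by blast
        then have "w = y'" using cell[of y w] by auto
        then show ?thesis using pS w by blast
      next
        case gap
        let ?L = "{a \<in> fst ` S. a < y}" and ?U = "{a \<in> fst ` S. y < a}"
        have fLU: "finite ?L" "finite ?U" using S(1) by auto
        have "- M \<in> ?L" using MS gap(1) image_eqI[OF _ MS(2), of _ fst] by simp
        then have "Max ?L \<in> ?L" using Max_in[OF fLU(1)] by blast
        moreover have "M \<in> ?U" using MS gap(2) image_eqI[OF _ MS(1), of _ fst] by simp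
        then have "Min ?U \<in> ?U" using Min_in[OF fLU(2)] by blast
        ultimately obtain l' u' where lu: "(Max ?L, l') \<in> S" "Max ?L < y" "(Min ?U, u') \<in> S" "y < Min ?U"
          by auto
        define l u where "l = Max ?L" and "u = Min ?U"
        have l: "(l, l') \<in> S" "l < y" and u: "(u, u') \<in> S" "y < u" using lu by (auto simp: l_def u_def)
        have l'u': "l' < y'" "y' < u'" using cell l u by blast+
        have none: False if w: "(w, w') \<in> S" "l < w" "w < u" for w w'
        proof -
          have fw: "w \<in> fst ` S" using w(1) by force
          have "w \<noteq> y" using w gap by blast
          then have "w \<in> ?L \<or> w \<in> ?U" using fw by auto
          then have "w \<le> l \<or> u \<le> w" using Max_ge[OF fLU(1)] Min_le[OF fLU(2)] by (auto simp: l_def u_def)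
          then show False using w by linarith
        qed
        have ndp: "\<forall>x. l < x \<longrightarrow> x < u \<longrightarrow> dp x \<noteq> 0" using root_dp none by blast
        have ndr: "\<forall>x. l' < x \<longrightarrow> x < u' \<longrightarrow> dr x \<noteq> 0"
        proof (intro allI impI notI)
          fix x assume x: "l' < x" "x < u'" and "dr x = 0"
          then obtain w where w: "(w, x) \<in> S" using root_dr by blast
          then show False
            using none[OF w] partial_iso_less[OF S(2) l(1) w] partial_iso_less[OF S(2) w u(1)] x by blast
        qed
        note sp = signs_between_critical_points[OF dp ndp less_trans[OF l(2) u(2)]]
        note sr = signs_between_critical_points[OF dr ndr less_trans[OF l'u']]
        have eq: "sgn (p l) = sgn (r l')" "sgn (p u) = sgn (r u')" using pS l u by blast+
        consider (nonneg) "0 \<le> p l" "0 \<le> p u" | (nonpos) "p l \<le> 0" "p u \<le> 0" | (change) "p l * p u < 0"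
          using mult_neg_pos[of "p l" "p u"] mult_pos_neg[of "p l" "p u"] by linarith
        then show ?thesis
        proof cases
          case nonneg
          then have "0 \<le> r l'" "0 \<le> r u'" using eq by (simp_all add: sgn_if split: if_splits)
          then show ?thesis using sp(1)[OF nonneg l(2) u(2)] sr(1)[OF _ _ l'u'] by simp
        next
          case nonpos
          then have "r l' \<le> 0" "r u' \<le> 0" using eq by (simp_all add: sgn_if split: if_splits)
          then show ?thesis using sp(2)[OF nonpos l(2) u(2)] sr(2)[OF _ _ l'u'] by simp
        next
          case change
          have "sgn (r l' * r u') = sgn (p l * p u)" using eq by (simp add: sgn_mult)
          then have "sgn (r l' * r u') = - 1" using change by simp
          then have change': "r l' * r u' < 0" by (simp add: sgn_1_neg)
          obtain a where a: "l < a" "a < u" "p a = 0" and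
            as: "\<And>y. l < y \<Longrightarrow> y < u \<Longrightarrow> (y < a \<longrightarrow> sgn (p y) = sgn (p l)) \<and> (a < y \<longrightarrow> sgn (p y) = sgn (p u))"
            using sp(3)[OF change] by blast
          obtain a' where a': "l' < a'" "a' < u'" "r a' = 0" and
            as': "\<And>y. l' < y \<Longrightarrow> y < u' \<Longrightarrow> (y < a' \<longrightarrow> sgn (r y) = sgn (r l')) \<and> (a' < y \<longrightarrow> sgn (r y) = sgn (r u'))"
            using sr(3)[OF change'] by blast
          have "(c < a \<longleftrightarrow> c' < a') \<and> (a < c \<longleftrightarrow> a' < c')" if c: "(c, c') \<in> S" for c c'
          proof -
            have "c \<le> l \<or> u \<le> c" using none[OF c] by (meson linorder_not_le)
            moreover have "(l < c \<longleftrightarrow> l' < c') \<and> (c < u \<longleftrightarrow> c' < u')"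
              using partial_iso_less[OF S(2) l(1) c] partial_iso_less[OF S(2) c u(1)] by blast
            ultimately show ?thesis using a a' by linarith
          qed
          then have "partial_iso (insert (a, a') S)" using S(2) unfolding partial_iso_insert by blast
          then have aR: "(a, a') \<in> R" using a a' by (simp add: R_def)
          then have c: "(a < y \<longleftrightarrow> a' < y') \<and> (y < a \<longleftrightarrow> y' < a')" using cell by blast
          consider "y < a" "y' < a'" | "a < y" "a' < y'" | "y = a" "y' = a'" using c by linarith
          then show ?thesis
          proof cases
            case 1
            then show ?thesis using as[OF l(2) u(2)] as'[OF l'u'] eq by simp
          next
            case 2
            then show ?thesis using as[OF l(2) u(2)] as'[OF l'u'] eq by simp
          next
            case 3
            then show ?thesis using a(3) a'(3) by simp
          qed
        qed
      qed
    qed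
    ultimately show ?thesis using q by blast
  qed
  ultimately have "sign_matching (S \<union> R) (insert (p, r) Q)"
    unfolding sign_matching_def using S(1) by blast
  then show ?thesis by blast
qed

section \<open>Quantifier elimination over the reals\<close>

inductive poly_fun :: "(('v \<Rightarrow> real) \<Rightarrow> real) \<Rightarrow> bool" where
  const: "poly_fun (\<lambda>_. c)"
| var: "poly_fun (\<lambda>e. e v)"
| add: "poly_fun p \<Longrightarrow> poly_fun q \<Longrightarrow> poly_fun (\<lambda>e. p e + q e)"
| mult: "poly_fun p \<Longrightarrow> poly_fun q \<Longrightarrow> poly_fun (\<lambda>e. p e * q e)"

lemma poly_fun_diff: "poly_fun p \<Longrightarrow> poly_fun q \<Longrightarrow> poly_fun (\<lambda>e. p e - q e)"
  using poly_fun.add[OF _ poly_fun.mult[OF poly_fun.const[of "-1"]], of p q] by simp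

lemma poly_fun_sum: "(\<And>i. i \<in> I \<Longrightarrow> poly_fun (p i)) \<Longrightarrow> poly_fun (\<lambda>e. \<Sum>i\<in>I. p i e)"
proof (induction I rule: infinite_finite_induct)
  case (insert x F)
  then show ?case using poly_fun.add[of "p x" "\<lambda>e. \<Sum>i\<in>F. p i e"] by simp
qed (simp_all add: poly_fun.const)

definition same_signs :: "(('v \<Rightarrow> real) \<Rightarrow> real) set \<Rightarrow> ('v \<Rightarrow> real) \<Rightarrow> ('v \<Rightarrow> real) \<Rightarrow> bool" where
  "same_signs Q e e' \<longleftrightarrow> (\<forall>q\<in>Q. sgn (q e) = sgn (q e'))"

text \<open>A family of univariate polynomials whose coefficients are polynomial functions of the parameter
  \<open>e\<close>. The number \<open>n\<close> bounds the number of coefficients; the formal leading coefficient, at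
  \<open>n - 1\<close>, may vanish for some parameters.\<close>

definition parametric_poly :: "nat \<Rightarrow> (('v \<Rightarrow> real) \<Rightarrow> real poly) \<Rightarrow> bool" where
  "parametric_poly n p \<longleftrightarrow>
     (\<forall>i. poly_fun (\<lambda>e. coeff (p e) i)) \<and> (\<forall>e. \<forall>i\<ge>n. coeff (p e) i = 0)"

lemma parametric_poly_pderiv:
  assumes "parametric_poly n p"
  shows "parametric_poly (n - 1) (\<lambda>e. pderiv (p e))"
  using assms poly_fun.mult[OF poly_fun.const] unfolding parametric_poly_def coeff_pderiv by auto

lemma parametric_poly_drop_top:
  assumes "parametric_poly n p"
  shows "parametric_poly (n - 1) (\<lambda>e. p e - monom (coeff (p e) (n - 1)) (n - 1))"
proof -
  have "poly_fun (\<lambda>e. coeff (p e) i - (if n - 1 = i then coeff (p e) (n - 1) else 0))" for i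
    using assms poly_fun_diff[of "\<lambda>e. coeff (p e) i"] poly_fun.const[of 0]
    by (cases "n - 1 = i") (auto simp: parametric_poly_def)
  moreover have "coeff (p e) i = 0" if "n - 1 \<le> i" "n - 1 \<noteq> i" for e i
    using assms that by (auto simp: parametric_poly_def)
  ultimately show ?thesis unfolding parametric_poly_def coeff_diff coeff_monom by simp
qed

text \<open>Pseudo-division. Each step multiplies \<open>p\<close> by the square of the leading coefficient of \<open>q\<close>, so
  that the signs at the roots of \<open>q\<close> are preserved, whatever the sign of that coefficient.\<close>

lemma parametric_remainder:
  assumes "parametric_poly n p" "parametric_poly k q" "0 < k"
  shows "\<exists>j r. j < k \<and> parametric_poly j r \<and>
    (\<forall>e y. coeff (q e) (k - 1) \<noteq> 0 \<longrightarrow> poly (q e) y = 0 \<longrightarrow> sgn (poly (r e) y) = sgn (poly (p e) y))"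
  using assms(1)
proof (induction n arbitrary: p)
  case 0
  then show ?case using assms(3) by blast
next
  case (Suc n)
  show ?case
  proof (cases "Suc n < k")
    case True
    then show ?thesis using Suc.prems by blast
  next
    case False
    define a where "a = (\<lambda>e. coeff (p e) n)"
    define b where "b = (\<lambda>e. coeff (q e) (k - 1))"
    define d where "d = Suc n - k"
    define p1 where "p1 = (\<lambda>e. smult (b e * b e) (p e) - smult (a e * b e) (monom 1 d * q e))"
    have ab: "poly_fun a" "poly_fun b"
      using Suc.prems assms(2) unfolding parametric_poly_def a_def b_def by auto
    have co: "coeff (p1 e) i = b e * b e * coeff (p e) i - a e * b e * (if d \<le> i then coeff (q e) (i - d) else 0)"
      for e i by (simp add: p1_def coeff_monom_mult)
    have "poly_fun (\<lambda>e. coeff (p1 e) i)" for i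
      unfolding co using ab Suc.prems assms(2) poly_fun.const[of 0]
      by (cases "d \<le> i") (auto simp: parametric_poly_def intro!: poly_fun_diff poly_fun.mult)
    moreover have "coeff (p1 e) i = 0" if "n \<le> i" for e i
    proof (cases "i = n")
      case True
      have "n - d = k - 1" "d \<le> n" using False assms(3) by (auto simp: d_def)
      then show ?thesis using True by (simp add: co a_def b_def)
    next
      case i: False
      then have "coeff (p e) i = 0" using that Suc.prems by (simp add: parametric_poly_def)
      moreover have "coeff (q e) (i - d) = 0"
        using that i assms(2) False by (simp add: parametric_poly_def d_def)
      ultimately show ?thesis by (simp add: co)
    qed
    ultimately have "parametric_poly n p1" by (auto simp: parametric_poly_def)
    from Suc.IH[OF this] obtain j r where r: "j < k" "parametric_poly j r"
      "\<And>e y. coeff (q e) (k - 1) \<noteq> 0 \<Longrightarrow> poly (q e) y = 0 \<Longrightarrow> sgn (poly (r e) y) = sgn (poly (p1 e) y)"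
      by blast
    have "sgn (poly (p1 e) y) = sgn (poly (p e) y)" if "coeff (q e) (k - 1) \<noteq> 0" "poly (q e) y = 0" for e y
    proof -
      have "poly (p1 e) y = (b e * b e) * poly (p e) y" using that(2) by (simp add: p1_def)
      moreover have "sgn (b e * b e) = 1" unfolding sgn_1_pos using that(1) not_real_square_gt_zero[of "b e"] unfolding b_def by blast
      ultimately show ?thesis by (metis sgn_mult mult_1)
    qed
    then show ?thesis using r by metis
  qed
qed

lemma poly_sgn_at_top: "\<exists>C. \<forall>y\<ge>C. sgn (poly P y) = sgn (lead_coeff P)" for P :: "real poly"
proof -
  have pos: "\<exists>C. \<forall>y\<ge>C. sgn (poly P y) = 1" if "0 < lead_coeff P" for P :: "real poly"
    using poly_pinfty_gt_lc[OF that] that by (meson less_le_trans sgn_pos)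
  consider "lead_coeff P = 0" | "0 < lead_coeff P" | "0 < lead_coeff (- P)" by fastforce
  then show ?thesis
  proof cases
    case 1 then show ?thesis by simp
  next
    case 2 then show ?thesis using pos[OF 2] by simp
  next
    case 3 then show ?thesis using pos[OF 3] by (simp add: sgn_minus minus_equation_iff[of _ 1])
  qed
qed

lemma poly_sgn_at_bot: "\<exists>C. \<forall>y\<le>C. sgn (poly P y) = sgn (lead_coeff P * (- 1) ^ degree P)"
  for P :: "real poly"
proof -
  obtain C where C: "\<And>y. C \<le> y \<Longrightarrow> sgn (poly (pcompose P [:0, - 1:]) y) = sgn (lead_coeff (pcompose P [:0, - 1:]))"
    using poly_sgn_at_top by blast
  have "sgn (poly P y) = sgn (lead_coeff P * (- 1) ^ degree P)" if "y \<le> - C" for y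
    using C[of "- y"] that by (simp add: poly_pcompose lead_coeff_comp)
  then show ?thesis by blast
qed

lemma same_signs_near_infinity:
  fixes P R :: "real poly"
  assumes "\<And>i. n \<le> i \<Longrightarrow> coeff P i = 0" "\<And>i. n \<le> i \<Longrightarrow> coeff R i = 0" "0 < n"
    "coeff P (n - 1) \<noteq> 0" "sgn (coeff P (n - 1)) = sgn (coeff R (n - 1))"
  obtains C where "\<And>y y'. C \<le> y \<Longrightarrow> C \<le> y' \<Longrightarrow> sgn (poly P y) = sgn (poly R y')"
    "\<And>y y'. y \<le> - C \<Longrightarrow> y' \<le> - C \<Longrightarrow> sgn (poly P y) = sgn (poly R y')"
proof -
  have deg: "degree S = n - 1" if "\<And>i. n \<le> i \<Longrightarrow> coeff S i = 0" "coeff S (n - 1) \<noteq> 0" for S :: "real poly"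
  proof (rule antisym)
    show "degree S \<le> n - 1" using that(1) assms(3) by (intro degree_le) auto
    show "n - 1 \<le> degree S" by (rule le_degree[OF that(2)])
  qed
  have "coeff R (n - 1) \<noteq> 0" using assms(4,5) by (metis sgn_0_0)
  then have d: "degree P = n - 1" "degree R = n - 1" using deg assms by blast+
  obtain C1 where C1: "\<And>y. C1 \<le> y \<Longrightarrow> sgn (poly P y) = sgn (lead_coeff P)" using poly_sgn_at_top by blast
  obtain C2 where C2: "\<And>y. C2 \<le> y \<Longrightarrow> sgn (poly R y) = sgn (lead_coeff R)" using poly_sgn_at_top by blast
  obtain C3 where C3: "\<And>y. y \<le> C3 \<Longrightarrow> sgn (poly P y) = sgn (lead_coeff P * (- 1) ^ degree P)"
    using poly_sgn_at_bot by blast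
  obtain C4 where C4: "\<And>y. y \<le> C4 \<Longrightarrow> sgn (poly R y) = sgn (lead_coeff R * (- 1) ^ degree R)"
    using poly_sgn_at_bot by blast
  show ?thesis
  proof (rule that[of "max (max C1 C2) (max (- C3) (- C4))"])
    fix y y'
    assume "max (max C1 C2) (max (- C3) (- C4)) \<le> y" "max (max C1 C2) (max (- C3) (- C4)) \<le> y'"
    then show "sgn (poly P y) = sgn (poly R y')" using C1[of y] C2[of y'] assms(5) d by simp
  next
    fix y y'
    assume "y \<le> - max (max C1 C2) (max (- C3) (- C4))" "y' \<le> - max (max C1 C2) (max (- C3) (- C4))"
    then show "sgn (poly P y) = sgn (poly R y')"
      using C3[of y] C4[of y'] assms(5) d by (simp add: sgn_mult le_minus_iff[of y] le_minus_iff[of y'] max_def split: if_splits)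
  qed
qed

abbreviation instances :: "('v \<Rightarrow> real) \<Rightarrow> ('v \<Rightarrow> real) \<Rightarrow> (nat \<times> (('v \<Rightarrow> real) \<Rightarrow> real poly)) list \<Rightarrow>
    ((real \<Rightarrow> real) \<times> (real \<Rightarrow> real)) set" where
  "instances e e' L \<equiv> (\<lambda>np. (poly (snd np e), poly (snd np e'))) ` set L"

text \<open>The induction step of the method of Cohen and Hoermander when no formal leading coefficient
  vanishes: \<open>K\<close> consists of the other polynomials, and \<open>R\<close> contains the remainders of \<open>p\<close>
  modulo these and modulo the derivative of \<open>p\<close>. At a root of one of the divisors the sign of
  \<open>p\<close> is that of the remainder.\<close>

lemma sign_matching_top_degree:
  fixes L :: "(nat \<times> (('v \<Rightarrow> real) \<Rightarrow> real poly)) list"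
  assumes par: "\<And>k q. (k, q) \<in> set L \<Longrightarrow> parametric_poly k q"
    and top: "\<And>k q. (k, q) \<in> set L \<Longrightarrow> 0 < k \<and> coeff (q e) (k - 1) \<noteq> 0 \<and>
        sgn (coeff (q e) (k - 1)) = sgn (coeff (q e') (k - 1))"
    and n: "2 \<le> n" and L: "set L \<subseteq> insert (n, p) (set K)" and K: "set (( n, p) # K) \<subseteq> set L"
    and A: "A = (n - 1, \<lambda>e. pderiv (p e)) # K"
    and rem: "\<And>k q. (k, q) \<in> set A \<Longrightarrow> \<exists>r \<in> snd ` set R.
        \<forall>e y. coeff (q e) (k - 1) \<noteq> 0 \<longrightarrow> poly (q e) y = 0 \<longrightarrow> sgn (poly (r e) y) = sgn (poly (p e) y)"
    and sm: "sign_matching T (instances e e' (A @ R))"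
  shows "\<exists>T'. sign_matching T' (instances e e' L)"
proof -
  have p: "parametric_poly n p" and ptop: "coeff (p e) (n - 1) \<noteq> 0" "sgn (coeff (p e) (n - 1)) = sgn (coeff (p e') (n - 1))"
    using par top K by auto
  have ptop': "coeff (p e') (n - 1) \<noteq> 0" using ptop by (metis sgn_0_0)
  have Atop: "coeff (q e) (k - 1) \<noteq> 0 \<and> coeff (q e') (k - 1) \<noteq> 0" if "(k, q) \<in> set A" for k q
  proof -
    consider "k = n - 1" "q = (\<lambda>e. pderiv (p e))" | "(k, q) \<in> set L" using \<open>(k, q) \<in> set A\<close> A K by auto
    then show ?thesis
    proof cases
      case 1
      have "Suc (n - 1 - 1) = n - 1" using n by simp
      then show ?thesis using 1 ptop ptop' n by (simp add: coeff_pderiv)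
    next
      case 2
      then show ?thesis using top[OF 2] by (metis sgn_0_0)
    qed
  qed
  have inst: "\<exists>k r. (k, r) \<in> set A \<and> q = poly (r e) \<and> q' = poly (r e')" if "(q, q') \<in> instances e e' A" for q q'
    using that by force
  have fin: "finite {y. poly (r f) y = 0}" if "coeff (r f) j \<noteq> 0" for f j and r :: "('v \<Rightarrow> real) \<Rightarrow> real poly"
  proof (rule poly_roots_finite)
    show "r f \<noteq> 0" using that by auto
  qed
  have finA: "finite {y. q y = 0} \<and> finite {y. q' y = 0}" if qq: "(q, q') \<in> instances e e' A" for q q'
  proof -
    obtain k r where r: "(k, r) \<in> set A" "q = poly (r e)" "q' = poly (r e')" using inst[OF qq] by blast
    then show ?thesis using fin[of r] Atop[OF r(1)] by blast
  qed
  have smA: "sign_matching T (instances e e' A)" by (rule sign_matching_mono[OF sm]) auto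
  define T0 where "T0 = {(y, y') \<in> T. \<exists>q q'. (q, q') \<in> instances e e' A \<and> q y = 0}"
  have sm0: "sign_matching T0 (instances e e' A)"
    unfolding T0_def
  proof (rule sign_matching_root_part[OF smA _ finA])
    fix q q' x assume "(q, q') \<in> instances e e' A"
    then show "isCont q x \<and> isCont q' x" using inst by fastforce
  qed
  have pt: "sgn (poly (p e) y) = sgn (poly (p e') y')" if yT0: "(y, y') \<in> T0" for y y'
  proof -
    obtain q q' where T: "(y, y') \<in> T" and q: "(q, q') \<in> instances e e' A" "q y = 0"
      using yT0 unfolding T0_def by blast
    obtain k s where s: "(k, s) \<in> set A" "q = poly (s e)" "q' = poly (s e')" using inst[OF q(1)] by blast
    have "sgn (q y) = sgn (q' y')" using sign_matching_point[OF smA q(1) T] .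
    then have z: "poly (s e) y = 0" "poly (s e') y' = 0" using q(2) s by (auto simp: sgn_0_0)
    obtain r where rR: "r \<in> snd ` set R"
      and r: "\<And>e y. coeff (s e) (k - 1) \<noteq> 0 \<Longrightarrow> poly (s e) y = 0 \<Longrightarrow> sgn (poly (r e) y) = sgn (poly (p e) y)"
      using rem[OF s(1)] by blast
    have "(poly (r e), poly (r e')) \<in> instances e e' (A @ R)" using rR by auto
    then have "sgn (poly (r e) y) = sgn (poly (r e') y')" using sign_matching_point[OF sm _ T] by blast
    then show ?thesis using r[of e y] r[of e' y'] z Atop[OF s(1)] by simp
  qed
  obtain C where C: "\<And>y y'. C \<le> y \<Longrightarrow> C \<le> y' \<Longrightarrow> sgn (poly (p e) y) = sgn (poly (p e') y')"
    "\<And>y y'. y \<le> - C \<Longrightarrow> y' \<le> - C \<Longrightarrow> sgn (poly (p e) y) = sgn (poly (p e') y')"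
    by (rule same_signs_near_infinity[of n "p e" "p e'"]) (use p ptop n in \<open>auto simp: parametric_poly_def\<close>)
  have "\<exists>T'. sign_matching T' (insert (poly (p e), poly (p e')) (instances e e' A))"
  proof (rule sign_matching_add_antiderivative[OF sm0 finA _ _ _ _ _ _ _ pt C])
    show "(poly (pderiv (p e)), poly (pderiv (p e'))) \<in> instances e e' A" using A by simp
    show "(poly (p e) has_real_derivative poly (pderiv (p e)) x) (at x)"
      "(poly (p e') has_real_derivative poly (pderiv (p e')) x) (at x)" for x by (rule poly_DERIV)+
    show "isCont (poly (pderiv (p e))) x" "isCont (poly (pderiv (p e'))) x" for x by simp_all
    show "finite {y. poly (p e) y = 0}" "finite {y. poly (p e') y = 0}" using fin ptop ptop' by blast+
  qed
  moreover have "instances e e' L \<subseteq> insert (poly (p e), poly (p e')) (instances e e' A)"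
    using L A by auto
  ultimately show ?thesis using sign_matching_mono by blast
qed

lemma sign_matching_of_constants:
  fixes L :: "(nat \<times> (('v \<Rightarrow> real) \<Rightarrow> real poly)) list"
  assumes par: "\<forall>(k, q) \<in> set L. parametric_poly k q" and le: "\<And>k q. (k, q) \<in> set L \<Longrightarrow> k \<le> 1"
    and same: "\<And>k q. (k, q) \<in> set L \<Longrightarrow> sgn (coeff (q e) 0) = sgn (coeff (q e') 0)"
  shows "sign_matching {} (instances e e' L)"
proof -
  have "sgn (poly (q e) y) = sgn (poly (q e') y')" if q: "(k, q) \<in> set L" for k q y y'
  proof -
    have "coeff (q f) (Suc i) = 0" for f i
      using par le[OF q] q by (auto simp: parametric_poly_def)
    then have eq: "q f = [:coeff (q f) 0:]" for f by (intro poly_eqI) (simp add: coeff_pCons split: nat.split)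
    have "poly (q f) z = coeff (q f) 0" for f z by (subst eq) simp
    then show ?thesis using same[OF q] by simp
  qed
  then show ?thesis unfolding sign_matching_def partial_iso_def by fastforce
qed

lemma mset_remove1_fst:
  assumes "(n, p) \<in> set L"
  shows "mset (map fst L) = add_mset n (mset (map fst (remove1 (n, p) L)))"
  using assms by (induction L) auto

lemma set_remove1_insert: "x \<in> set L \<Longrightarrow> set L = insert x (set (remove1 x L))"
  by (induction L) auto

definition uniformly_matched :: "(nat \<times> (('v \<Rightarrow> real) \<Rightarrow> real poly)) list \<Rightarrow> bool" where
  "uniformly_matched L \<longleftrightarrow> (\<exists>Q. finite Q \<and> (\<forall>q\<in>Q. poly_fun q) \<and>
     (\<forall>e e'. same_signs Q e e' \<longrightarrow> (\<exists>T. sign_matching T (instances e e' L))))"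

lemma uniformly_matchedI:
  assumes "finite Q" "\<And>q. q \<in> Q \<Longrightarrow> poly_fun q"
    "\<And>e e'. same_signs Q e e' \<Longrightarrow> \<exists>T. sign_matching T (instances e e' L)"
  shows "uniformly_matched L"
  unfolding uniformly_matched_def
  by (intro exI[of _ Q] conjI ballI allI impI) (fact assms)+

lemma uniformly_matchedE:
  assumes "uniformly_matched L"
  obtains Q where "finite Q" "\<And>q. q \<in> Q \<Longrightarrow> poly_fun q"
    "\<And>e e'. same_signs Q e e' \<Longrightarrow> \<exists>T. sign_matching T (instances e e' L)"
  using assms unfolding uniformly_matched_def by blast

text \<open>Induction on the multiset of the formal degrees. If a leading coefficient vanishes, it is
  dropped. Otherwise a polynomial of maximal degree is traded for finitely many of smaller
  degree. The polynomial functions \<open>Q\<close> are collected from all these cases, and they contain the leading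
  coefficients themselves, so that \<open>e\<close> and \<open>e'\<close> always fall into the same case.\<close>

lemma uniform_sign_matching:
  fixes L :: "(nat \<times> (('v \<Rightarrow> real) \<Rightarrow> real poly)) list"
  assumes "\<forall>(k, q) \<in> set L. parametric_poly k q"
  shows "uniformly_matched L"
  using assms
proof (induction L rule: wf_induct_rule[OF wf_inv_image[OF wf_mult1[OF wf_less_than], of "\<lambda>L. mset (map fst L)"]])
  case (1 L)
  have IH: "uniformly_matched L'"
    if x: "(n, p) \<in> set L" and L': "mset (map fst L') = mset (map fst (remove1 (n, p) L)) + mset (map fst K)"
      and K: "\<And>k q. (k, q) \<in> set K \<Longrightarrow> k < n" and par: "\<And>k q. (k, q) \<in> set L' \<Longrightarrow> parametric_poly k q"
    for n p and L' K :: "(nat \<times> (('v \<Rightarrow> real) \<Rightarrow> real poly)) list"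
  proof (rule "1.IH")
    show "(L', L) \<in> inv_image (mult1 less_than) (\<lambda>L. mset (map fst L))"
      unfolding in_inv_image
    proof (rule mult1I[OF mset_remove1_fst[OF x] L'])
      show "(b, n) \<in> less_than" if "b \<in># mset (map fst K)" for b
        using that K by auto
    qed
    show "\<forall>(k, q)\<in>set L'. parametric_poly k q" using par by blast
  qed
  have par: "parametric_poly k q" if "(k, q) \<in> set L" for k q using "1.prems" that by blast
  consider (zero) p where "(0, p) \<in> set L"
    | (base) "\<And>k q. (k, q) \<in> set L \<Longrightarrow> k \<le> 1"
    | (step) "\<And>k q. (k, q) \<in> set L \<Longrightarrow> 0 < k" "\<exists>k q. (k, q) \<in> set L \<and> 1 < k"
    by (metis gr0I linorder_not_le)
  then show ?case
  proof cases
    case zero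
    define L' where "L' = remove1 (0, p) L"
    have "uniformly_matched L'"
    proof (rule IH[OF zero, of _ "[]"])
      show "parametric_poly k q" if "(k, q) \<in> set L'" for k q
        using that par unfolding L'_def by (meson notin_set_remove1)
    qed (auto simp: L'_def)
    then obtain Q where Q: "finite Q" "\<And>q. q \<in> Q \<Longrightarrow> poly_fun q"
      "\<And>e e'. same_signs Q e e' \<Longrightarrow> \<exists>T. sign_matching T (instances e e' L')" by (rule uniformly_matchedE) blast
    have "p e = 0" for e using par[OF zero] by (intro poly_eqI) (simp add: parametric_poly_def)
    then have "sign_matching T (instances e e' L)" if "sign_matching T (instances e e' L')" for T e e'
      using that set_remove1_insert[OF zero, folded L'_def] by (simp add: sign_matching_def)
    then show ?thesis using Q(3) by (intro uniformly_matchedI[OF Q(1,2)]) blast+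
  next
    case base
    define Q where "Q = (\<lambda>np e. coeff (snd np e) 0) ` set L"
    have "poly_fun q" if "q \<in> Q" for q using that par by (auto simp: Q_def parametric_poly_def)
    moreover have "sign_matching {} (instances e e' L)" if "same_signs Q e e'" for e e'
      by (rule sign_matching_of_constants[OF "1.prems" base])
        (use that in \<open>auto simp: same_signs_def Q_def\<close>)
    moreover have "finite Q" by (simp add: Q_def)
    ultimately show ?thesis by (intro uniformly_matchedI[of Q]) blast+
  next
    case step
    define N where "N = Max (fst ` set L)"
    have "N \<in> fst ` set L" unfolding N_def using step(2) by (intro Max_in) auto
    then obtain p where p: "(N, p) \<in> set L" by auto
    have N: "k \<le> N" if "(k, q) \<in> set L" for k q
      unfolding N_def using that by (intro Max_ge) force+
    have N2: "2 \<le> N" using step(2) N by fastforce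
    define K where "K = remove1 (N, p) L"
    have LK: "set L = insert (N, p) (set K)" unfolding K_def by (rule set_remove1_insert[OF p])
    define A where "A = (N - 1, \<lambda>e. pderiv (p e)) # K"
    have parA: "parametric_poly k q" "0 < k" "k \<le> N" if "(k, q) \<in> set A" for k q
    proof -
      have "parametric_poly (N - 1) (\<lambda>e. pderiv (p e))" using parametric_poly_pderiv par p by blast
      moreover have "(k = N - 1 \<and> q = (\<lambda>e. pderiv (p e))) \<or> (k, q) \<in> set L"
        using that LK by (auto simp: A_def)
      ultimately show "parametric_poly k q" "0 < k" "k \<le> N" using par step(1) N N2 by auto
    qed
    have "\<forall>x\<in>set A. \<exists>y. fst y < fst x \<and> parametric_poly (fst y) (snd y) \<and>
        (\<forall>e z. coeff (snd x e) (fst x - 1) \<noteq> 0 \<longrightarrow> poly (snd x e) z = 0 \<longrightarrow>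
          sgn (poly (snd y e) z) = sgn (poly (p e) z))"
    proof
      fix x assume "x \<in> set A"
      then have x: "parametric_poly (fst x) (snd x)" "0 < fst x" using parA[of "fst x" "snd x"] by auto
      obtain j r where "j < fst x" "parametric_poly j r"
        "\<forall>e z. coeff (snd x e) (fst x - 1) \<noteq> 0 \<longrightarrow> poly (snd x e) z = 0 \<longrightarrow>
          sgn (poly (r e) z) = sgn (poly (p e) z)"
        using parametric_remainder[OF par[OF p] x] by blast
      then show "\<exists>y. fst y < fst x \<and> parametric_poly (fst y) (snd y) \<and>
        (\<forall>e z. coeff (snd x e) (fst x - 1) \<noteq> 0 \<longrightarrow> poly (snd x e) z = 0 \<longrightarrow>
          sgn (poly (snd y e) z) = sgn (poly (p e) z))"
        by (intro exI[of _ "(j, r)"]) simp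
    qed
    from bchoice[OF this] obtain f where f: "\<And>x. x \<in> set A \<Longrightarrow> fst (f x) < fst x \<and>
        parametric_poly (fst (f x)) (snd (f x)) \<and>
        (\<forall>e z. coeff (snd x e) (fst x - 1) \<noteq> 0 \<longrightarrow> poly (snd x e) z = 0 \<longrightarrow>
          sgn (poly (snd (f x) e) z) = sgn (poly (p e) z))" by blast
    define R where "R = map f A"
    have "uniformly_matched (A @ R)"
    proof (rule IH[OF p, of _ "(N - 1, \<lambda>e. pderiv (p e)) # R"])
      show "mset (map fst (A @ R)) =
          mset (map fst (remove1 (N, p) L)) + mset (map fst ((N - 1, \<lambda>e. pderiv (p e)) # R))"
        by (simp add: A_def K_def)
      show "k < N" if "(k, q) \<in> set ((N - 1, \<lambda>e. pderiv (p e)) # R)" for k q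
      proof -
        have "(k, q) \<in> set R \<or> k = N - 1" using that by auto
        moreover have "k < N" if kq: "(k, q) \<in> set R"
        proof -
          obtain x where x: "x \<in> set A" "(k, q) = f x" using kq by (auto simp: R_def)
          then have "k < fst x" using f[OF x(1)] by (metis fst_conv)
          then show ?thesis using parA(3)[of "fst x" "snd x"] x(1) by simp
        qed
        ultimately show ?thesis using N2 by auto
      qed
      show "parametric_poly k q" if kq: "(k, q) \<in> set (A @ R)" for k q
      proof (cases "(k, q) \<in> set A")
        case True then show ?thesis by (rule parA)
      next
        case False
        then obtain x where x: "x \<in> set A" "(k, q) = f x" using kq by (auto simp: R_def)
        then show ?thesis using f[OF x(1)] by (metis fst_conv snd_conv)
      qed
    qed
    then obtain Q1 where Q1: "finite Q1" "\<And>q. q \<in> Q1 \<Longrightarrow> poly_fun q"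
      "\<And>e e'. same_signs Q1 e e' \<Longrightarrow> \<exists>T. sign_matching T (instances e e' (A @ R))" by (rule uniformly_matchedE) blast
    define drop where "drop = (\<lambda>x :: nat \<times> (('v \<Rightarrow> real) \<Rightarrow> real poly).
      (fst x - 1, \<lambda>e. snd x e - monom (coeff (snd x e) (fst x - 1)) (fst x - 1)) # remove1 x L)"
    have "\<forall>x\<in>set L. uniformly_matched (drop x)"
    proof
      fix x assume "x \<in> set L"
      then have x: "(fst x, snd x) \<in> set L" by simp
      define d where "d = (fst x - 1, \<lambda>e. snd x e - monom (coeff (snd x e) (fst x - 1)) (fst x - 1))"
      have drop: "drop x = d # remove1 x L" by (simp add: drop_def d_def)
      show "uniformly_matched (drop x)"
      proof (rule IH[OF x, of _ "[d]"])
        show "mset (map fst (drop x)) = mset (map fst (remove1 (fst x, snd x) L)) + mset (map fst [d])"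
          by (simp add: drop)
        show "k < fst x" if "(k, q) \<in> set [d]" for k q
          using that step(1)[OF x] by (simp add: d_def)
        show "parametric_poly k q" if "(k, q) \<in> set (drop x)" for k q
        proof -
          have "(k, q) = d \<or> (k, q) \<in> set L" using that unfolding drop by (auto dest: notin_set_remove1)
          then show ?thesis using par parametric_poly_drop_top[OF par[OF x]] by (auto simp: d_def)
        qed
      qed
    qed
    then have "\<forall>x\<in>set L. \<exists>Q. finite Q \<and> (\<forall>q\<in>Q. poly_fun q) \<and>
      (\<forall>e e'. same_signs Q e e' \<longrightarrow> (\<exists>T. sign_matching T (instances e e' (drop x))))"
      unfolding uniformly_matched_def .
    from bchoice[OF this] obtain g where g0: "\<forall>x\<in>set L. finite (g x) \<and> (\<forall>q\<in>g x. poly_fun q) \<and>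
      (\<forall>e e'. same_signs (g x) e e' \<longrightarrow> (\<exists>T. sign_matching T (instances e e' (drop x))))" ..
    then have g: "finite (g x)" "\<forall>q\<in>g x. poly_fun q" if "x \<in> set L" for x
      using that by simp_all
    have gT: "\<exists>T. sign_matching T (instances e e' (drop x))"
      if "x \<in> set L" "same_signs (g x) e e'" for x e e'
      using bspec[OF g0 that(1)] that(2) by blast
    define Q where "Q = (\<lambda>x e. coeff (snd x e) (fst x - 1)) ` set L \<union> (\<Union>x\<in>set L. g x) \<union> Q1"
    have lead: "sgn (coeff (snd x e) (fst x - 1)) = sgn (coeff (snd x e') (fst x - 1))"
      if x: "x \<in> set L" and same: "same_signs Q e e'" for x e e'
    proof -
      have "(\<lambda>e. coeff (snd x e) (fst x - 1)) \<in> Q"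
        unfolding Q_def by (intro UnI1, rule image_eqI[OF _ x], rule refl)
      then show ?thesis using same unfolding same_signs_def by fast
    qed
    have "finite Q" using Q1(1) g(1) by (simp add: Q_def)
    moreover have "poly_fun q" if "q \<in> Q" for q
      using that Q1 g par by (auto simp: Q_def parametric_poly_def)
    moreover have "\<exists>T. sign_matching T (instances e e' L)" if same: "same_signs Q e e'" for e e'
    proof (cases "\<exists>x\<in>set L. coeff (snd x e) (fst x - 1) = 0")
      case True
      then obtain x where x: "x \<in> set L" "coeff (snd x e) (fst x - 1) = 0" by blast
      have "sgn (coeff (snd x e) (fst x - 1)) = sgn (coeff (snd x e') (fst x - 1))"
        by (rule lead[OF x(1) same])
      then have x': "coeff (snd x e') (fst x - 1) = 0" using x(2) by (simp add: sgn_0_0)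
      have "same_signs (g x) e e'" using same x(1) by (auto simp: same_signs_def Q_def)
      then obtain T where "sign_matching T (instances e e' (drop x))" using gT[OF x(1)] by blast
      moreover have "instances e e' (drop x) = instances e e' L"
        using set_remove1_insert[OF x(1)] x(2) x' by (simp add: drop_def)
      ultimately show ?thesis by metis
    next
      case False
      have "same_signs Q1 e e'" using same by (auto simp: same_signs_def Q_def)
      then obtain T where T: "sign_matching T (instances e e' (A @ R))" using Q1 by blast
      show ?thesis
      proof (rule sign_matching_top_degree[OF par _ N2 _ _ A_def _ T])
        fix k q assume kq: "(k, q) \<in> set L"
        have "sgn (coeff (q e) (k - 1)) = sgn (coeff (q e') (k - 1))"
          using lead[OF kq same] by simp
        then show "0 < k \<and> coeff (q e) (k - 1) \<noteq> 0 \<and> sgn (coeff (q e) (k - 1)) = sgn (coeff (q e') (k - 1))"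
          using False step(1)[OF kq] kq by force
      next
        show "set L \<subseteq> insert (N, p) (set K)" "set ((N, p) # K) \<subseteq> set L" using LK by auto
        fix k q assume kq: "(k, q) \<in> set A"
        then have "snd (f (k, q)) \<in> snd ` set R" by (simp add: R_def)
        then show "\<exists>r\<in>snd ` set R. \<forall>e y. coeff (q e) (k - 1) \<noteq> 0 \<longrightarrow> poly (q e) y = 0 \<longrightarrow>
            sgn (poly (r e) y) = sgn (poly (p e) y)"
          using f[OF kq] by (metis fst_conv snd_conv)
      qed
    qed
    ultimately show ?thesis by (rule uniformly_matchedI)
  qed
qed

lemma poly_fun_as_parametric_poly:
  assumes "poly_fun p"
  shows "\<exists>n q. parametric_poly n q \<and> (\<forall>e y. poly (q e) y = p (e(v := y)))"
  using assms
proof induction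
  case (const c)
  have "parametric_poly 1 (\<lambda>e. [:c:])"
    unfolding parametric_poly_def coeff_pCons by (auto split: nat.split intro: poly_fun.const)
  then show ?case by (intro exI[of _ 1] exI[of _ "\<lambda>e. [:c:]"]) simp
next
  case (var w)
  show ?case
  proof (cases "w = v")
    case True
    have "parametric_poly 2 (\<lambda>e. [:0, 1:])"
      unfolding parametric_poly_def coeff_pCons
      by (auto split: nat.split intro: poly_fun.const)
    then show ?thesis using True by (intro exI[of _ 2] exI[of _ "\<lambda>e. [:0, 1:]"]) simp
  next
    case False
    have "poly_fun (\<lambda>e. coeff [:e w:] i)" for i
      by (cases i) (simp_all add: poly_fun.const poly_fun.var)
    then have "parametric_poly 1 (\<lambda>e. [:e w:])"
      unfolding parametric_poly_def by (auto simp: coeff_pCons split: nat.split)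
    then show ?thesis using False by (intro exI[of _ 1] exI[of _ "\<lambda>e. [:e w:]"]) simp
  qed
next
  case (add p q)
  then obtain n m p' q' where *: "parametric_poly n p'" "\<forall>e y. poly (p' e) y = p (e(v := y))"
    "parametric_poly m q'" "\<forall>e y. poly (q' e) y = q (e(v := y))" by blast
  have "parametric_poly (max n m) (\<lambda>e. p' e + q' e)"
    using * by (auto simp: parametric_poly_def intro: poly_fun.add)
  then show ?case using * by (intro exI[of _ "max n m"] exI[of _ "\<lambda>e. p' e + q' e"])
      (simp only: poly_add simp_thms)
next
  case (mult p q)
  then obtain n m p' q' where *: "parametric_poly n p'" "\<forall>e y. poly (p' e) y = p (e(v := y))"
    "parametric_poly m q'" "\<forall>e y. poly (q' e) y = q (e(v := y))" by blast
  have "poly_fun (\<lambda>e. coeff (p' e * q' e) i)" for i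
    using * unfolding coeff_mult parametric_poly_def by (auto intro!: poly_fun_sum poly_fun.mult)
  moreover have "coeff (p' e * q' e) i = 0" if "n + m \<le> i" for e i
    unfolding coeff_mult
  proof (rule sum.neutral, rule ballI)
    fix j assume "j \<in> {..i}"
    then have "n \<le> j \<or> m \<le> i - j" using that by auto
    then show "coeff (p' e) j * coeff (q' e) (i - j) = 0" using * by (auto simp: parametric_poly_def)
  qed
  ultimately have "parametric_poly (n + m) (\<lambda>e. p' e * q' e)" by (simp add: parametric_poly_def)
  then show ?case using * by (intro exI[of _ "n + m"] exI[of _ "\<lambda>e. p' e * q' e"])
      (simp only: poly_mult simp_thms)
qed

text \<open>This expresses that \<open>A\<close> is semi-algebraic: \<open>A\<close> is a union of sign classes of finitely many
  polynomial functions. In this form, elimination of a quantifier only requires moving witnesses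
  between parameters of the same class.\<close>

definition sign_determined :: "('v \<Rightarrow> real) set \<Rightarrow> bool" where
  "sign_determined A \<longleftrightarrow> (\<exists>Q. finite Q \<and> (\<forall>q\<in>Q. poly_fun q) \<and>
     (\<forall>e e'. same_signs Q e e' \<longrightarrow> e \<in> A \<longrightarrow> e' \<in> A))"

theorem Tarski_Seidenberg:
  assumes "sign_determined A"
  shows "sign_determined {e. \<exists>y. e(v := y) \<in> A}"
proof -
  obtain P where P: "finite P" "\<And>p. p \<in> P \<Longrightarrow> poly_fun p"
    "\<And>e e'. same_signs P e e' \<Longrightarrow> e \<in> A \<Longrightarrow> e' \<in> A"
    using assms unfolding sign_determined_def by blast
  have "\<forall>p\<in>P. \<exists>x. parametric_poly (fst x) (snd x) \<and> (\<forall>e y. poly (snd x e) y = p (e(v := y)))"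
  proof
    fix p assume "p \<in> P"
    then obtain n q where "parametric_poly n q" "\<forall>e y. poly (q e) y = p (e(v := y))"
      using poly_fun_as_parametric_poly[OF P(2)] by blast
    then show "\<exists>x. parametric_poly (fst x) (snd x) \<and> (\<forall>e y. poly (snd x e) y = p (e(v := y)))"
      by (intro exI[of _ "(n, q)"]) simp
  qed
  from bchoice[OF this] obtain f where
    f: "\<And>p. p \<in> P \<Longrightarrow> parametric_poly (fst (f p)) (snd (f p)) \<and> (\<forall>e y. poly (snd (f p) e) y = p (e(v := y)))"
    by blast
  from finite_list[OF finite_imageI[OF P(1)]] obtain L where L: "set L = f ` P" ..
  have "\<forall>x \<in> set L. parametric_poly (fst x) (snd x)" using f unfolding L by blast
  then have "\<forall>(k, q) \<in> set L. parametric_poly k q" by (simp add: split_beta)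
  from uniform_sign_matching[OF this] obtain Q where Q: "finite Q" "\<And>q. q \<in> Q \<Longrightarrow> poly_fun q"
    "\<And>e e'. same_signs Q e e' \<Longrightarrow> \<exists>T. sign_matching T (instances e e' L)" by (rule uniformly_matchedE) blast
  have "\<exists>y'. e'(v := y') \<in> A" if same: "same_signs Q e e'" and y: "e(v := y) \<in> A" for e e' y
  proof -
    obtain T where T: "sign_matching T (instances e e' L)" using Q(3)[OF same] by blast
    obtain y' where y': "partial_iso (insert (y, y') T)"
      by (rule partial_iso_extend[of T y]) (use T in \<open>simp_all add: sign_matching_def\<close>)
    have "sgn (p (e(v := y))) = sgn (p (e'(v := y')))" if "p \<in> P" for p
    proof -
      have "(poly (snd (f p) e), poly (snd (f p) e')) \<in> instances e e' L" using that L by auto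
      then have "sgn (poly (snd (f p) e) y) = sgn (poly (snd (f p) e') y')"
        using T y' unfolding sign_matching_def by blast
      then show ?thesis using f[OF that] by simp
    qed
    then have "same_signs P (e(v := y)) (e'(v := y'))" by (simp add: same_signs_def)
    then show ?thesis using P(3) y by blast
  qed
  then show ?thesis unfolding sign_determined_def using Q(1,2) by (intro exI[of _ Q]) (simp, blast)
qed

lemma sign_determinedI:
  assumes "finite Q" "\<And>q. q \<in> Q \<Longrightarrow> poly_fun q" "\<And>e e'. same_signs Q e e' \<Longrightarrow> e \<in> A \<Longrightarrow> e' \<in> A"
  shows "sign_determined A"
  unfolding sign_determined_def by (intro exI[of _ Q] conjI ballI allI impI) (fact assms)+

lemma sign_determinedE:
  assumes "sign_determined A"
  obtains Q where "finite Q" "\<And>q. q \<in> Q \<Longrightarrow> poly_fun q"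
    "\<And>e e'. same_signs Q e e' \<Longrightarrow> e \<in> A \<longleftrightarrow> e' \<in> A"
proof -
  obtain Q where Q: "finite Q" "\<And>q. q \<in> Q \<Longrightarrow> poly_fun q"
    "\<And>e e'. same_signs Q e e' \<Longrightarrow> e \<in> A \<Longrightarrow> e' \<in> A"
    using assms unfolding sign_determined_def by blast
  have "same_signs Q e' e" if "same_signs Q e e'" for e e' using that by (simp add: same_signs_def)
  then show ?thesis using that[of Q] Q by blast
qed

lemma sign_determined_Compl: "sign_determined A \<Longrightarrow> sign_determined (- A)"
  by (erule sign_determinedE, rule sign_determinedI) auto

lemma sign_determined_Int:
  assumes "sign_determined A" "sign_determined B"
  shows "sign_determined (A \<inter> B)"
proof -
  obtain P where P: "finite P" "\<And>q. q \<in> P \<Longrightarrow> poly_fun q" "\<And>e e'. same_signs P e e' \<Longrightarrow> e \<in> A \<longleftrightarrow> e' \<in> A"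
    using assms(1) by (rule sign_determinedE) blast
  obtain Q where Q: "finite Q" "\<And>q. q \<in> Q \<Longrightarrow> poly_fun q" "\<And>e e'. same_signs Q e e' \<Longrightarrow> e \<in> B \<longleftrightarrow> e' \<in> B"
    using assms(2) by (rule sign_determinedE) blast
  show ?thesis
  proof (rule sign_determinedI[of "P \<union> Q"])
    fix e e' assume "same_signs (P \<union> Q) e e'"
    then have "same_signs P e e'" "same_signs Q e e'" by (auto simp: same_signs_def)
    then show "e \<in> A \<inter> B \<Longrightarrow> e' \<in> A \<inter> B" using P(3) Q(3) by blast
  qed (use P Q in auto)
qed

lemma sign_determined_Un:
  assumes "sign_determined A" "sign_determined B"
  shows "sign_determined (A \<union> B)"
proof -
  have "A \<union> B = - (- A \<inter> - B)" by blast
  then show ?thesis using assms by (metis sign_determined_Compl sign_determined_Int)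
qed

lemma sign_determined_pos: "poly_fun p \<Longrightarrow> sign_determined {e. 0 < p e}"
  by (rule sign_determinedI[of "{p}"]) (auto simp: same_signs_def sgn_if split: if_splits)

lemma sign_determined_le: "poly_fun p \<Longrightarrow> poly_fun q \<Longrightarrow> sign_determined {e. p e \<le> q e}"
  using sign_determined_Compl[OF sign_determined_pos[OF poly_fun_diff[of p q]]]
  by (simp add: Collect_neg_eq[symmetric] not_less)

lemma sign_determined_eq:
  assumes "poly_fun p" "poly_fun q"
  shows "sign_determined {e. p e = q e}"
proof -
  have "{e. p e = q e} = {e. p e \<le> q e} \<inter> {e. q e \<le> p e}" by auto
  then show ?thesis using assms by (simp add: sign_determined_Int sign_determined_le)
qed

lemma sign_determined_Inter:
  assumes "finite I" "\<And>i. i \<in> I \<Longrightarrow> sign_determined (A i)"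
  shows "sign_determined {e. \<forall>i\<in>I. e \<in> A i}"
  using assms
proof (induction I)
  case empty
  show ?case by (rule sign_determinedI[of "{}"]) auto
next
  case (insert i I)
  have "{e. \<forall>j\<in>insert i I. e \<in> A j} = A i \<inter> {e. \<forall>j\<in>I. e \<in> A j}" by auto
  then show ?case using insert by (simp add: sign_determined_Int)
qed

lemma sign_determined_projection:
  assumes "finite D" "sign_determined A"
  shows "sign_determined {e. \<exists>e'\<in>A. \<forall>v. v \<notin> D \<longrightarrow> e' v = e v}"
  using assms(1)
proof (induction D)
  case empty
  have "{e. \<exists>e'\<in>A. \<forall>v. v \<notin> {} \<longrightarrow> e' v = e v} = A" by (auto simp flip: fun_eq_iff)
  then show ?case using assms(2) by simp
next
  case (insert w D)
  have "{e. \<exists>e'\<in>A. \<forall>v. v \<notin> insert w D \<longrightarrow> e' v = e v} =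
      {e. \<exists>y. e(w := y) \<in> {e. \<exists>e'\<in>A. \<forall>v. v \<notin> D \<longrightarrow> e' v = e v}}" (is "?L = ?R")
  proof (intro set_eqI iffI)
    fix e assume "e \<in> ?L"
    then obtain e' where e': "e' \<in> A" "\<And>v. v \<notin> insert w D \<Longrightarrow> e' v = e v" by blast
    then have "\<forall>v. v \<notin> D \<longrightarrow> e' v = (e(w := e' w)) v" by auto
    then show "e \<in> ?R" using e'(1) by blast
  next
    fix e assume "e \<in> ?R"
    then obtain y e' where e': "e' \<in> A" "\<And>v. v \<notin> D \<Longrightarrow> e' v = (e(w := y)) v" by blast
    then have "\<forall>v. v \<notin> insert w D \<longrightarrow> e' v = e v" by simp
    then show "e \<in> ?L" using e'(1) by blast
  qed
  then show ?case using Tarski_Seidenberg[OF insert.IH] by simp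
qed

lemma poly_fun_real_polynomial_function:
  fixes h :: "('v \<Rightarrow> real) \<Rightarrow> 'a::euclidean_space"
  assumes "real_polynomial_function p" "\<And>b. b \<in> Basis \<Longrightarrow> poly_fun (\<lambda>e. h e \<bullet> b)"
  shows "poly_fun (\<lambda>e. p (h e))"
  using assms(1)
proof induction
  case (linear f)
  then interpret bounded_linear f .
  have "f (h e) = (\<Sum>b\<in>Basis. (h e \<bullet> b) * f b)" for e
  proof -
    have "f (h e) = f (\<Sum>b\<in>Basis. (h e \<bullet> b) *\<^sub>R b)" by (simp add: euclidean_representation)
    also have "\<dots> = (\<Sum>b\<in>Basis. (h e \<bullet> b) * f b)" by (simp add: sum scaleR)
    finally show ?thesis .
  qed
  then show ?case using assms(2) by (simp add: poly_fun_sum poly_fun.mult poly_fun.const)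
qed (auto intro: poly_fun.intros)

lemma sign_determined_semialgebraic:
  fixes h :: "('v \<Rightarrow> real) \<Rightarrow> 'a::euclidean_space"
  assumes "semialgebraic S" "\<And>b. b \<in> Basis \<Longrightarrow> poly_fun (\<lambda>e. h e \<bullet> b)"
  shows "sign_determined {e. h e \<in> S}"
  using assms(1)
proof induction
  case (pos p)
  show ?case using sign_determined_pos[OF poly_fun_real_polynomial_function[OF pos assms(2)]] by simp
next
  case (compl A)
  then show ?case using sign_determined_Compl by (force simp: Collect_neg_eq)
next
  case (inter A B)
  then show ?case using sign_determined_Int by (force simp: Collect_conj_eq)
next
  case (union A B)
  then show ?case using sign_determined_Un by (force simp: Collect_disj_eq)
qed

section \<open>Polynomial growth and the comparison of logarithms\<close>

abbreviation two_values :: "'v \<Rightarrow> 'v \<Rightarrow> real \<Rightarrow> real \<Rightarrow> 'v \<Rightarrow> real" where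
  "two_values s z \<sigma> \<zeta> \<equiv> (\<lambda>_. 0)(s := \<sigma>, z := \<zeta>)"

lemma poly_fun_two_values:
  assumes "poly_fun p" "s \<noteq> z"
  shows "\<exists>P :: real poly poly. \<forall>\<sigma> \<zeta>. p (two_values s z \<sigma> \<zeta>) = poly (poly P [:\<zeta>:]) \<sigma>"
  using assms(1)
proof induction
  case (const c)
  show ?case by (intro exI[of _ "[:[:c:]:]"]) simp
next
  case (var v)
  consider "v = z" | "v = s" | "v \<noteq> z" "v \<noteq> s" by blast
  then show ?case
  proof cases
    case 1 then show ?thesis by (intro exI[of _ "[:0, 1:]"]) simp
  next
    case 2 then show ?thesis using assms(2) by (intro exI[of _ "[:[:0, 1:]:]"]) simp
  next
    case 3 then show ?thesis by (intro exI[of _ 0]) simp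
  qed
next
  case (add p q)
  then obtain P Q where "\<forall>\<sigma> \<zeta>. p (two_values s z \<sigma> \<zeta>) = poly (poly P [:\<zeta>:]) \<sigma>"
    "\<forall>\<sigma> \<zeta>. q (two_values s z \<sigma> \<zeta>) = poly (poly Q [:\<zeta>:]) \<sigma>" by blast
  then show ?case by (intro exI[of _ "P + Q"]) (simp only: poly_add simp_thms)
next
  case (mult p q)
  then obtain P Q where "\<forall>\<sigma> \<zeta>. p (two_values s z \<sigma> \<zeta>) = poly (poly P [:\<zeta>:]) \<sigma>"
    "\<forall>\<sigma> \<zeta>. q (two_values s z \<sigma> \<zeta>) = poly (poly Q [:\<zeta>:]) \<sigma>" by blast
  then show ?case by (intro exI[of _ "P * Q"]) (simp only: poly_mult simp_thms)
qed

lemma poly_eventually_away_from_0: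
  fixes q :: "real poly"
  assumes "q \<noteq> 0"
  shows "\<exists>a C. 0 < a \<and> (\<forall>\<sigma>\<ge>C. a \<le> \<bar>poly q \<sigma>\<bar>)"
proof (cases "0 < lead_coeff q")
  case True
  then obtain C where "\<forall>\<sigma>\<ge>C. lead_coeff q \<le> poly q \<sigma>" using poly_pinfty_gt_lc by blast
  then show ?thesis using True by (intro exI[of _ "lead_coeff q"] exI[of _ C]) force
next
  case False
  then have neg: "0 < lead_coeff (- q)" using assms by (simp add: less_le)
  then obtain C where "\<forall>\<sigma>\<ge>C. lead_coeff (- q) \<le> poly (- q) \<sigma>" using poly_pinfty_gt_lc by blast
  then show ?thesis using neg by (intro exI[of _ "lead_coeff (- q)"] exI[of _ C]) force
qed

lemma poly_eventually_le_power:
  fixes q :: "real poly"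
  shows "\<exists>k C. \<forall>\<sigma>\<ge>C. \<bar>poly q \<sigma>\<bar> \<le> \<sigma> ^ k"
proof (induction q)
  case 0
  show ?case by (intro exI[of _ 0]) simp
next
  case (pCons a q)
  then obtain k C where kC: "\<forall>\<sigma>\<ge>C. \<bar>poly q \<sigma>\<bar> \<le> \<sigma> ^ k" by blast
  have "\<bar>poly (pCons a q) \<sigma>\<bar> \<le> \<sigma> ^ Suc (Suc k)" if \<sigma>: "max C (1 + \<bar>a\<bar>) \<le> \<sigma>" for \<sigma>
  proof -
    have 1: "1 \<le> \<sigma>" "\<bar>a\<bar> \<le> \<sigma> - 1" "C \<le> \<sigma>" using \<sigma> by auto
    have p1: "1 \<le> \<sigma> ^ Suc k" by (rule one_le_power[OF 1(1)])
    have "\<bar>poly (pCons a q) \<sigma>\<bar> \<le> \<bar>a\<bar> + \<sigma> * \<bar>poly q \<sigma>\<bar>"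
      using 1 abs_triangle_ineq[of a "\<sigma> * poly q \<sigma>"] by (simp add: abs_mult)
    also have "\<dots> \<le> (\<sigma> - 1) + \<sigma> * \<sigma> ^ k" using kC 1 by (intro add_mono mult_left_mono) auto
    also have "\<dots> \<le> (\<sigma> - 1) * \<sigma> ^ Suc k + \<sigma> ^ Suc k"
      using mult_left_mono[OF p1, of "\<sigma> - 1"] 1 by simp
    also have "\<dots> = \<sigma> ^ Suc (Suc k)" by (simp add: algebra_simps)
    finally show ?thesis .
  qed
  then show ?case by blast
qed

text \<open>Read as a polynomial in \<open>\<zeta>\<close> with coefficients that are polynomials in \<open>\<sigma>\<close>, \<open>P\<close> is dominated by
  its leading term as soon as \<open>\<zeta>\<close> exceeds a suitable power of \<open>\<sigma>\<close>. The bound away from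
  zero is carried along to make the induction in the style of Horner's scheme work.\<close>

lemma leading_coefficient_dominates:
  fixes P :: "real poly poly"
  assumes "P \<noteq> 0"
  shows "\<exists>a N C. 0 < a \<and> (\<forall>\<sigma>\<ge>C. \<forall>\<zeta>>\<sigma> ^ N. a \<le> \<bar>poly (poly P [:\<zeta>:]) \<sigma>\<bar> \<and>
      sgn (poly (poly P [:\<zeta>:]) \<sigma>) = sgn (poly (lead_coeff P) \<sigma>))"
  using assms
proof (induction P)
  case 0
  then show ?case by simp
next
  case (pCons b P)
  show ?case
  proof (cases "P = 0")
    case True
    then have "b \<noteq> 0" using pCons.hyps by simp
    then obtain a C where "0 < a" "\<forall>\<sigma>\<ge>C. a \<le> \<bar>poly b \<sigma>\<bar>" using poly_eventually_away_from_0 by blast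
    then show ?thesis using True by (intro exI[of _ a] exI[of _ 0] exI[of _ C]) simp
  next
    case False
    from pCons.IH[OF False] obtain a N C where a: "0 < a" and
      IH: "\<And>\<sigma> \<zeta>. C \<le> \<sigma> \<Longrightarrow> \<sigma> ^ N < \<zeta> \<Longrightarrow> a \<le> \<bar>poly (poly P [:\<zeta>:]) \<sigma>\<bar> \<and>
        sgn (poly (poly P [:\<zeta>:]) \<sigma>) = sgn (poly (lead_coeff P) \<sigma>)" by blast
    obtain k C' where k: "\<And>\<sigma>. C' \<le> \<sigma> \<Longrightarrow> \<bar>poly b \<sigma>\<bar> \<le> \<sigma> ^ k" using poly_eventually_le_power by blast
    have "1 \<le> \<bar>poly (poly (pCons b P) [:\<zeta>:]) \<sigma>\<bar> \<and>
        sgn (poly (poly (pCons b P) [:\<zeta>:]) \<sigma>) = sgn (poly (lead_coeff (pCons b P)) \<sigma>)"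
      if \<sigma>: "max (max C C') (max 1 (2 / a)) \<le> \<sigma>" and \<zeta>: "\<sigma> ^ max N (Suc k) < \<zeta>" for \<sigma> \<zeta>
    proof -
      define u where "u = poly (poly P [:\<zeta>:]) \<sigma>"
      have s: "1 \<le> \<sigma>" "C \<le> \<sigma>" "C' \<le> \<sigma>" "2 / a \<le> \<sigma>" using \<sigma> by auto
      have "\<sigma> ^ N \<le> \<sigma> ^ max N (Suc k)" "\<sigma> ^ Suc k \<le> \<sigma> ^ max N (Suc k)"
        using s(1) by (intro power_increasing; simp)+
      then have z: "\<sigma> ^ N < \<zeta>" "\<sigma> ^ Suc k < \<zeta>" using \<zeta> by linarith+
      have p1: "1 \<le> \<sigma> ^ k" by (rule one_le_power[OF s(1)])
      have u: "a \<le> \<bar>u\<bar>" "sgn u = sgn (poly (lead_coeff P) \<sigma>)" using IH[OF s(2) z(1)] by (auto simp: u_def)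
      have z0: "0 < \<zeta>" using z(2) zero_less_power[of \<sigma> "Suc k"] s(1) by linarith
      have "2 \<le> a * \<sigma>" using s(4) a by (simp add: field_simps)
      then have "2 * \<sigma> ^ k \<le> a * \<sigma> * \<sigma> ^ k" using p1 by (intro mult_right_mono) auto
      also have "\<dots> = a * \<sigma> ^ Suc k" by simp
      also have "\<dots> \<le> \<bar>u\<bar> * \<zeta>" using u(1) z(2) a p1 s(1) by (intro mult_mono) auto
      finally have big: "2 * \<sigma> ^ k \<le> \<bar>\<zeta> * u\<bar>" using z0
        by (simp add: abs_mult mult.commute)
      have b: "\<bar>poly b \<sigma>\<bar> \<le> \<sigma> ^ k" by (rule k[OF s(3)])
      have "sgn (\<zeta> * u) = sgn u" using z0 by (simp add: sgn_mult)
      moreover have "sgn (poly b \<sigma> + \<zeta> * u) = sgn (\<zeta> * u)" "1 \<le> \<bar>poly b \<sigma> + \<zeta> * u\<bar>"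
        using big b p1 by (auto simp: sgn_if split: if_splits)
      ultimately show ?thesis using u(2) False by (simp add: u_def mult.commute)
    qed
    then show ?thesis 
      by (intro exI[of _ 1] exI[of _ "max N (Suc k)"] exI[of _ "max (max C C') (max 1 (2 / a))"])
        (simp only: zero_less_one simp_thms, blast)
  qed
qed

lemma poly_fun_eventually_constant_sign:
  assumes "poly_fun p" "s \<noteq> z"
  shows "\<forall>\<^sub>F M in sequentially. \<forall>\<sigma>\<ge>real M. \<forall>\<zeta>>\<sigma> ^ M. \<forall>\<zeta>'>\<sigma> ^ M.
    sgn (p (two_values s z \<sigma> \<zeta>)) = sgn (p (two_values s z \<sigma> \<zeta>'))"
proof -
  obtain P :: "real poly poly" where P: "\<And>\<sigma> \<zeta>. p (two_values s z \<sigma> \<zeta>) = poly (poly P [:\<zeta>:]) \<sigma>"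
    using poly_fun_two_values[OF assms] by blast
  have "\<exists>N C. \<forall>\<sigma>\<ge>C. \<forall>\<zeta>>\<sigma> ^ N. sgn (poly (poly P [:\<zeta>:]) \<sigma>) = sgn (poly (lead_coeff P) \<sigma>)"
    using leading_coefficient_dominates[of P] by (cases "P = 0") auto
  then obtain N C where NC: "\<And>\<sigma> \<zeta>. C \<le> \<sigma> \<Longrightarrow> \<sigma> ^ N < \<zeta> \<Longrightarrow>
      sgn (p (two_values s z \<sigma> \<zeta>)) = sgn (poly (lead_coeff P) \<sigma>)" unfolding P by blast
  obtain K :: nat where K: "C \<le> real K" using real_arch_simple by blast
  show ?thesis
  proof (rule eventually_sequentiallyI[of "max (max 1 K) N"], intro allI impI)
    fix M :: nat and \<sigma> \<zeta> \<zeta>' :: real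
    assume M: "max (max 1 K) N \<le> M" and \<sigma>: "real M \<le> \<sigma>" and \<zeta>: "\<sigma> ^ M < \<zeta>" "\<sigma> ^ M < \<zeta>'"
    have "1 \<le> \<sigma>" "C \<le> \<sigma>" using M \<sigma> K by auto
    moreover have "\<sigma> ^ N \<le> \<sigma> ^ M" using M \<open>1 \<le> \<sigma>\<close> by (intro power_increasing) auto
    ultimately show "sgn (p (two_values s z \<sigma> \<zeta>)) = sgn (p (two_values s z \<sigma> \<zeta>'))"
      using NC \<zeta> by (metis order_le_less_trans)
  qed
qed

text \<open>Above \<open>\<sigma>\<^sup>M\<close> all defining polynomials have constant sign. A point of \<open>B\<close> there would
  put an unbounded interval into \<open>B\<close>.\<close>

theorem sign_determined_polynomial_growth:
  assumes "sign_determined B" "s \<noteq> z" and bdd: "\<And>\<sigma>. bdd_above {\<zeta>. two_values s z \<sigma> \<zeta> \<in> B}"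
  shows "\<exists>M::nat. \<forall>\<sigma>\<ge>real M. \<forall>\<zeta>. two_values s z \<sigma> \<zeta> \<in> B \<longrightarrow> \<zeta> \<le> \<sigma> ^ M"
proof -
  obtain Q where Q: "finite Q" "\<And>q. q \<in> Q \<Longrightarrow> poly_fun q" "\<And>e e'. same_signs Q e e' \<Longrightarrow> e \<in> B \<longleftrightarrow> e' \<in> B"
    using assms(1) by (rule sign_determinedE) blast
  have "\<forall>\<^sub>F M in sequentially. \<forall>q\<in>Q. \<forall>\<sigma>\<ge>real M. \<forall>\<zeta>>\<sigma> ^ M. \<forall>\<zeta>'>\<sigma> ^ M.
      sgn (q (two_values s z \<sigma> \<zeta>)) = sgn (q (two_values s z \<sigma> \<zeta>'))"
    using poly_fun_eventually_constant_sign[OF Q(2) assms(2)] by (intro eventually_ball_finite Q(1)) blast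
  then obtain M :: nat where M: "\<forall>q\<in>Q. \<forall>\<sigma>\<ge>real M. \<forall>\<zeta>>\<sigma> ^ M. \<forall>\<zeta>'>\<sigma> ^ M.
      sgn (q (two_values s z \<sigma> \<zeta>)) = sgn (q (two_values s z \<sigma> \<zeta>'))"
    using eventually_happens'[OF sequentially_bot] by blast
  have "\<zeta> \<le> \<sigma> ^ M" if \<sigma>: "real M \<le> \<sigma>" and B: "two_values s z \<sigma> \<zeta> \<in> B" for \<sigma> \<zeta>
  proof (rule ccontr)
    assume "\<not> \<zeta> \<le> \<sigma> ^ M"
    then have \<zeta>: "\<sigma> ^ M < \<zeta>" by simp
    have "two_values s z \<sigma> \<zeta>' \<in> B" if "\<sigma> ^ M < \<zeta>'" for \<zeta>'
    proof -
      have "same_signs Q (two_values s z \<sigma> \<zeta>) (two_values s z \<sigma> \<zeta>')"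
        using M \<sigma> \<zeta> that unfolding same_signs_def by blast
      then show ?thesis using Q(3) B by blast
    qed
    then have "{\<sigma> ^ M<..} \<subseteq> {\<zeta>. two_values s z \<sigma> \<zeta> \<in> B}" by blast
    then have "bdd_above {\<sigma> ^ M<..}" by (rule bdd_above_mono[OF bdd])
    then obtain b where b: "\<And>x. \<sigma> ^ M < x \<Longrightarrow> x \<le> b" unfolding bdd_above_def by auto
    show False using b[of "max b (\<sigma> ^ M) + 1"] by linarith
  qed
  then show ?thesis by blast
qed

lemma compact_of_finite_proper:
  assumes "finite_proper V F" "0 < a"
  shows "compact {x \<in> V. \<forall>f\<in>F. a \<le> f x \<and> f x \<le> b}"
proof -
  let ?X = "product_topology (\<lambda>_. top_of_set {0 :: real<..}) F"
  have "compactin (top_of_set {0 :: real<..}) {a..b}"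
    using assms(2) by (auto simp: compactin_subtopology)
  then have "compactin ?X (PiE F (\<lambda>_. {a..b}))" by (simp add: compactin_PiE)
  moreover have "proper_map (top_of_set V) ?X (E_map F)" using assms(1) by (simp add: finite_proper_def)
  ultimately have "compactin (top_of_set V) {x \<in> V. E_map F x \<in> PiE F (\<lambda>_. {a..b})}"
    using compactin_proper_map_preimage by fastforce
  moreover have "{x \<in> V. E_map F x \<in> PiE F (\<lambda>_. {a..b})} = {x \<in> V. \<forall>f\<in>F. a \<le> f x \<and> f x \<le> b}"
    by (auto simp: E_map_def PiE_iff)
  ultimately show ?thesis by (simp add: compactin_subtopology)
qed

text \<open>The variables of the semi-algebraic set from which the growth estimate is obtained: the level
  \<open>\<sigma>\<close>, the quantity \<open>\<zeta>\<close> to be bounded, the value of \<open>g\<close>, the coordinates of the point of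
  \<open>V\<close>, and the values of the members of the family.\<close>

datatype ('n, 'f) vars = Level | Bound | Val | Coord 'n | Arg 'f

lemma continuous_positive_bounded:
  fixes g :: "'a::topological_space \<Rightarrow> real"
  assumes "compact K" "continuous_on K g" "\<And>x. x \<in> K \<Longrightarrow> 0 < g x"
  obtains b where "\<And>x. x \<in> K \<Longrightarrow> g x \<le> b" "\<And>x. x \<in> K \<Longrightarrow> 1 / g x \<le> b"
proof -
  have "continuous_on K (\<lambda>x. 1 / g x)" 
    using assms(3) by (intro continuous_on_divide continuous_on_const assms(2)) fastforce
  from compact_continuous_image[OF this assms(1)] have "bdd_above ((\<lambda>x. 1 / g x) ` K)"
    by (intro bounded_imp_bdd_above compact_imp_bounded)
  moreover from compact_continuous_image[OF assms(2,1)] have "bdd_above (g ` K)"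
    by (intro bounded_imp_bdd_above compact_imp_bounded)
  ultimately obtain b1 b2 where "\<And>x. x \<in> K \<Longrightarrow> g x \<le> b1" "\<And>x. x \<in> K \<Longrightarrow> 1 / g x \<le> b2"
    unfolding bdd_above_def by auto
  then show ?thesis using that[of "max b1 b2"] by (meson max.coboundedI1 max.coboundedI2)
qed

text \<open>Only the graphs of the functions are known to be semi-algebraic, so their values enter as
  additional variables, which are then eliminated together with the coordinates.\<close>

theorem ln_growth_comparison:
  fixes V :: "(real^'n) set"
  assumes F: "F \<subseteq> cont_sa_funs V" "finite_proper V F" and g: "g \<in> cont_sa_funs V"
  shows "\<exists>C>0. \<forall>x\<in>V. \<bar>ln (g x)\<bar> \<le> C * (1 + (\<Sum>f\<in>F. \<bar>ln (f x)\<bar>))"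
proof -
  have finF: "finite F" using F(2) by (simp add: finite_proper_def)
  define pt where "pt = (\<lambda>e :: ('n, real^'n \<Rightarrow> real) vars \<Rightarrow> real. (\<chi> i. e (Coord i)) :: real^'n)"
  define graph where "graph = (\<lambda>f :: real^'n \<Rightarrow> real. (\<lambda>x. (x, f x)) ` V)"
  define A where "A = {e. 1 \<le> e Level} \<inter> {e. (pt e, e Val) \<in> graph g} \<inter>
    ({e. e Bound = e Val} \<union> {e. e Bound * e Val = 1}) \<inter>
    {e. \<forall>f\<in>F. e \<in> {e. (pt e, e (Arg f)) \<in> graph f} \<inter> {e. e (Arg f) \<le> e Level} \<inter> {e. 1 \<le> e Level * e (Arg f)}}"
  define D where "D = insert Val (range Coord \<union> Arg ` F :: ('n, real^'n \<Rightarrow> real) vars set)"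
  define B where "B = {e. \<exists>e'\<in>A. \<forall>v. v \<notin> D \<longrightarrow> e' v = e v}"
  have det: "sign_determined {e. (pt e, e w) \<in> graph f}" if "f \<in> cont_sa_funs V" for f w
  proof (rule sign_determined_semialgebraic)
    show "semialgebraic (graph f)"
      using that by (simp add: cont_sa_funs_def semialgebraic_fun_def graph_def)
    show "poly_fun (\<lambda>e. (pt e, e w) \<bullet> b)" for b
      unfolding inner_prod_def inner_vec_def inner_real_def pt_def
      by (simp, intro poly_fun.add poly_fun.mult poly_fun_sum poly_fun.const poly_fun.var)
  qed
  have "sign_determined A"
    unfolding A_def
    using F(1) g
    by (intro sign_determined_Int sign_determined_Un sign_determined_Inter finF det sign_determined_le
        sign_determined_eq poly_fun.const poly_fun.var poly_fun.mult) auto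
  moreover have "finite D" using finF by (simp add: D_def)
  ultimately have "sign_determined B" unfolding B_def by (intro sign_determined_projection)
  have B_iff: "two_values Level Bound \<sigma> \<zeta> \<in> B \<longleftrightarrow>
      1 \<le> \<sigma> \<and> (\<exists>x\<in>V. (\<zeta> = g x \<or> \<zeta> * g x = 1) \<and> (\<forall>f\<in>F. f x \<le> \<sigma> \<and> 1 \<le> \<sigma> * f x))" for \<sigma> \<zeta>
  proof
    assume "two_values Level Bound \<sigma> \<zeta> \<in> B"
    then obtain e where e: "e \<in> A" and eq: "\<And>v. v \<notin> D \<Longrightarrow> e v = two_values Level Bound \<sigma> \<zeta> v"
      unfolding B_def by blast
    have *: "e Level = \<sigma>" "e Bound = \<zeta>" using eq[of Level] eq[of Bound] by (auto simp: D_def)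
    then show "1 \<le> \<sigma> \<and> (\<exists>x\<in>V. (\<zeta> = g x \<or> \<zeta> * g x = 1) \<and> (\<forall>f\<in>F. f x \<le> \<sigma> \<and> 1 \<le> \<sigma> * f x))"
    proof (intro conjI bexI[of _ "pt e"] ballI)
      have g: "1 \<le> e Level" "pt e \<in> V" "e Val = g (pt e)" "e Bound = e Val \<or> e Bound * e Val = 1"
        using e by (auto simp: A_def graph_def)
      then show "1 \<le> \<sigma>" "pt e \<in> V" "\<zeta> = g (pt e) \<or> \<zeta> * g (pt e) = 1" using * by simp_all
      fix f assume "f \<in> F"
      then have "(pt e, e (Arg f)) \<in> graph f" "e (Arg f) \<le> e Level" "1 \<le> e Level * e (Arg f)"
        using e by (simp_all add: A_def)
      moreover from this have "e (Arg f) = f (pt e)" unfolding graph_def by blast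
      ultimately show "f (pt e) \<le> \<sigma>" "1 \<le> \<sigma> * f (pt e)" using * by simp_all
    qed
  next
    assume "1 \<le> \<sigma> \<and> (\<exists>x\<in>V. (\<zeta> = g x \<or> \<zeta> * g x = 1) \<and> (\<forall>f\<in>F. f x \<le> \<sigma> \<and> 1 \<le> \<sigma> * f x))"
    then obtain x where x: "1 \<le> \<sigma>" "x \<in> V" "\<zeta> = g x \<or> \<zeta> * g x = 1" "\<forall>f\<in>F. f x \<le> \<sigma> \<and> 1 \<le> \<sigma> * f x"
      by blast
    define e where "e = (\<lambda>v. case v of Level \<Rightarrow> \<sigma> | Bound \<Rightarrow> \<zeta> | Val \<Rightarrow> g x | Coord i \<Rightarrow> x $ i
      | Arg f \<Rightarrow> if f \<in> F then f x else 0)"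
    have "pt e = x" by (simp add: pt_def e_def vec_eq_iff)
    then have "e \<in> A" using x by (auto simp: A_def graph_def e_def)
    moreover have "e v = two_values Level Bound \<sigma> \<zeta> v" if "v \<notin> D" for v
      using that by (cases v) (auto simp: D_def e_def)
    ultimately show "two_values Level Bound \<sigma> \<zeta> \<in> B" unfolding B_def by blast
  qed
  have pos: "0 < f x" if "f \<in> cont_sa_funs V" "x \<in> V" for f x
    using that by (auto simp: cont_sa_funs_def)
  have "bdd_above {\<zeta>. two_values Level Bound \<sigma> \<zeta> \<in> B}" for \<sigma>
  proof (cases "1 \<le> \<sigma>")
    case True
    define K where "K = {x \<in> V. \<forall>f\<in>F. 1 / \<sigma> \<le> f x \<and> f x \<le> \<sigma>}"
    have "compact K" unfolding K_def using True by (intro compact_of_finite_proper F) simp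
    moreover have "continuous_on K g"
      using g by (auto simp: cont_sa_funs_def K_def elim: continuous_on_subset)
    moreover have "0 < g x" if "x \<in> K" for x using pos[OF g] that by (simp add: K_def)
    ultimately obtain b where b: "\<And>x. x \<in> K \<Longrightarrow> g x \<le> b" "\<And>x. x \<in> K \<Longrightarrow> 1 / g x \<le> b"
      by (rule continuous_positive_bounded) blast+
    show ?thesis
    proof (rule bdd_aboveI[of _ b])
      fix \<zeta> assume "\<zeta> \<in> {\<zeta>. two_values Level Bound \<sigma> \<zeta> \<in> B}"
      then obtain x where x: "x \<in> V" "\<zeta> = g x \<or> \<zeta> * g x = 1" "\<forall>f\<in>F. f x \<le> \<sigma> \<and> 1 \<le> \<sigma> * f x"
        using B_iff by blast
      then have "x \<in> K" using True by (auto simp: K_def field_simps)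
      moreover have "\<zeta> = g x \<or> \<zeta> = 1 / g x" using x(2) pos[OF g x(1)] by (auto simp: field_simps)
      ultimately show "\<zeta> \<le> b" using b by blast
    qed
  next
    case False
    then show ?thesis by (simp only: B_iff) simp
  qed
  from sign_determined_polynomial_growth[OF \<open>sign_determined B\<close> _ this]
  have "\<exists>M::nat. \<forall>\<sigma>\<ge>real M. \<forall>\<zeta>. two_values Level Bound \<sigma> \<zeta> \<in> B \<longrightarrow> \<zeta> \<le> \<sigma> ^ M" by simp
  then obtain M :: nat where
    M: "\<forall>\<sigma>\<ge>real M. \<forall>\<zeta>. two_values Level Bound \<sigma> \<zeta> \<in> B \<longrightarrow> \<zeta> \<le> \<sigma> ^ M" ..
  have "\<bar>ln (g x)\<bar> \<le> (real M * real M + real M + 1) * (1 + (\<Sum>f\<in>F. \<bar>ln (f x)\<bar>))" if x: "x \<in> V" for x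
  proof -
    define S where "S = (\<Sum>f\<in>F. \<bar>ln (f x)\<bar>)"
    have S: "0 \<le> S" by (simp add: S_def sum_nonneg)
    \<comment> \<open>A level that is at least \<open>M\<close>, to which \<open>x\<close> belongs, and whose logarithm is
      linear in \<open>S\<close>.\<close>
    define \<sigma> where "\<sigma> = exp (real M + S)"
    have "1 + real M \<le> exp (real M)" by (rule exp_ge_add_one_self)
    moreover have "exp (real M) \<le> \<sigma>" using S by (simp add: \<sigma>_def)
    ultimately have \<sigma>: "1 \<le> \<sigma>" "real M \<le> \<sigma>" by linarith+
    have f: "f x \<le> \<sigma> \<and> 1 \<le> \<sigma> * f x" if "f \<in> F" for f
    proof -
      have fx: "0 < f x" using pos that F(1) x by blast
      have "\<bar>ln (f x)\<bar> \<le> S" unfolding S_def using that finF by (intro member_le_sum) auto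
      then have "ln (f x) \<le> real M + S" "- ln (f x) \<le> real M + S" by auto
      then have "exp (ln (f x)) \<le> \<sigma>" "exp (- ln (f x)) \<le> \<sigma>" unfolding \<sigma>_def by simp_all
      then show ?thesis using fx by (simp add: exp_minus field_simps)
    qed
    have gx: "0 < g x" using pos[OF g x] .
    have "two_values Level Bound \<sigma> (g x) \<in> B" "two_values Level Bound \<sigma> (1 / g x) \<in> B"
      unfolding B_iff using \<sigma> x f gx by auto
    then have "g x \<le> \<sigma> ^ M" "1 / g x \<le> \<sigma> ^ M" using M \<sigma> by blast+
    moreover have "\<sigma> ^ M = exp (real M * (real M + S))" by (simp add: \<sigma>_def exp_of_nat_mult)
    ultimately have "ln (g x) \<le> real M * (real M + S)" "ln (1 / g x) \<le> real M * (real M + S)"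
      using gx by (metis exp_gt_zero ln_exp ln_le_cancel_iff zero_less_divide_1_iff)+
    then have "\<bar>ln (g x)\<bar> \<le> real M * (real M + S)" using gx by (simp add: ln_div)
    also have "\<dots> \<le> (real M * real M + real M + 1) * (1 + S)"
      using S by (simp add: algebra_simps)
    finally show ?thesis by (simp add: S_def)
  qed
  then show ?thesis by (intro exI[of _ "real M * real M + real M + 1"]) (auto simp: add_nonneg_pos)
qed

section \<open>The boundary of a single finite family\<close>

lemma L2_set_restrict [simp]: "L2_set (restrict x F) F = L2_set x F"
  by (rule L2_set_cong) auto

lemma L2_set_scaled: "0 \<le> c \<Longrightarrow> L2_set (\<lambda>f. x f * c) F = L2_set x F * c"
  by (simp add: L2_set_left_distrib)

lemma abs_le_L2_set:
  assumes "finite F" "f \<in> F"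
  shows "\<bar>x f\<bar> \<le> L2_set x F"
  using member_le_L2_set[OF assms, of "\<lambda>g. \<bar>x g\<bar>"] by (simp add: L2_set_def)

lemma L2_set_ball_map: "L2_set (ball_map F x) F = L2_set x F / sqrt (1 + (L2_set x F)\<^sup>2)"
proof -
  have "L2_set (\<lambda>f. x f / sqrt (1 + (L2_set x F)\<^sup>2)) F = L2_set (\<lambda>f. x f * inverse (sqrt (1 + (L2_set x F)\<^sup>2))) F"
    by (simp add: divide_inverse)
  also have "\<dots> = L2_set x F * inverse (sqrt (1 + (L2_set x F)\<^sup>2))" by (intro L2_set_scaled) simp
  finally show ?thesis by (simp add: ball_map_def divide_inverse)
qed

lemma one_minus_L2_set_ball_map: "1 - (L2_set (ball_map F x) F)\<^sup>2 = 1 / (1 + (L2_set x F)\<^sup>2)"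
proof -
  have "0 < 1 + (L2_set x F)\<^sup>2" by (simp add: add_pos_nonneg)
  then show ?thesis by (simp add: L2_set_ball_map power_divide field_simps)
qed

lemma L2_set_ball_map_less_1: "L2_set (ball_map F x) F < 1"
proof -
  have "0 < 1 + (L2_set x F)\<^sup>2" by (simp add: add_pos_nonneg)
  then have "0 < 1 - (L2_set (ball_map F x) F)\<^sup>2" by (simp add: one_minus_L2_set_ball_map)
  then have "(L2_set (ball_map F x) F)\<^sup>2 < 1\<^sup>2" by simp
  then show ?thesis by (rule power_less_imp_less_base) simp
qed

lemma inj_on_ball_map: "inj_on (ball_map F) (F \<rightarrow>\<^sub>E UNIV)"
proof (rule inj_onI)
  fix x y assume x: "x \<in> F \<rightarrow>\<^sub>E UNIV" and y: "y \<in> F \<rightarrow>\<^sub>E UNIV" and eq: "ball_map F x = ball_map F y"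
  have pos: "0 < 1 + (L2_set z F)\<^sup>2" for z by (simp add: add_pos_nonneg)
  have "1 / (1 + (L2_set x F)\<^sup>2) = 1 / (1 + (L2_set y F)\<^sup>2)"
    using one_minus_L2_set_ball_map[of F x] one_minus_L2_set_ball_map[of F y] eq by simp
  then have n: "1 + (L2_set x F)\<^sup>2 = 1 + (L2_set y F)\<^sup>2" using pos by (simp add: field_simps)
  have "x f = y f" if "f \<in> F" for f
  proof -
    have "x f / sqrt (1 + (L2_set x F)\<^sup>2) = y f / sqrt (1 + (L2_set x F)\<^sup>2)"
      using fun_cong[OF eq, of f] that n by (simp add: ball_map_def)
    then show ?thesis using pos[of x] by simp
  qed
  then show "x = y" using x y by (intro PiE_ext)
qed

abbreviation ball_point :: "real \<Rightarrow> ('a \<Rightarrow> real) set \<Rightarrow> 'a \<Rightarrow> ('a \<Rightarrow> real) \<Rightarrow> real" where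
  "ball_point t F x \<equiv> ball_map F (L_map t F x)"

lemma L_map_eq: "0 < t \<Longrightarrow> f \<in> F \<Longrightarrow> L_map t F x f = ln (f x) / ln (1 / t)"
  by (simp add: L_map_def Log_map_def E_map_def log_def)

lemma ball_point_in_PiE: "ball_point t F x \<in> F \<rightarrow>\<^sub>E UNIV"
  by (simp add: ball_map_def)

text \<open>The scale \<open>T\<close> is free: it allows the point of the ball to be compared with the image of \<open>x\<close>
  under the logarithm to any other base.\<close>

lemma ball_point_eq:
  assumes "0 < t" "t < 1" "f \<in> F" "0 < T"
  shows "ball_point t F x f =
    (ln (f x) / T) / sqrt ((ln (1 / t) / T)\<^sup>2 + (L2_set (\<lambda>g. ln (g x) / T) F)\<^sup>2)"
proof -
  define c where "c = ln (1 / t) / T"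
  have c: "0 < c" using assms by (simp add: c_def)
  have tau: "0 < ln (1 / t)" using assms by simp
  have "L2_set (L_map t F x) F = L2_set (\<lambda>g. (ln (g x) / T) * inverse c) F"
    using assms by (intro L2_set_cong) (auto simp: L_map_eq c_def)
  also have "\<dots> = L2_set (\<lambda>g. ln (g x) / T) F * inverse c" using c by (intro L2_set_scaled) simp
  finally have n: "L2_set (L_map t F x) F = L2_set (\<lambda>g. ln (g x) / T) F / c" by (simp add: divide_inverse)
  have "c\<^sup>2 + (L2_set (\<lambda>g. ln (g x) / T) F)\<^sup>2 = c\<^sup>2 * (1 + (L2_set (L_map t F x) F)\<^sup>2)"
    using c by (simp add: n power_divide field_simps)
  then have "sqrt (c\<^sup>2 + (L2_set (\<lambda>g. ln (g x) / T) F)\<^sup>2) = c * sqrt (1 + (L2_set (L_map t F x) F)\<^sup>2)"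
    using c by (simp add: real_sqrt_mult)
  moreover have "L_map t F x f = (ln (f x) / T) / c" using assms by (simp add: L_map_eq c_def)
  ultimately show ?thesis using assms(3) by (simp add: ball_map_def c_def[symmetric])
qed

lemma tendsto_L2_set:
  assumes "\<And>f. f \<in> F \<Longrightarrow> ((\<lambda>k. x k f) \<longlongrightarrow> z f) A"
  shows "((\<lambda>k. L2_set (x k) F) \<longlongrightarrow> L2_set z F) A"
  unfolding L2_set_def using assms by (intro tendsto_intros)

lemma continuous_on_L2_set:
  assumes "\<And>f. f \<in> F \<Longrightarrow> continuous_on A (\<lambda>p. h p f)"
  shows "continuous_on A (\<lambda>p. L2_set (h p) F)"
  unfolding L2_set_def using assms by (intro continuous_intros)

lemma continuous_map_L2_set:
  assumes "finite F" "\<And>f. f \<in> F \<Longrightarrow> continuous_map X euclideanreal (\<lambda>p. h p f)"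
  shows "continuous_map X euclideanreal (\<lambda>p. L2_set (h p) F)"
  unfolding L2_set_def
  by (intro continuous_map_sqrt continuous_map_sum continuous_map_real_pow assms)

lemma closure_of_Rspace_sequence:
  assumes "finite F" "z \<in> Rspace F closure_of S"
  obtains s where "\<And>k::nat. s k \<in> S" "\<And>f. f \<in> F \<Longrightarrow> (\<lambda>k. s k f) \<longlonglongrightarrow> z f"
proof -
  have z: "z \<in> F \<rightarrow>\<^sub>E UNIV" using assms(2) closure_of_subset_topspace[of "Rspace F" S] by auto
  have "\<exists>s\<in>S. \<forall>f\<in>F. dist (s f) (z f) < inverse (real (Suc k))" for k
  proof -
    let ?U = "PiE F (\<lambda>f. {y. dist y (z f) < inverse (real (Suc k))})"
    have "open {y. dist y (z f) < inverse (real (Suc k))}" for f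
      by (intro open_Collect_less continuous_intros)
    then have "openin (Rspace F) ?U" using assms(1) by (intro openin_PiE_gen[THEN iffD2]) auto
    moreover have "z \<in> ?U" using z by (auto simp: PiE_iff)
    ultimately obtain s where "s \<in> S" "s \<in> ?U" using assms(2) unfolding in_closure_of by blast
    then show ?thesis by (intro bexI[of _ s]) (auto simp: PiE_iff)
  qed
  then obtain s where s: "\<And>k. s k \<in> S" "\<And>k f. f \<in> F \<Longrightarrow> dist (s k f) (z f) < inverse (real (Suc k))"
    by metis
  have "(\<lambda>k. s k f) \<longlonglongrightarrow> z f" if "f \<in> F" for f
    by (rule metric_tendsto_imp_tendsto[OF LIMSEQ_inverse_real_of_nat])
      (use s(2)[OF that] in \<open>auto intro!: always_eventually less_imp_le\<close>)
  then show ?thesis using that[of s] s(1) by blast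
qed

lemma in_closure_of_Rspace:
  assumes "z \<in> F \<rightarrow>\<^sub>E UNIV" "\<And>k::nat. s k \<in> S" "S \<subseteq> F \<rightarrow>\<^sub>E UNIV"
    "\<And>f. f \<in> F \<Longrightarrow> (\<lambda>k. s k f) \<longlonglongrightarrow> z f"
  shows "z \<in> Rspace F closure_of S"
proof (rule limitin_closedin)
  have "s k \<in> F \<rightarrow>\<^sub>E UNIV" for k using assms(2,3) by blast
  then show "limitin (Rspace F) s z sequentially"
    unfolding limitin_componentwise using assms(1,4) by (auto simp: PiE_iff)
  show "closedin (Rspace F) (Rspace F closure_of S)" by simp
  have "S \<subseteq> Rspace F closure_of S" using assms(3) by (intro closure_of_subset) simp
  then show "\<forall>\<^sub>F k in sequentially. s k \<in> Rspace F closure_of S"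
    using assms(2) by (intro always_eventually) blast
qed simp

lemma L2_set_nonzero:
  assumes "finite F" "x \<in> F \<rightarrow>\<^sub>E UNIV" "x \<noteq> (\<lambda>f\<in>F. 0)"
  shows "L2_set x F \<noteq> 0"
proof
  assume "L2_set x F = 0"
  then have "\<forall>f\<in>F. x f = 0" using assms(1) by (simp add: L2_set_eq_0_iff)
  then have "x = (\<lambda>f\<in>F. 0)" using PiE_arb[OF assms(2)] by (auto simp: fun_eq_iff)
  then show False using assms(3) by contradiction
qed

lemma boundary_sphere:
  assumes "finite F" "z \<in> boundary F W"
  shows "z \<in> F \<rightarrow>\<^sub>E UNIV" "L2_set z F = 1"
proof -
  obtain x where x: "z = direction F x" "x \<in> F \<rightarrow>\<^sub>E UNIV" "x \<noteq> (\<lambda>i\<in>F. 0)"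
    using assms(2) unfolding boundary_def log_limit_set_def by blast
  show "z \<in> F \<rightarrow>\<^sub>E UNIV" by (simp add: x(1) direction_def)
  have "L2_set x F \<noteq> 0" by (rule L2_set_nonzero[OF assms(1) x(2,3)])
  moreover have "L2_set z F = L2_set x F * inverse (L2_set x F)"
    unfolding x(1) direction_def by (simp add: divide_inverse L2_set_scaled)
  ultimately show "L2_set z F = 1" by simp
qed

text \<open>The points of the boundary are the limit points of the image of \<open>V\<close> on the unit sphere. If
  \<open>t\<^sub>k \<rightarrow> 0\<close> and the logarithms to base \<open>1/t\<^sub>k\<close> converge to \<open>x \<noteq> 0\<close>, then the points of the ball
  converge to the direction of \<open>x\<close>. Conversely, a point of the ball can itself be written as a
  logarithm to another base, and that base tends to infinity as the point approaches the sphere.\<close>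

lemma boundary_iff:
  assumes t: "0 < t" "t < 1" and finF: "finite F"
  shows "z \<in> boundary F (E_map F ` V) \<longleftrightarrow>
    z \<in> Rspace F closure_of (ball_point t F ` V) \<and> L2_set z F = 1"
proof
  assume z: "z \<in> boundary F (E_map F ` V)"
  then obtain x where x: "x \<in> log_limit_set F (E_map F ` V)" "x \<noteq> (\<lambda>i\<in>F. 0)" "z = direction F x"
    unfolding boundary_def by blast
  then obtain u w where u: "\<And>k::nat. 0 < u k \<and> u k < 1 \<and> w k \<in> E_map F ` V" "u \<longlonglongrightarrow> 0"
    and lim: "limitin (Rspace F) (\<lambda>k. Log_map F (u k) (w k)) x sequentially"
    unfolding log_limit_set_def by blast
  have xF: "x \<in> F \<rightarrow>\<^sub>E UNIV" using x(1) by (simp add: log_limit_set_def)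
  obtain v where v: "\<And>k. v k \<in> V" "\<And>k. w k = E_map F (v k)" using u(1) unfolding image_iff by metis
  define T where "T = (\<lambda>k. ln (1 / u k))"
  have T: "0 < T k" for k using u(1)[of k] by (simp add: T_def)
  have "filterlim u (at_right 0) sequentially"
    using u(1) by (intro tendsto_imp_filterlim_at_right[OF u(2)] always_eventually) blast
  then have "filterlim (\<lambda>k. inverse (u k)) at_top sequentially"
    by (rule filterlim_compose[OF filterlim_inverse_at_top_right])
  then have "filterlim T at_top sequentially"
    unfolding T_def by (intro filterlim_compose[OF ln_at_top]) (simp add: inverse_eq_divide)
  then have "(\<lambda>k. inverse (T k)) \<longlonglongrightarrow> 0"
    by (intro tendsto_inverse_0_at_top)
  then have Tlim: "(\<lambda>k. ln (1 / t) / T k) \<longlonglongrightarrow> 0"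
    using tendsto_mult_left[of "\<lambda>k. inverse (T k)" 0 sequentially "ln (1 / t)"] by (simp add: divide_inverse)
  have alim: "(\<lambda>k. ln (f (v k)) / T k) \<longlonglongrightarrow> x f" if "f \<in> F" for f
  proof -
    have "(\<lambda>k. Log_map F (u k) (w k) f) \<longlonglongrightarrow> x f"
      using lim that unfolding limitin_componentwise by simp
    moreover have "Log_map F (u k) (w k) f = ln (f (v k)) / T k" for k
      using that by (simp add: Log_map_def v(2) E_map_def log_def T_def)
    ultimately show ?thesis by simp
  qed
  have x0: "L2_set x F \<noteq> 0" by (rule L2_set_nonzero[OF finF xF x(2)])
  have "(\<lambda>k. ball_point t F (v k) f) \<longlonglongrightarrow> z f" if "f \<in> F" for f
  proof -
    have "(\<lambda>k. (ln (f (v k)) / T k) / sqrt ((ln (1 / t) / T k)\<^sup>2 + (L2_set (\<lambda>g. ln (g (v k)) / T k) F)\<^sup>2))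
        \<longlonglongrightarrow> x f / sqrt (0\<^sup>2 + (L2_set x F)\<^sup>2)"
      using x0 by (intro tendsto_divide tendsto_real_sqrt tendsto_add tendsto_power Tlim alim[OF that]
          tendsto_L2_set alim) auto
    moreover have "x f / sqrt (0\<^sup>2 + (L2_set x F)\<^sup>2) = z f" using that by (simp add: x(3) direction_def)
    ultimately show ?thesis using ball_point_eq[OF t that T] by simp
  qed
  then have "z \<in> Rspace F closure_of (ball_point t F ` V)"
    by (intro in_closure_of_Rspace[where s = "\<lambda>k. ball_point t F (v k)"] boundary_sphere[OF finF z])
      (auto simp: v ball_map_def)
  then show "z \<in> Rspace F closure_of (ball_point t F ` V) \<and> L2_set z F = 1"
    using boundary_sphere[OF finF z] by simp
next
  assume z: "z \<in> Rspace F closure_of (ball_point t F ` V) \<and> L2_set z F = 1"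
  have zF: "z \<in> F \<rightarrow>\<^sub>E UNIV" using z closure_of_subset_topspace[of "Rspace F"] by fastforce
  obtain s where s: "\<And>k::nat. s k \<in> ball_point t F ` V" "\<And>f. f \<in> F \<Longrightarrow> (\<lambda>k. s k f) \<longlonglongrightarrow> z f"
    using closure_of_Rspace_sequence[OF finF] z by metis
  obtain v where v: "\<And>k. v k \<in> V" "\<And>k. s k = ball_point t F (v k)" using s(1) unfolding image_iff by metis
  define \<tau> where "\<tau> = ln (1 / t)"
  have \<tau>: "0 < \<tau>" using t by (simp add: \<tau>_def)
  define n where "n = (\<lambda>k. L2_set (\<lambda>g. ln (g (v k))) F)"
  \<comment> \<open>With base \<open>exp (T k)\<close>, the logarithm of the \<open>k\<close>-th point is exactly \<open>s k\<close>.\<close>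
  define T where "T = (\<lambda>k. sqrt (\<tau>\<^sup>2 + (n k)\<^sup>2))"
  have T: "0 < T k" for k using \<tau> by (simp add: T_def add_pos_nonneg)
  have Log: "Log_map F (exp (- T k)) (E_map F (v k)) = s k" for k
  proof (rule PiE_ext[of _ F "\<lambda>_. UNIV"])
    fix f assume f: "f \<in> F"
    have "s k f = ln (f (v k)) / T k"
      using ball_point_eq[OF t f zero_less_one, of "v k"] by (simp add: v T_def n_def \<tau>_def)
    moreover have "ln (1 / exp (- T k)) = T k" by (subst ln_div) simp_all
    ultimately show "Log_map F (exp (- T k)) (E_map F (v k)) f = s k f"
      using f by (simp add: Log_map_def E_map_def log_def)
  qed (simp_all add: v ball_point_in_PiE Log_map_def)
  have Tsq: "(\<tau> / T k)\<^sup>2 = 1 - (L2_set (s k) F)\<^sup>2" for k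
  proof -
    have "L2_set (L_map t F (v k)) F = L2_set (\<lambda>g. ln (g (v k)) * inverse \<tau>) F"
      using t by (intro L2_set_cong) (auto simp: L_map_eq \<tau>_def divide_inverse)
    also have "\<dots> = n k * inverse \<tau>" using \<tau> by (simp add: L2_set_scaled n_def)
    finally have n: "L2_set (L_map t F (v k)) F = n k / \<tau>" by (simp add: divide_inverse)
    have "0 < \<tau>\<^sup>2 + (n k)\<^sup>2" using \<tau> by (simp add: add_pos_nonneg)
    then show ?thesis
      unfolding v(2) one_minus_L2_set_ball_map n using \<tau> by (simp add: T_def power_divide field_simps)
  qed
  have "(\<lambda>k. (\<tau> / T k)\<^sup>2) \<longlonglongrightarrow> 1 - (L2_set z F)\<^sup>2"
    unfolding Tsq by (intro tendsto_intros tendsto_L2_set s)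
  then have "(\<lambda>k. sqrt ((\<tau> / T k)\<^sup>2)) \<longlonglongrightarrow> sqrt 0" using z by (intro tendsto_real_sqrt) simp
  then have "(\<lambda>k. \<tau> / T k) \<longlonglongrightarrow> 0" using \<tau> T by (simp add: less_imp_le)
  then have "(\<lambda>k. inverse \<tau> * (\<tau> / T k)) \<longlonglongrightarrow> inverse \<tau> * 0" by (rule tendsto_mult_left)
  moreover have "inverse \<tau> * (\<tau> / T k) = inverse (T k)" for k using \<tau> by (simp add: field_simps)
  ultimately have "(\<lambda>k. inverse (T k)) \<longlonglongrightarrow> 0" by simp
  then have "filterlim T at_top sequentially"
    using filterlim_inverse_at_top[of "\<lambda>k. inverse (T k)"] T by (simp add: always_eventually)
  then have "filterlim (\<lambda>k. - T k) at_bot sequentially" by (simp add: filterlim_uminus_at_bot)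
  then have "(\<lambda>k. exp (- T k)) \<longlonglongrightarrow> 0" by (rule filterlim_compose[OF exp_at_bot])
  moreover have "limitin (Rspace F) (\<lambda>k. Log_map F (exp (- T k)) (E_map F (v k))) z sequentially"
    unfolding Log limitin_componentwise using zF s v ball_point_in_PiE by (auto simp: PiE_iff ball_map_def)
  moreover have "0 < exp (- T k) \<and> exp (- T k) < 1 \<and> E_map F (v k) \<in> E_map F ` V" for k
    using T[of k] v(1) by simp
  ultimately have "z \<in> log_limit_set F (E_map F ` V)"
    unfolding log_limit_set_def mem_Collect_eq
    by (intro conjI zF exI[of _ "\<lambda>k. exp (- T k)"] exI[of _ "\<lambda>k. E_map F (v k)"] allI)
      (assumption | blast)+
  moreover have "z \<noteq> (\<lambda>i\<in>F. 0)"
  proof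
    assume "z = (\<lambda>i\<in>F. 0)"
    then have "L2_set z F = 0" by (simp add: L2_set_0')
    then show False using z by simp
  qed
  moreover have "direction F z = z"
    using zF z by (intro PiE_ext[of _ F "\<lambda>_. UNIV"]) (auto simp: direction_def)
  ultimately show "z \<in> boundary F (E_map F ` V)" unfolding boundary_def by force
qed

lemma continuous_on_ball_point:
  assumes t: "0 < t" "t < 1" and f: "f \<in> F" and F: "finite F" "F \<subseteq> cont_sa_funs V"
  shows "continuous_on V (\<lambda>x. ball_point t F x f)"
proof -
  have ln: "continuous_on V (\<lambda>x. ln (g x))" if "g \<in> F" for g
  proof (rule continuous_on_ln)
    show "continuous_on V g" using that F(2) by (auto simp: cont_sa_funs_def)
    show "\<forall>x\<in>V. g x \<noteq> 0" using that F(2) by (force simp: cont_sa_funs_def PiE_iff)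
  qed
  have pos: "0 < (ln (1 / t))\<^sup>2 + (L2_set (\<lambda>g. ln (g x)) F)\<^sup>2" for x
    using t by (intro add_pos_nonneg zero_less_power) simp_all
  have "sqrt ((ln (1 / t))\<^sup>2 + (L2_set (\<lambda>g. ln (g x)) F)\<^sup>2) \<noteq> 0" for x
    using real_sqrt_gt_zero[OF pos[of x]] by linarith
  then have "continuous_on V (\<lambda>x. ln (f x) / sqrt ((ln (1 / t))\<^sup>2 + (L2_set (\<lambda>g. ln (g x)) F)\<^sup>2))"
    by (intro continuous_on_divide ln f continuous_on_real_sqrt continuous_on_add continuous_on_power
        continuous_on_const continuous_on_L2_set ballI)
  then show ?thesis using ball_point_eq[OF t f zero_less_one] by simp
qed

text \<open>Properness in terms of the ball: points of \<open>V\<close> that stay away from the sphere stay in a compact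
  set.\<close>

lemma compact_ball_point_sublevel:
  assumes t: "0 < t" "t < 1" and F: "finite_proper V F" "F \<subseteq> cont_sa_funs V" and r: "r < 1"
  shows "compact {x \<in> V. L2_set (ball_point t F x) F \<le> r}"
proof -
  have finF: "finite F" using F(1) by (simp add: finite_proper_def)
  define \<tau> where "\<tau> = ln (1 / t)"
  have \<tau>: "0 < \<tau>" using t by (simp add: \<tau>_def)
  define R where "R = \<tau> / sqrt (1 - r\<^sup>2)"
  define K where "K = {x \<in> V. \<forall>f\<in>F. exp (- R) \<le> f x \<and> f x \<le> exp R}"
  have "compact K" unfolding K_def by (rule compact_of_finite_proper[OF F(1)]) simp
  have sub: "x \<in> K" if x: "x \<in> V" "L2_set (ball_point t F x) F \<le> r" for x
  proof -
    define m where "m = L2_set (L_map t F x) F"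
    have r2: "(L2_set (ball_point t F x) F)\<^sup>2 \<le> r\<^sup>2" using x(2) by (intro power_mono) auto
    have r0: "0 \<le> r" using x(2) L2_set_nonneg[of "ball_point t F x" F] by linarith
    then have r1: "0 < 1 - r\<^sup>2" using r power_strict_mono[of r 1 2] by simp
    have "1 - r\<^sup>2 \<le> 1 / (1 + m\<^sup>2)" using r2 one_minus_L2_set_ball_map[of F "L_map t F x"] by (simp add: m_def)
    then have "(1 - r\<^sup>2) * (1 + m\<^sup>2) \<le> 1"
      by (subst (asm) pos_le_divide_eq) (simp_all add: add_pos_nonneg)
    then have "1 + m\<^sup>2 \<le> 1 / (1 - r\<^sup>2)" by (simp only: pos_le_divide_eq[OF r1] mult.commute)
    then have "m\<^sup>2 \<le> 1 / (1 - r\<^sup>2)" by simp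
    then have "sqrt (m\<^sup>2) \<le> sqrt (1 / (1 - r\<^sup>2))" by (rule real_sqrt_le_mono)
    then have m: "m \<le> 1 / sqrt (1 - r\<^sup>2)" by (simp add: m_def real_sqrt_divide)
    have "exp (- R) \<le> f x \<and> f x \<le> exp R" if f: "f \<in> F" for f
    proof -
      have fx: "0 < f x" using f F(2) x(1) by (force simp: cont_sa_funs_def PiE_iff)
      have "\<bar>L_map t F x f\<bar> \<le> m"
        unfolding m_def by (rule abs_le_L2_set[OF finF f])
      then have "\<bar>ln (f x)\<bar> / \<tau> \<le> 1 / sqrt (1 - r\<^sup>2)" using m \<tau> t f by (simp add: L_map_eq \<tau>_def[symmetric])
      then have "\<bar>ln (f x)\<bar> \<le> R" using \<tau> r1 by (simp add: R_def field_simps)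
      then have "exp (- R) \<le> exp (ln (f x))" "exp (ln (f x)) \<le> exp R" by auto
      then show ?thesis using fx by simp
    qed
    then show ?thesis using x(1) by (simp add: K_def)
  qed
  have "continuous_on V (\<lambda>x. L2_set (ball_point t F x) F)"
    by (intro continuous_on_L2_set continuous_on_ball_point t finF F(2))
  then have "continuous_on K (\<lambda>x. L2_set (ball_point t F x) F)"
    by (rule continuous_on_subset) (auto simp: K_def)
  then have "closedin (top_of_set K) (K \<inter> (\<lambda>x. L2_set (ball_point t F x) F) -` {..r})"
    by (rule continuous_closedin_preimage) simp
  then have "compact (K \<inter> (\<lambda>x. L2_set (ball_point t F x) F) -` {..r})"
    using \<open>compact K\<close> closedin_compact by blast
  moreover have "K \<inter> (\<lambda>x. L2_set (ball_point t F x) F) -` {..r} = {x \<in> V. L2_set (ball_point t F x) F \<le> r}"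
    using sub by (auto simp: K_def)
  ultimately show ?thesis by simp
qed

lemma amoeba_closure_eq_Un:
  "amoeba_closure F t (E_map F ` V) = ball_point t F ` V \<union> boundary F (E_map F ` V)"
  by (simp add: amoeba_closure_def amoeba_def image_image L_map_def)

text \<open>A limit point inside the open ball is attained, by properness.\<close>

lemma amoeba_closure_eq_closure_of:
  assumes t: "0 < t" "t < 1" and F: "finite_proper V F" "F \<subseteq> cont_sa_funs V"
  shows "amoeba_closure F t (E_map F ` V) = Rspace F closure_of (ball_point t F ` V)"
proof -
  have finF: "finite F" using F(1) by (simp add: finite_proper_def)
  have "ball_point t F ` V \<subseteq> Rspace F closure_of (ball_point t F ` V)"
    by (rule closure_of_subset) (auto simp: ball_map_def)
  moreover have "z \<in> ball_point t F ` V"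
    if z: "z \<in> Rspace F closure_of (ball_point t F ` V)" "L2_set z F \<noteq> 1" for z
  proof -
    have zF: "z \<in> F \<rightarrow>\<^sub>E UNIV" using z closure_of_subset_topspace[of "Rspace F"] by fastforce
    obtain s where s: "\<And>k::nat. s k \<in> ball_point t F ` V" "\<And>f. f \<in> F \<Longrightarrow> (\<lambda>k. s k f) \<longlonglongrightarrow> z f"
      using closure_of_Rspace_sequence[OF finF z(1)] by metis
    obtain v where v: "\<And>k. v k \<in> V" "\<And>k. s k = ball_point t F (v k)" using s(1) unfolding image_iff by metis
    have nlim: "(\<lambda>k. L2_set (s k) F) \<longlonglongrightarrow> L2_set z F" by (rule tendsto_L2_set[OF s(2)])
    have "L2_set z F \<le> 1"
      by (rule LIMSEQ_le_const2[OF nlim]) (auto simp: v(2) intro: less_imp_le[OF L2_set_ball_map_less_1])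
    then have z1: "L2_set z F < 1" using z(2) by simp
    then obtain r where r: "L2_set z F < r" "r < 1" using dense by blast
    define K where "K = {x \<in> V. L2_set (ball_point t F x) F \<le> r}"
    have "compact K" unfolding K_def by (rule compact_ball_point_sublevel[OF t F r(2)])
    have "\<forall>\<^sub>F k in sequentially. L2_set (s k) F < r" using order_tendstoD(2)[OF nlim r(1)] .
    then obtain N where N: "\<And>k. N \<le> k \<Longrightarrow> L2_set (s k) F < r" unfolding eventually_sequentially by blast
    have "v (k + N) \<in> K" for k using N[of "k + N"] v by (simp add: K_def less_imp_le)
    then obtain x \<phi> where x: "x \<in> K" "strict_mono (\<phi> :: nat \<Rightarrow> nat)" "((\<lambda>k. v (k + N)) \<circ> \<phi>) \<longlonglongrightarrow> x"
      using compact_imp_seq_compact[OF \<open>compact K\<close>] unfolding seq_compact_def by metis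
    have "ball_point t F x f = z f" if f: "f \<in> F" for f
    proof (rule LIMSEQ_unique)
      have cont: "continuous_on V (\<lambda>x. ball_point t F x f)" by (rule continuous_on_ball_point[OF t f finF F(2)])
      have xV: "x \<in> V" using x(1) by (simp add: K_def)
      show "(\<lambda>k. ball_point t F (v (\<phi> k + N)) f) \<longlonglongrightarrow> ball_point t F x f"
        by (rule continuous_on_tendsto_compose[OF cont _ xV]) (use x(3) v in \<open>auto simp: o_def\<close>)
      have "(\<lambda>k. s (k + N) f) \<longlonglongrightarrow> z f" by (rule LIMSEQ_ignore_initial_segment[OF s(2)[OF f]])
      from LIMSEQ_subseq_LIMSEQ[OF this x(2)]
      show "(\<lambda>k. ball_point t F (v (\<phi> k + N)) f) \<longlonglongrightarrow> z f" by (simp add: o_def v(2))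
    qed
    then have "ball_point t F x = z" using zF ball_point_in_PiE by (intro PiE_ext[of _ F "\<lambda>_. UNIV"])
    then show ?thesis using x(1) by (auto simp: K_def)
  qed
  ultimately show ?thesis unfolding amoeba_closure_eq_Un using boundary_iff[OF t finF] by blast
qed

lemma compactin_amoeba_closure:
  assumes t: "0 < t" "t < 1" and F: "finite_proper V F" "F \<subseteq> cont_sa_funs V"
  shows "compactin (Rspace F) (amoeba_closure F t (E_map F ` V))"
proof (rule closed_compactin)
  have finF: "finite F" using F(1) by (simp add: finite_proper_def)
  show "compactin (Rspace F) (PiE F (\<lambda>_. {-1..1}))" by (simp add: compactin_PiE)
  show "closedin (Rspace F) (amoeba_closure F t (E_map F ` V))"
    unfolding amoeba_closure_eq_closure_of[OF assms] by simp
  have bound: "z \<in> PiE F (\<lambda>_. {-1..1})" if "z \<in> F \<rightarrow>\<^sub>E UNIV" "L2_set z F \<le> 1" for z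
  proof -
    have "\<bar>z f\<bar> \<le> 1" if f: "f \<in> F" for f
      using abs_le_L2_set[OF finF f, of z] \<open>L2_set z F \<le> 1\<close> by linarith
    then show ?thesis using \<open>z \<in> F \<rightarrow>\<^sub>E UNIV\<close> by (force simp: PiE_iff abs_le_iff)
  qed
  show "amoeba_closure F t (E_map F ` V) \<subseteq> PiE F (\<lambda>_. {-1..1})"
  proof
    fix z assume "z \<in> amoeba_closure F t (E_map F ` V)"
    then consider x where "z = ball_point t F x" | "z \<in> boundary F (E_map F ` V)"
      unfolding amoeba_closure_eq_Un by blast
    then show "z \<in> PiE F (\<lambda>_. {-1..1})"
    proof cases
      case 1
      then show ?thesis
        using bound[OF ball_point_in_PiE less_imp_le[OF L2_set_ball_map_less_1]] by simp
    next
      case 2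
      then show ?thesis using bound boundary_sphere[OF finF 2] by simp
    qed
  qed
qed

section \<open>The closure of V over the inverse limit\<close>

lemma finite_proper_superset:
  fixes V :: "(real^'n) set"
  assumes F: "finite_proper V F" and sub: "F \<subseteq> F'" and fin: "finite F'" and sa: "F' \<subseteq> cont_sa_funs V"
  shows "finite_proper V F'"
  unfolding finite_proper_def
proof (intro conjI fin)
  let ?X = "\<lambda>F. product_topology (\<lambda>_. top_of_set {0 :: real<..}) F"
  show "proper_map (top_of_set V) (?X F') (E_map F')"
  proof (rule proper_map_from_composition_right[where g = "\<lambda>w. restrict w F"])
    show "Hausdorff_space (?X F')"
      by (simp add: Hausdorff_space_product_topology Hausdorff_space_subtopology)
    have "(\<lambda>w. restrict w F) \<circ> E_map F' = E_map F" using sub by (auto simp: E_map_def fun_eq_iff)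
    then show "proper_map (top_of_set V) (?X F) ((\<lambda>w. restrict w F) \<circ> E_map F')"
      using F by (simp add: finite_proper_def)
    show "continuous_map (top_of_set V) (?X F') (E_map F')"
      unfolding continuous_map_componentwise
    proof (intro conjI ballI)
      fix f assume "f \<in> F'"
      then have "continuous_on V f" "\<forall>x\<in>V. 0 < f x" "f \<in> F'" using sa by (auto simp: cont_sa_funs_def PiE_iff)
      then show "continuous_map (top_of_set V) (top_of_set {0<..}) (\<lambda>x. E_map F' x f)"
        by (auto simp: E_map_def continuous_map_in_subtopology)
    qed (auto simp: E_map_def)
    show "continuous_map (?X F') (?X F) (\<lambda>w. restrict w F)"
      unfolding continuous_map_componentwise
      using sub by (auto intro: continuous_map_product_projection)
  qed
qed

text \<open>This keeps the projection from shrinking directions at infinity to zero. It is where the functions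
  being semi-algebraic enters the topological argument.\<close>

lemma norm_comparison:
  fixes V :: "(real^'n) set"
  assumes t: "0 < t" "t < 1" and F: "finite_proper V F" "F \<subseteq> cont_sa_funs V"
    and F': "finite F'" "F' \<subseteq> cont_sa_funs V"
  shows "\<exists>C>0. \<forall>x\<in>V. 1 + (L2_set (L_map t F' x) F')\<^sup>2 \<le> C * (1 + (L2_set (L_map t F x) F)\<^sup>2)"
proof -
  have finF: "finite F" using F(1) by (simp add: finite_proper_def)
  define \<tau> where "\<tau> = ln (1 / t)"
  have \<tau>: "0 < \<tau>" using t by (simp add: \<tau>_def)
  have "\<forall>g\<in>F'. \<exists>C>0. \<forall>x\<in>V. \<bar>ln (g x)\<bar> \<le> C * (1 + (\<Sum>f\<in>F. \<bar>ln (f x)\<bar>))"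
    using ln_growth_comparison[OF F(2,1)] F'(2) by blast
  from bchoice[OF this] obtain c where c: "\<forall>g\<in>F'. 0 < c g \<and>
    (\<forall>x\<in>V. \<bar>ln (g x)\<bar> \<le> c g * (1 + (\<Sum>f\<in>F. \<bar>ln (f x)\<bar>)))" ..
  define d where "d = (\<lambda>g. c g * (1 + real (card F) * \<tau>) / \<tau>)"
  have bound: "(L_map t F' x g)\<^sup>2 \<le> 2 * (d g)\<^sup>2 * (1 + (L2_set (L_map t F x) F)\<^sup>2)"
    if x: "x \<in> V" and g: "g \<in> F'" for x g
  proof -
    define n where "n = L2_set (L_map t F x) F"
    have n: "0 \<le> n" by (simp add: n_def)
    have "\<bar>ln (f x)\<bar> \<le> \<tau> * n" if f: "f \<in> F" for f
    proof -
      have "\<bar>ln (f x) / \<tau>\<bar> \<le> n"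
        using abs_le_L2_set[OF finF f, of "L_map t F x"] t f by (simp add: L_map_eq \<tau>_def n_def)
      then show ?thesis using \<tau> by (simp add: field_simps)
    qed
    then have "(\<Sum>f\<in>F. \<bar>ln (f x)\<bar>) \<le> real (card F) * (\<tau> * n)" by (intro sum_bounded_above)
    moreover have "0 \<le> real (card F) * \<tau>" using \<tau> by simp
    moreover have "(1 + real (card F) * \<tau>) * (1 + n) = 1 + n + real (card F) * \<tau> + real (card F) * (\<tau> * n)"
      by (simp add: algebra_simps)
    ultimately have "1 + (\<Sum>f\<in>F. \<bar>ln (f x)\<bar>) \<le> (1 + real (card F) * \<tau>) * (1 + n)"
      using n by linarith
    then have "c g * (1 + (\<Sum>f\<in>F. \<bar>ln (f x)\<bar>)) \<le> c g * ((1 + real (card F) * \<tau>) * (1 + n))"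
      using c g by (intro mult_left_mono) auto
    then have "\<bar>ln (g x)\<bar> \<le> c g * ((1 + real (card F) * \<tau>) * (1 + n))"
      using bspec[OF conjunct2[OF bspec[OF c g]] x] by linarith
    then have "\<bar>ln (g x)\<bar> / \<tau> \<le> d g * (1 + n)" using \<tau> by (simp add: d_def field_simps)
    then have "\<bar>L_map t F' x g\<bar> \<le> d g * (1 + n)" using t g \<tau> by (simp add: L_map_eq \<tau>_def[symmetric])
    then have "\<bar>L_map t F' x g\<bar>\<^sup>2 \<le> (d g * (1 + n))\<^sup>2" by (intro power_mono) auto
    then have "(L_map t F' x g)\<^sup>2 \<le> (d g)\<^sup>2 * (1 + n)\<^sup>2" by (simp add: power_mult_distrib)
    also have "\<dots> \<le> (d g)\<^sup>2 * (2 * (1 + n\<^sup>2))"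
    proof (rule mult_left_mono)
      have "0 \<le> (1 - n)\<^sup>2" by simp
      then show "(1 + n)\<^sup>2 \<le> 2 * (1 + n\<^sup>2)" by (simp add: power2_eq_square algebra_simps)
    qed simp
    finally show ?thesis by (simp only: n_def mult_ac)
  qed
  define C where "C = 1 + (\<Sum>g\<in>F'. 2 * (d g)\<^sup>2)"
  have C: "0 < C" by (simp add: C_def add_pos_nonneg sum_nonneg)
  have "1 + (L2_set (L_map t F' x) F')\<^sup>2 \<le> C * (1 + (L2_set (L_map t F x) F)\<^sup>2)" if x: "x \<in> V" for x
  proof -
    let ?m = "1 + (L2_set (L_map t F x) F)\<^sup>2"
    have "(L2_set (L_map t F' x) F')\<^sup>2 = (\<Sum>g\<in>F'. (L_map t F' x g)\<^sup>2)"
      by (simp add: L2_set_def sum_nonneg)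
    also have "\<dots> \<le> (\<Sum>g\<in>F'. 2 * (d g)\<^sup>2 * ?m)" by (intro sum_mono bound x)
    also have "\<dots> = (\<Sum>g\<in>F'. 2 * (d g)\<^sup>2) * ?m" by (simp only: sum_distrib_right)
    finally show ?thesis
      unfolding C_def distrib_right[of 1] mult_1 using zero_le_power2[of "L2_set (L_map t F x) F"] by linarith
  qed
  then show ?thesis using C by blast
qed

lemma bond_ball_point:
  assumes "F \<subseteq> F'"
  shows "bond F' F (ball_point t F' x) = ball_point t F x"
proof -
  have "L_map t F' x \<in> F' \<rightarrow>\<^sub>E UNIV" by (simp add: L_map_def Log_map_def)
  then have "inv_into (F' \<rightarrow>\<^sub>E UNIV) (ball_map F') (ball_point t F' x) = L_map t F' x"
    by (intro inv_into_f_f inj_on_ball_map)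
  moreover have "restrict (L_map t F' x) F = L_map t F x"
    using assms by (auto simp: L_map_def Log_map_def E_map_def fun_eq_iff)
  moreover have "L2_set (ball_point t F' x) F' \<noteq> 1"
    using L2_set_ball_map_less_1[of F' "L_map t F' x"] by simp
  ultimately show ?thesis by (simp add: bond_def)
qed

text \<open>The coordinate projection, applied to points of the ball instead of points of \<open>\<real>\<^sup>F\<^sup>'\<close>, is off by
  the scalar \<open>c\<close> only. This is the form in which the bonding maps pass to limits.\<close>

lemma ball_point_projection:
  fixes x :: 'a and t :: real and F F' :: "('a \<Rightarrow> real) set"
  assumes "F \<subseteq> F'"
  defines "c \<equiv> sqrt (1 + (L2_set (L_map t F x) F)\<^sup>2) / sqrt (1 + (L2_set (L_map t F' x) F')\<^sup>2)"
  shows "f \<in> F \<Longrightarrow> ball_point t F' x f = ball_point t F x f * c"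
    and "L2_set (ball_point t F' x) F = L2_set (ball_point t F x) F * c"
proof -
  have pos: "0 < sqrt (1 + y\<^sup>2)" for y :: real by (simp add: add_pos_nonneg)
  have eq: "ball_point t F' x f = ball_point t F x f * c" if "f \<in> F" for f
    using that assms(1) pos[of "L2_set (L_map t F x) F"]
    by (auto simp: ball_map_def c_def L_map_def Log_map_def E_map_def subset_iff)
  then show "f \<in> F \<Longrightarrow> ball_point t F' x f = ball_point t F x f * c" .
  have "0 \<le> c" by (simp add: c_def)
  have "L2_set (ball_point t F' x) F = L2_set (\<lambda>f. ball_point t F x f * c) F"
    by (intro L2_set_cong) (auto simp: eq)
  also have "\<dots> = L2_set (ball_point t F x) F * c" by (rule L2_set_scaled[OF \<open>0 \<le> c\<close>])
  finally show "L2_set (ball_point t F' x) F = L2_set (ball_point t F x) F * c" .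
qed

lemma bond_on_sphere:
  assumes "L2_set z F' = 1" "L2_set w F = 1" "w \<in> F \<rightarrow>\<^sub>E UNIV" "0 < L2_set z F"
    and "\<And>f. f \<in> F \<Longrightarrow> L2_set w F * z f = L2_set z F * w f"
  shows "bond F' F z = w"
proof (rule PiE_ext)
  fix f assume f: "f \<in> F"
  have "z f = L2_set z F * w f" using assms(2) assms(5)[OF f] by simp
  then show "bond F' F z f = w f" using assms(1,4) f by (simp add: bond_def direction_def)
next
  show "bond F' F z \<in> F \<rightarrow>\<^sub>E UNIV" using assms(1) by (simp add: bond_def direction_def)
qed (fact assms(3))

locale proper_family_setup =
  fixes V :: "(real^'n) set" and G :: "(real^'n \<Rightarrow> real) set" and t :: real
  assumes t: "0 < t" "t < 1" and G: "G \<subseteq> cont_sa_funs V" and proper: "proper_family V G"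
begin

abbreviation "\<P> \<equiv> proper_subfamilies V G"

lemma proper_subfamilyD: "F \<in> \<P> \<Longrightarrow> finite_proper V F" "F \<in> \<P> \<Longrightarrow> F \<subseteq> cont_sa_funs V" "F \<in> \<P> \<Longrightarrow> finite F"
  using G by (auto simp: proper_subfamilies_def finite_proper_def)

lemma Union_proper_subfamilies:
  assumes "finite \<Q>" "\<Q> \<subseteq> \<P>" "\<Q> \<noteq> {}"
  shows "\<Union>\<Q> \<in> \<P>"
proof -
  obtain F where F: "F \<in> \<Q>" using assms(3) by blast
  have "finite_proper V (\<Union>\<Q>)"
  proof (rule finite_proper_superset)
    show "finite_proper V F" "\<Union>\<Q> \<subseteq> cont_sa_funs V" "F \<subseteq> \<Union>\<Q>" using F proper_subfamilyD(1,2) assms(2) by blast+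
    show "finite (\<Union>\<Q>)" using proper_subfamilyD(3) assms by blast
  qed
  then show ?thesis using assms(2) by (auto simp: proper_subfamilies_def)
qed

lemma proper_subfamilies_nonempty: "\<P> \<noteq> {}"
  using proper by (auto simp: proper_family_def proper_subfamilies_def)

definition amoeba_cl where "amoeba_cl F = amoeba_closure F t (E_map F ` V)"

text \<open>The compact space in which closures are taken. The bonding maps are left out: they are not
  continuous where the projection vanishes, and the closure of the image of \<open>V\<close> is shown to avoid
  such points.\<close>

definition ambient where
  "ambient = prod_topology (Alexandroff_compactification (top_of_set V))
     (product_topology (\<lambda>F. subtopology (Rspace F) (amoeba_cl F)) \<P>)"

lemma amoeba_cl_eq: "F \<in> \<P> \<Longrightarrow> amoeba_cl F = ball_point t F ` V \<union> boundary F (E_map F ` V)"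
  by (simp add: amoeba_cl_def amoeba_closure_eq_Un)

lemma amoeba_cl_subset_PiE: "F \<in> \<P> \<Longrightarrow> amoeba_cl F \<subseteq> F \<rightarrow>\<^sub>E UNIV"
  using compactin_subset_topspace[OF compactin_amoeba_closure[OF t proper_subfamilyD(1,2)]] by (simp add: amoeba_cl_def)

lemma amoeba_cl_topspace: "F \<in> \<P> \<Longrightarrow> topspace (subtopology (Rspace F) (amoeba_cl F)) = amoeba_cl F"
  using compactin_subset_topspace[OF compactin_amoeba_closure[OF t proper_subfamilyD(1,2)]]
  by (auto simp: amoeba_cl_def)

lemma topspace_ambient: "topspace ambient = insert None (Some ` V) \<times> PiE \<P> amoeba_cl"
  by (simp add: ambient_def amoeba_cl_topspace cong: PiE_cong del: topspace_subtopology)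

lemma compact_space_ambient: "compact_space ambient"
  using compactin_amoeba_closure[OF t proper_subfamilyD(1,2)]
  by (auto simp: ambient_def compact_space_prod_topology compact_space_product_topology amoeba_cl_def
      compact_space_subtopology)

lemma continuous_fst: "continuous_map ambient (Alexandroff_compactification (top_of_set V)) fst"
  unfolding ambient_def by (rule continuous_map_fst)

lemma continuous_component:
  "F \<in> \<P> \<Longrightarrow> continuous_map ambient (subtopology (Rspace F) (amoeba_cl F)) (\<lambda>p. snd p F)"
  unfolding ambient_def
  by (rule continuous_map_compose[OF continuous_map_snd continuous_map_product_projection, unfolded o_def])

lemma continuous_coordinate:
  assumes "F \<in> \<P>" "f \<in> F"
  shows "continuous_map ambient euclideanreal (\<lambda>p. snd p F f)"
proof -
  have "continuous_map ambient (Rspace F) (\<lambda>p. snd p F)"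
    using continuous_component[OF assms(1)] by (simp add: continuous_map_in_subtopology)
  from continuous_map_compose[OF this continuous_map_product_projection[OF assms(2)]]
  show ?thesis by (simp add: o_def)
qed

lemma continuous_iota: "continuous_map (top_of_set V) ambient (iota t V G)"
proof -
  have "continuous_map (top_of_set V) (product_topology (\<lambda>F. subtopology (Rspace F) (amoeba_cl F)) \<P>) (L_lim t V G)"
    unfolding continuous_map_componentwise
  proof (intro conjI ballI)
    fix F assume F: "F \<in> \<P>"
    have "continuous_map (top_of_set V) (Rspace F) (ball_point t F)"
      unfolding continuous_map_componentwise
      using continuous_on_ball_point[OF t _ proper_subfamilyD(3,2)[OF F]] by (auto simp: ball_map_def)
    then show "continuous_map (top_of_set V) (subtopology (Rspace F) (amoeba_cl F)) (\<lambda>x. L_lim t V G x F)"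
      using F by (auto simp: L_lim_def continuous_map_in_subtopology amoeba_cl_eq)
  qed (auto simp: L_lim_def)
  then show ?thesis
    unfolding ambient_def iota_def by (intro continuous_map_pairedI continuous_map_Some)
qed

definition closure_V where "closure_V = ambient closure_of (iota t V G ` V)"

lemma closedin_closure_V: "closedin ambient closure_V"
  by (simp add: closure_V_def)

lemma closure_V_subset: "closure_V \<subseteq> topspace ambient"
  by (simp add: closure_V_def closure_of_subset_topspace)

lemma iota_in_closure_V: "x \<in> V \<Longrightarrow> iota t V G x \<in> closure_V"
proof -
  have "iota t V G ` V \<subseteq> topspace ambient" using continuous_map_image_subset_topspace[OF continuous_iota] by simp
  then show "x \<in> V \<Longrightarrow> iota t V G x \<in> closure_V" unfolding closure_V_def using closure_of_subset by blast
qed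

lemma open_meets_V:
  assumes "p \<in> closure_V" "openin ambient U" "p \<in> U"
  obtains x where "x \<in> V" "iota t V G x \<in> U"
  using assms unfolding closure_V_def in_closure_of by blast

lemma L_lim_app: "F \<in> \<P> \<Longrightarrow> L_lim t V G x F = ball_point t F x"
  by (simp add: L_lim_def)

text \<open>Over \<open>V\<close> the closure is the graph of a continuous map into a Hausdorff space.\<close>

lemma closure_V_over_V:
  assumes "(Some x, z) \<in> closure_V"
  shows "x \<in> V" "z = L_lim t V G x"
proof -
  show xV: "x \<in> V" using assms closure_V_subset by (auto simp: topspace_ambient)
  have z: "z \<in> PiE \<P> amoeba_cl" using assms closure_V_subset by (auto simp: topspace_ambient)
  have "z F f = ball_point t F x f" if F: "F \<in> \<P>" and f: "f \<in> F" for F f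
  proof (rule ccontr)
    assume "z F f \<noteq> ball_point t F x f"
    then obtain A B where AB: "open A" "open B" "z F f \<in> A" "ball_point t F x f \<in> B" "A \<inter> B = {}"
      using hausdorff by metis
    define W where "W = {y \<in> V. ball_point t F y f \<in> B}"
    have "continuous_on V (\<lambda>y. ball_point t F y f)" by (rule continuous_on_ball_point[OF t f proper_subfamilyD(3,2)[OF F]])
    then have "openin (top_of_set V) (V \<inter> (\<lambda>y. ball_point t F y f) -` B)"
      using AB(2) by (rule continuous_openin_preimage_gen)
    moreover have "V \<inter> (\<lambda>y. ball_point t F y f) -` B = W" by (auto simp: W_def)
    ultimately have "openin (Alexandroff_compactification (top_of_set V)) (Some ` W)" by simp
    then have "openin ambient {p \<in> topspace ambient. fst p \<in> Some ` W}"
      by (intro openin_continuous_map_preimage[OF continuous_fst])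
    moreover have "openin ambient {p \<in> topspace ambient. snd p F f \<in> A}"
      using openin_continuous_map_preimage[OF continuous_coordinate[OF F f]] AB(1) by simp
    ultimately have "openin ambient ({p \<in> topspace ambient. fst p \<in> Some ` W} \<inter> {p \<in> topspace ambient. snd p F f \<in> A})"
      by (rule openin_Int)
    moreover have "(Some x, z) \<in> {p \<in> topspace ambient. fst p \<in> Some ` W} \<inter> {p \<in> topspace ambient. snd p F f \<in> A}"
      using assms closure_V_subset AB xV by (auto simp: W_def)
    ultimately obtain y where "y \<in> V"
      "iota t V G y \<in> {p \<in> topspace ambient. fst p \<in> Some ` W} \<inter> {p \<in> topspace ambient. snd p F f \<in> A}"
      by (rule open_meets_V[OF assms])
    then have "ball_point t F y f \<in> A \<inter> B" using F by (auto simp: iota_def L_lim_app W_def)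
    then show False using AB(5) by blast
  qed
  moreover have "z F \<in> F \<rightarrow>\<^sub>E UNIV" if "F \<in> \<P>" for F
    using subsetD[OF amoeba_cl_subset_PiE PiE_mem[OF z]] that by blast
  ultimately have eq: "z F = ball_point t F x" if "F \<in> \<P>" for F
    using that by (intro PiE_ext[OF _ ball_point_in_PiE]) blast+
  have "z F = L_lim t V G x F" for F
    using eq[of F] PiE_arb[OF z, of F] by (cases "F \<in> \<P>") (auto simp: L_lim_def)
  then show "z = L_lim t V G x" by blast
qed

text \<open>A point inside the open ball has a neighbourhood whose preimage in \<open>V\<close> lies in a compact set, and the
  complement of that set is a neighbourhood of \<open>\<infinity>\<close>.\<close>

lemma closure_V_at_infinity_sphere:
  assumes "(None, z) \<in> closure_V" and F: "F \<in> \<P>"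
  shows "z F \<in> boundary F (E_map F ` V)"
proof (rule ccontr)
  assume not: "z F \<notin> boundary F (E_map F ` V)"
  have "z \<in> PiE \<P> amoeba_cl" using assms closure_V_subset by (auto simp: topspace_ambient)
  then have "z F \<in> amoeba_cl F" using F by blast
  then obtain x where "z F = ball_point t F x" using not amoeba_cl_eq[OF F] by blast
  then have "L2_set (z F) F < 1" using L2_set_ball_map_less_1 by simp
  then obtain r where r: "L2_set (z F) F < r" "r < 1" using dense by blast
  define K where "K = {x \<in> V. L2_set (ball_point t F x) F \<le> r}"
  have "compact K" unfolding K_def by (rule compact_ball_point_sublevel[OF t proper_subfamilyD(1,2)[OF F] r(2)])
  then have "closedin (Alexandroff_compactification (top_of_set V)) (Some ` K)"
    by (auto simp: compactin_subtopology K_def closed_subset compact_imp_closed)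
  then have "openin (Alexandroff_compactification (top_of_set V))
      (topspace (Alexandroff_compactification (top_of_set V)) - Some ` K)" by blast
  then have "openin ambient {p \<in> topspace ambient. fst p \<in> topspace (Alexandroff_compactification (top_of_set V)) - Some ` K}"
    by (intro openin_continuous_map_preimage[OF continuous_fst])
  moreover have "continuous_map ambient euclideanreal (\<lambda>p. L2_set (snd p F) F)"
    by (intro continuous_map_L2_set proper_subfamilyD(3)[OF F] continuous_coordinate[OF F])
  then have "openin ambient {p \<in> topspace ambient. L2_set (snd p F) F \<in> {..<r}}"
    by (rule openin_continuous_map_preimage) simp
  ultimately have "openin ambient ({p \<in> topspace ambient. fst p \<in> topspace (Alexandroff_compactification (top_of_set V)) - Some ` K}
      \<inter> {p \<in> topspace ambient. L2_set (snd p F) F \<in> {..<r}})" by (rule openin_Int)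
  moreover have "(None, z) \<in> {p \<in> topspace ambient. fst p \<in> topspace (Alexandroff_compactification (top_of_set V)) - Some ` K}
      \<inter> {p \<in> topspace ambient. L2_set (snd p F) F \<in> {..<r}}"
    using assms(1) closure_V_subset r(1) by auto
  ultimately obtain y where "y \<in> V"
    "iota t V G y \<in> {p \<in> topspace ambient. fst p \<in> topspace (Alexandroff_compactification (top_of_set V)) - Some ` K}
      \<inter> {p \<in> topspace ambient. L2_set (snd p F) F \<in> {..<r}}"
    by (rule open_meets_V[OF assms(1)])
  then show False using F by (auto simp: iota_def L_lim_app K_def)
qed

text \<open>Two closed conditions hold on the image of \<open>V\<close>: the projection of the component at \<open>F'\<close> is
  proportional to the component at \<open>F\<close>, and its norm is at least a constant multiple of the norm
  of the latter. The constant comes from the comparison of norms. On the sphere the two conditions give the bonding map.\<close>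

lemma closure_V_at_infinity_bond:
  assumes z: "(None, z) \<in> closure_V" and F: "F \<in> \<P>" and F': "F' \<in> \<P>" and sub: "F \<subseteq> F'"
  shows "bond F' F (z F') = z F"
proof -
  obtain c where c: "0 < c" "\<And>x. x \<in> V \<Longrightarrow>
      1 + (L2_set (L_map t F' x) F')\<^sup>2 \<le> c * (1 + (L2_set (L_map t F x) F)\<^sup>2)"
    using norm_comparison[OF t proper_subfamilyD(1,2)[OF F] proper_subfamilyD(3,2)[OF F']] by blast
  have cont: "continuous_map ambient euclideanreal (\<lambda>p. L2_set (snd p F) F)"
    "continuous_map ambient euclideanreal (\<lambda>p. L2_set (snd p F') F)"
    using sub by (intro continuous_map_L2_set proper_subfamilyD(3)[OF F] continuous_coordinate F F'; blast)+
  have proportional: "L2_set (snd p F) F * snd p F' f = L2_set (snd p F') F * snd p F f"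
    if "p \<in> closure_V" and f: "f \<in> F" for p f
  proof (rule forall_in_closure_of_eq[OF \<open>p \<in> closure_V\<close>[unfolded closure_V_def], where Y = euclideanreal])
    show "continuous_map ambient euclideanreal (\<lambda>p. L2_set (snd p F) F * snd p F' f)"
      "continuous_map ambient euclideanreal (\<lambda>p. L2_set (snd p F') F * snd p F f)"
      using f sub by (intro continuous_map_real_mult cont continuous_coordinate F F'; blast)+
    fix p assume "p \<in> iota t V G ` V"
    then obtain x where "p = iota t V G x" by blast
    then show "L2_set (snd p F) F * snd p F' f = L2_set (snd p F') F * snd p F f"
      using F F' ball_point_projection(1)[OF sub f, of t x] ball_point_projection(2)[OF sub, of t x] by (simp add: iota_def L_lim_app)
  qed simp
  have lower: "L2_set (snd p F) F / sqrt c \<le> L2_set (snd p F') F" if "p \<in> closure_V" for p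
  proof (rule forall_in_closure_of[OF \<open>p \<in> closure_V\<close>[unfolded closure_V_def]])
    have "continuous_map ambient euclideanreal (\<lambda>p. L2_set (snd p F') F - L2_set (snd p F) F / sqrt c)"
      using c(1) by (intro continuous_map_diff continuous_map_real_divide cont) auto
    from closedin_continuous_map_preimage[OF this, of "{0..}"]
    show "closedin ambient {p \<in> topspace ambient. L2_set (snd p F) F / sqrt c \<le> L2_set (snd p F') F}"
      by simp
    fix p assume "p \<in> iota t V G ` V"
    then obtain x where x: "x \<in> V" "p = iota t V G x" by blast
    define m m' where "m = 1 + (L2_set (L_map t F x) F)\<^sup>2" and "m' = 1 + (L2_set (L_map t F' x) F')\<^sup>2"
    have m: "0 < m" "0 < m'" by (simp_all add: m_def m'_def add_pos_nonneg)
    have "m' \<le> c * m" using c(2)[OF x(1)] by (simp add: m_def m'_def)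
    then have "sqrt m' \<le> sqrt c * sqrt m" by (metis real_sqrt_le_mono real_sqrt_mult)
    then have "1 / sqrt c \<le> sqrt m / sqrt m'" using m c(1) by (simp add: field_simps)
    then have "L2_set (ball_point t F x) F * (1 / sqrt c) \<le> L2_set (ball_point t F x) F * (sqrt m / sqrt m')"
      by (rule mult_left_mono) simp
    then show "L2_set (snd p F) F / sqrt c \<le> L2_set (snd p F') F"
      using F F' ball_point_projection(2)[OF sub, of t x] x(2) by (simp add: iota_def L_lim_app m_def m'_def)
  qed
  have bd: "z F \<in> F \<rightarrow>\<^sub>E UNIV" "L2_set (z F) F = 1" "L2_set (z F') F' = 1"
    using boundary_sphere[OF proper_subfamilyD(3)[OF F] closure_V_at_infinity_sphere[OF z F]]
      boundary_sphere[OF proper_subfamilyD(3)[OF F'] closure_V_at_infinity_sphere[OF z F']] by blast+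
  show ?thesis
  proof (rule bond_on_sphere[OF bd(3,2,1)])
    have "0 < 1 / sqrt c" using c(1) by simp
    also have "\<dots> \<le> L2_set (z F') F" using lower[OF z] bd(2) by simp
    finally show "0 < L2_set (z F') F" .
    show "L2_set (z F) F * z F' f = L2_set (z F') F * z F f" if "f \<in> F" for f
      using proportional[OF z that] by simp
  qed
qed

lemma closure_V_at_infinity_boundary_lim:
  assumes "(None, z) \<in> closure_V"
  shows "z \<in> boundary_lim V G"
proof -
  have "z \<in> PiE \<P> amoeba_cl" using assms closure_V_subset by (auto simp: topspace_ambient)
  then show ?thesis
    using closure_V_at_infinity_sphere[OF assms] closure_V_at_infinity_bond[OF assms]
    by (auto simp: boundary_lim_def inverse_limit_set_def PiE_iff)
qed

lemma boundary_limD: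
  assumes "z \<in> boundary_lim V G"
  shows "z \<in> extensional \<P>" "\<And>F. F \<in> \<P> \<Longrightarrow> z F \<in> boundary F (E_map F ` V)"
    "\<And>F F'. F \<in> \<P> \<Longrightarrow> F' \<in> \<P> \<Longrightarrow> F \<subseteq> F' \<Longrightarrow> bond F' F (z F') = z F"
  using assms by (auto simp: boundary_lim_def inverse_limit_set_def PiE_iff)

text \<open>The projection of the closure to the factor at \<open>F\<close> is compact and contains the image of \<open>V\<close>, hence
  also every limit point of it. Over \<open>V\<close> the projection stays inside the open ball.\<close>

lemma boundary_lift:
  assumes F: "F \<in> \<P>" and u: "u \<in> boundary F (E_map F ` V)"
  shows "\<exists>w. (None, w) \<in> closure_V \<and> w F = u"
proof -
  let ?X = "subtopology (Rspace F) (amoeba_cl F)"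
  have "continuous_map ambient ?X (\<lambda>p. snd p F)" by (rule continuous_component[OF F])
  moreover have "compactin ambient closure_V" by (rule closedin_compact_space[OF compact_space_ambient closedin_closure_V])
  ultimately have "compactin ?X ((\<lambda>p. snd p F) ` closure_V)" by (rule image_compactin[rotated])
  moreover have "Hausdorff_space ?X"
    by (intro Hausdorff_space_subtopology) (simp add: Hausdorff_space_product_topology)
  ultimately have "closedin ?X ((\<lambda>p. snd p F) ` closure_V)" by (intro compactin_imp_closedin)
  moreover have "ball_point t F ` V \<subseteq> (\<lambda>p. snd p F) ` closure_V"
  proof
    fix y assume "y \<in> ball_point t F ` V"
    then obtain x where x: "x \<in> V" "y = ball_point t F x" by blast
    then have "y = snd (iota t V G x) F" using F by (simp add: iota_def L_lim_app)
    then show "y \<in> (\<lambda>p. snd p F) ` closure_V" using iota_in_closure_V[OF x(1)] by blast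
  qed
  ultimately have "?X closure_of (ball_point t F ` V) \<subseteq> (\<lambda>p. snd p F) ` closure_V" by (rule closure_of_minimal[rotated])
  moreover have "u \<in> ?X closure_of (ball_point t F ` V)"
  proof -
    have "u \<in> Rspace F closure_of (ball_point t F ` V)" using u boundary_iff[OF t proper_subfamilyD(3)[OF F]] by blast
    moreover have "u \<in> amoeba_cl F" "amoeba_cl F \<inter> ball_point t F ` V = ball_point t F ` V"
      using u amoeba_cl_eq[OF F] by blast+
    ultimately show ?thesis by (simp add: closure_of_subtopology)
  qed
  ultimately obtain p where p: "p \<in> closure_V" "snd p F = u" by blast
  obtain v w where vw: "p = (v, w)" by (cases p)
  have "v = None"
  proof (cases v)
    case (Some x)
    then have "w = L_lim t V G x" using closure_V_over_V p vw by blast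
    then have "u = ball_point t F x" using F p vw by (simp add: L_lim_app)
    then show ?thesis
      using boundary_sphere(2)[OF proper_subfamilyD(3)[OF F] u] L2_set_ball_map_less_1[of F "L_map t F x"] by simp
  qed
  then show ?thesis using p vw by auto
qed

text \<open>For each \<open>F\<close> the points over \<open>\<infinity>\<close> in the closure with the prescribed coordinate at \<open>F\<close> form
  a closed set. These sets are nonempty and directed, since the coordinate at \<open>F\<close> determines
  those at all subfamilies, so by compactness they have a common point.\<close>

lemma boundary_lim_in_closure_V:
  assumes z: "z \<in> boundary_lim V G"
  shows "(None, z) \<in> closure_V"
proof -
  define S where "S F = {p \<in> closure_V. fst p = None \<and> snd p F = z F}" for F
  have closed: "closedin ambient (S F)" if F: "F \<in> \<P>" for F
  proof -
    let ?X = "subtopology (Rspace F) (amoeba_cl F)"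
    have "closedin (Alexandroff_compactification (top_of_set V)) {None}"
      by (auto simp: closedin_Alexandroff_compactification)
    then have "closedin ambient {p \<in> topspace ambient. fst p \<in> {None}}"
      by (intro closedin_continuous_map_preimage[OF continuous_fst])
    moreover have "closedin ?X {z F}"
    proof (rule closedin_Hausdorff_singleton)
      show "Hausdorff_space ?X"
        by (intro Hausdorff_space_subtopology) (simp add: Hausdorff_space_product_topology)
      show "z F \<in> topspace ?X" unfolding amoeba_cl_topspace[OF F] using boundary_limD(2)[OF z F] amoeba_cl_eq[OF F] by blast
    qed
    then have "closedin ambient {p \<in> topspace ambient. snd p F \<in> {z F}}"
      by (rule closedin_continuous_map_preimage[OF continuous_component[OF F]])
    ultimately have "closedin ambient (closure_V \<inter> ({p \<in> topspace ambient. fst p \<in> {None}} \<inter> {p \<in> topspace ambient. snd p F \<in> {z F}}))"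
      by (intro closedin_Int closedin_closure_V)
    moreover have "closure_V \<inter> ({p \<in> topspace ambient. fst p \<in> {None}} \<inter> {p \<in> topspace ambient. snd p F \<in> {z F}}) = S F"
      using closure_V_subset by (auto simp: S_def)
    ultimately show ?thesis by simp
  qed
  have mono: "S F' \<subseteq> S F" if F: "F \<in> \<P>" "F' \<in> \<P>" "F \<subseteq> F'" for F F'
  proof
    fix p assume p: "p \<in> S F'"
    then obtain w where w: "p = (None, w)" "(None, w) \<in> closure_V" "w F' = z F'"
      by (cases p) (auto simp: S_def)
    have "w F = bond F' F (w F')"
      using boundary_limD(3)[OF closure_V_at_infinity_boundary_lim[OF w(2)] F] by simp
    also have "\<dots> = z F" using boundary_limD(3)[OF z F] w(3) by simp
    finally show "p \<in> S F" using w by (simp add: S_def)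
  qed
  have "\<Inter>(S ` \<P>) \<noteq> {}"
  proof -
    have "\<Inter>\<F> \<noteq> {}" if \<F>: "finite \<F>" "\<F> \<subseteq> S ` \<P>" for \<F>
    proof (cases "\<F> = {}")
      case False
      obtain \<Q> where \<Q>: "\<Q> \<subseteq> \<P>" "finite \<Q>" "\<F> = S ` \<Q>" using finite_subset_image[OF \<F>] by blast
      then have "\<Q> \<noteq> {}" using False by blast
      then have U: "\<Union>\<Q> \<in> \<P>" using Union_proper_subfamilies \<Q> by blast
      obtain w where "(None, w) \<in> closure_V" "w (\<Union>\<Q>) = z (\<Union>\<Q>)"
        using boundary_lift[OF U boundary_limD(2)[OF z U]] by blast
      then have "(None, w) \<in> S (\<Union>\<Q>)" by (simp add: S_def)
      moreover have "S (\<Union>\<Q>) \<subseteq> S F" if "F \<in> \<Q>" for F using mono[OF _ U] that \<Q>(1) by blast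
      ultimately show ?thesis using \<Q>(3) by blast
    qed simp
    moreover have "\<forall>K\<in>S ` \<P>. closedin ambient K" using closed by blast
    ultimately have "(\<forall>K\<in>S ` \<P>. closedin ambient K) \<and> (\<forall>\<F>. finite \<F> \<and> \<F> \<subseteq> S ` \<P> \<longrightarrow> \<Inter>\<F> \<noteq> {})"
      by blast
    then show ?thesis by (rule compact_space_fip[THEN iffD1, OF compact_space_ambient, THEN spec, THEN mp])
  qed
  then obtain p where p: "\<And>F. F \<in> \<P> \<Longrightarrow> p \<in> S F" by blast
  obtain F0 where "F0 \<in> \<P>" using proper_subfamilies_nonempty by blast
  then obtain w where w: "p = (None, w)" "(None, w) \<in> closure_V" using p by (cases p) (auto simp: S_def)
  have "w F = z F" if "F \<in> \<P>" for F using p[OF that] w by (simp add: S_def)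
  moreover have "w \<in> extensional \<P>" using boundary_limD(1)[OF closure_V_at_infinity_boundary_lim[OF w(2)]] .
  ultimately have "w = z" using boundary_limD(1)[OF z] by (metis extensionalityI)
  then show ?thesis using w by simp
qed

lemma closure_V_eq: "closure_V = iota t V G ` V \<union> {None} \<times> boundary_lim V G"
proof (intro set_eqI iffI)
  fix p assume p: "p \<in> closure_V"
  obtain v z where vz: "p = (v, z)" by (cases p)
  show "p \<in> iota t V G ` V \<union> {None} \<times> boundary_lim V G"
  proof (cases v)
    case None
    then show ?thesis using p vz closure_V_at_infinity_boundary_lim by blast
  next
    case (Some x)
    then have "x \<in> V" "p = iota t V G x" using p vz closure_V_over_V[of x z] by (auto simp: iota_def)
    then show ?thesis by blast
  qed
next
  fix p assume "p \<in> iota t V G ` V \<union> {None} \<times> boundary_lim V G"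
  then show "p \<in> closure_V" using iota_in_closure_V boundary_lim_in_closure_V by auto
qed

text \<open>The closure in the ambient space already lies over the inverse limit, so that it agrees with the
  closure taken there.\<close>

lemma V_bar_eq: "V_bar t V G = subtopology ambient closure_V"
proof -
  define M where "M = inverse_limit_set \<P> (\<subseteq>) amoeba_cl bond"
  have "inverse_limit_set \<P> (\<subseteq>) (\<lambda>F. topspace (subtopology (Rspace F) (amoeba_cl F))) bond = M"
    unfolding inverse_limit_set_def M_def by (simp only: amoeba_cl_topspace cong: PiE_cong)
  then have X: "prod_topology (Alexandroff_compactification (top_of_set V)) (M_space t V G) =
      subtopology ambient (topspace (Alexandroff_compactification (top_of_set V)) \<times> M)"
    by (simp only: M_space_def inverse_limit_def amoeba_cl_def[symmetric] prod_topology_subtopology(2) ambient_def)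
  have "L_lim t V G x \<in> M" if "x \<in> V" for x
    unfolding M_def inverse_limit_set_def
    using that by (auto simp: L_lim_def amoeba_cl_eq bond_ball_point)
  moreover have "boundary_lim V G \<subseteq> M"
    unfolding boundary_lim_def M_def inverse_limit_set_def by (auto simp: PiE_iff amoeba_cl_eq)
  ultimately have sub: "closure_V \<subseteq> topspace (Alexandroff_compactification (top_of_set V)) \<times> M"
    unfolding closure_V_eq by (auto simp: iota_def)
  moreover have "iota t V G ` V \<subseteq> closure_V" using iota_in_closure_V by blast
  ultimately have "subtopology ambient (topspace (Alexandroff_compactification (top_of_set V)) \<times> M) closure_of (iota t V G ` V) = closure_V"
    by (simp only: closure_of_subtopology closure_V_def[symmetric] Int_absorb1 subset_trans)
  then show ?thesis
    unfolding V_bar_def Let_def X subtopology_subtopology using sub by (simp add: Int_absorb1)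
qed

lemma topspace_V_bar: "topspace (V_bar t V G) = closure_V"
  unfolding V_bar_eq using closure_V_subset by (simp add: Int_absorb1)

lemma open_map_iota: "open_map (top_of_set V) (V_bar t V G) (iota t V G)"
  unfolding open_map_def
proof (intro allI impI)
  fix U assume U: "openin (top_of_set V) U"
  then have "U \<subseteq> V" using openin_subset by fastforce
  have "openin (Alexandroff_compactification (top_of_set V)) (Some ` U)" using U by simp
  then have "openin ambient {p \<in> topspace ambient. fst p \<in> Some ` U}"
    by (intro openin_continuous_map_preimage[OF continuous_fst])
  then have "openin (V_bar t V G) (closure_V \<inter> {p \<in> topspace ambient. fst p \<in> Some ` U})"
    unfolding V_bar_eq by (rule openin_subtopology_Int2)
  moreover have "closure_V \<inter> {p \<in> topspace ambient. fst p \<in> Some ` U} = iota t V G ` U"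
    using closure_V_subset \<open>U \<subseteq> V\<close> iota_in_closure_V unfolding closure_V_eq by (auto simp: iota_def)
  ultimately show "openin (V_bar t V G) (iota t V G ` U)" by simp
qed

lemma compactification_iota: "compactification_map (top_of_set V) (V_bar t V G) (iota t V G)"
  unfolding compactification_map_def
proof (intro conjI)
  show "compact_space (V_bar t V G)"
    unfolding V_bar_eq
    using closedin_compact_space[OF compact_space_ambient closedin_closure_V] by (rule compact_space_subtopology)
  have "continuous_map (top_of_set V) (V_bar t V G) (iota t V G)"
    unfolding V_bar_eq using continuous_iota iota_in_closure_V by (auto simp: continuous_map_in_subtopology)
  moreover have "inj_on (iota t V G) (topspace (top_of_set V))" by (auto simp: inj_on_def iota_def)
  ultimately show "embedding_map (top_of_set V) (V_bar t V G) (iota t V G)"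
    by (rule injective_open_imp_embedding_map[OF _ open_map_iota])
  show "openin (V_bar t V G) (iota t V G ` topspace (top_of_set V))"
    using open_map_iota openin_topspace unfolding open_map_def by blast
  have "iota t V G ` V \<subseteq> closure_V" using iota_in_closure_V by blast
  then show "V_bar t V G closure_of (iota t V G ` topspace (top_of_set V)) = topspace (V_bar t V G)"
    unfolding topspace_V_bar unfolding V_bar_eq
    by (simp add: closure_of_subtopology Int_absorb1 closure_V_def[symmetric])
qed

lemma boundary_V_bar: "topspace (V_bar t V G) - iota t V G ` V = {None} \<times> boundary_lim V G"
  unfolding topspace_V_bar closure_V_eq by (auto simp: iota_def)

end

theorem proposition2p5:
  fixes V :: "(real^'n) set" and G :: "(real^'n \<Rightarrow> real) set" and t0 :: real
  assumes "0 < t0" and "t0 < 1"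
    and "semialgebraic V"
    and "G \<subseteq> cont_sa_funs V"
    and "proper_family V G"
  shows "compactification_map (top_of_set V) (V_bar t0 V G) (iota t0 V G) \<and>
    topspace (V_bar t0 V G) - iota t0 V G ` V = {None} \<times> boundary_lim V G"
proof -
  interpret proper_family_setup V G t0 using assms by unfold_locales
  show ?thesis using compactification_iota boundary_V_bar by blast
qed

end
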